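(* Let $0<\epsilon<1/2$. There is a deterministic dynamic algorithm that, for a set system $(\mathcal{S},\mathcal{E})$ undergoing an arbitrary sequence of element insertions and deletions, maintains after every update a collection $\mathcal{I}\subseteq\mathcal{S}$ that covers all current elements and whose total cost satisfies $c(\mathcal{I})\le (1+\epsilon)f\cdot OPT(\mathcal{S},\mathcal{E})$, with amortized update time $O(f\log(Cn)/\epsilon^2)$.
   Context: Dynamic minimum-cost set cover: $\mathcal{S}$ is a collection of $m$ sets over a universe $\mathcal{E}$ of elements, each set $s$ has a cost $c_s$ with $1/C\le c_s\le 1$ for a parameter $C>1$. An update either inserts a new element $e$ into $\mathcal{E}$, specifying the (at most $f$) sets of $\mathcal{S}$ that contain $e$, or deletes an element from $\mathcal{E}$. Here $f$ is an upper bound on the number of sets containing any element (maximum frequency) and $n$ is the maximum number of elements present at any time. For $\mathcal{I}\subseteq\mathcal{S}$, $c(\mathcal{I})=\sum_{s\in\mathcal{I}}c_s$, and $OPT(\mathcal{S},\mathcal{E})$ is the minimum cost of a subcollection of $\mathcal{S}$ covering $\mathcal{E}$ (an element $e$ is covered by $s$ if $e\in s$). An algorithm has amortized update time $t$ if for every $k$ the total time spent processing the first $k$ updates is at most $kt$.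
   Formalization: log(Cn) is read as log(C·max(2,n)), since for n = 1 and C near 1 the literal bound tends to 0; the universe starts empty, and every inserted element belongs to at least one set, so that a cover exists. *)

theory Defs
  imports Complex_Main
begin

section \<open>Computational model\<close>

text \<open>
  Running time is the number of unit-cost operations of a random access machine with real
  arithmetic. Memory consists of natural-number arrays and real arrays; an array name is a
  constant of the program, indices are computed. Natural numbers (indices, pointers, counters)
  only admit addition and truncated subtraction; reals admit field operations and comparison but
  no rounding to integers. Both restrictions exclude the known abuses of unit-cost arithmetic.
  Programs are finite syntax objects whose only literals are natural numbers.
\<close>

record mem =
  nmem :: "nat \<Rightarrow> nat \<Rightarrow> nat"
  rmem :: "nat \<Rightarrow> nat \<Rightarrow> real"

datatype nexp =
    NConst nat
  | NRead nat nexp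
  | NAdd nexp nexp
  | NSub nexp nexp

datatype rexp =
    ROfNat nexp
  | RRead nat nexp
  | RAdd rexp rexp
  | RSub rexp rexp
  | RMul rexp rexp
  | RDiv rexp rexp

datatype bexp =
    NLess nexp nexp
  | NEq nexp nexp
  | RLess rexp rexp
  | BNot bexp
  | BAnd bexp bexp

datatype com =
    Skip
  | NWrite nat nexp nexp
  | RWrite nat nexp rexp
  | Seq com com
  | Cond bexp com com
  | While bexp com

primrec neval :: "nexp \<Rightarrow> mem \<Rightarrow> nat" where
  "neval (NConst k) \<sigma> = k"
| "neval (NRead a i) \<sigma> = nmem \<sigma> a (neval i \<sigma>)"
| "neval (NAdd x y) \<sigma> = neval x \<sigma> + neval y \<sigma>"
| "neval (NSub x y) \<sigma> = neval x \<sigma> - neval y \<sigma>"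

primrec reval :: "rexp \<Rightarrow> mem \<Rightarrow> real" where
  "reval (ROfNat x) \<sigma> = real (neval x \<sigma>)"
| "reval (RRead a i) \<sigma> = rmem \<sigma> a (neval i \<sigma>)"
| "reval (RAdd x y) \<sigma> = reval x \<sigma> + reval y \<sigma>"
| "reval (RSub x y) \<sigma> = reval x \<sigma> - reval y \<sigma>"
| "reval (RMul x y) \<sigma> = reval x \<sigma> * reval y \<sigma>"
| "reval (RDiv x y) \<sigma> = reval x \<sigma> / reval y \<sigma>"

primrec beval :: "bexp \<Rightarrow> mem \<Rightarrow> bool" where
  "beval (NLess x y) \<sigma> \<longleftrightarrow> neval x \<sigma> < neval y \<sigma>"
| "beval (NEq x y) \<sigma> \<longleftrightarrow> neval x \<sigma> = neval y \<sigma>"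
| "beval (RLess x y) \<sigma> \<longleftrightarrow> reval x \<sigma> < reval y \<sigma>"
| "beval (BNot b) \<sigma> \<longleftrightarrow> \<not> beval b \<sigma>"
| "beval (BAnd b b') \<sigma> \<longleftrightarrow> beval b \<sigma> \<and> beval b' \<sigma>"

text \<open>
  Evaluating an expression costs one unit per node, so that a program cannot hide work in large
  expressions.
\<close>

primrec ncost :: "nexp \<Rightarrow> nat" where
  "ncost (NConst k) = 1"
| "ncost (NRead a i) = 1 + ncost i"
| "ncost (NAdd x y) = 1 + ncost x + ncost y"
| "ncost (NSub x y) = 1 + ncost x + ncost y"

primrec rcost :: "rexp \<Rightarrow> nat" where
  "rcost (ROfNat x) = 1 + ncost x"
| "rcost (RRead a i) = 1 + ncost i"
| "rcost (RAdd x y) = 1 + rcost x + rcost y"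
| "rcost (RSub x y) = 1 + rcost x + rcost y"
| "rcost (RMul x y) = 1 + rcost x + rcost y"
| "rcost (RDiv x y) = 1 + rcost x + rcost y"

primrec bcost :: "bexp \<Rightarrow> nat" where
  "bcost (NLess x y) = 1 + ncost x + ncost y"
| "bcost (NEq x y) = 1 + ncost x + ncost y"
| "bcost (RLess x y) = 1 + rcost x + rcost y"
| "bcost (BNot b) = 1 + bcost b"
| "bcost (BAnd b b') = 1 + bcost b + bcost b'"

text \<open>\<open>exec P \<sigma> t \<sigma>'\<close>: started in \<open>\<sigma>\<close>, the program \<open>P\<close> halts in \<open>\<sigma>'\<close> after time \<open>t\<close>.\<close>

inductive exec :: "com \<Rightarrow> mem \<Rightarrow> nat \<Rightarrow> mem \<Rightarrow> bool" where
  Skip: "exec Skip \<sigma> 1 \<sigma>"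
| NWrite: "exec (NWrite a i x) \<sigma> (1 + ncost i + ncost x)
    (\<sigma>\<lparr>nmem := (nmem \<sigma>)(a := (nmem \<sigma> a)(neval i \<sigma> := neval x \<sigma>))\<rparr>)"
| RWrite: "exec (RWrite a i x) \<sigma> (1 + ncost i + rcost x)
    (\<sigma>\<lparr>rmem := (rmem \<sigma>)(a := (rmem \<sigma> a)(neval i \<sigma> := reval x \<sigma>))\<rparr>)"
| Seq: "\<lbrakk>exec P \<sigma> t \<sigma>'; exec Q \<sigma>' t' \<sigma>''\<rbrakk> \<Longrightarrow> exec (Seq P Q) \<sigma> (t + t') \<sigma>''"
| CondTrue: "\<lbrakk>beval b \<sigma>; exec P \<sigma> t \<sigma>'\<rbrakk> \<Longrightarrow> exec (Cond b P Q) \<sigma> (1 + bcost b + t) \<sigma>'"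
| CondFalse: "\<lbrakk>\<not> beval b \<sigma>; exec Q \<sigma> t \<sigma>'\<rbrakk> \<Longrightarrow> exec (Cond b P Q) \<sigma> (1 + bcost b + t) \<sigma>'"
| WhileFalse: "\<not> beval b \<sigma> \<Longrightarrow> exec (While b P) \<sigma> (1 + bcost b) \<sigma>"
| WhileTrue: "\<lbrakk>beval b \<sigma>; exec P \<sigma> t \<sigma>'; exec (While b P) \<sigma>' t' \<sigma>''\<rbrakk>
    \<Longrightarrow> exec (While b P) \<sigma> (1 + bcost b + t + t') \<sigma>''"

inductive_cases exec_SkipE: "exec Skip \<sigma> t \<sigma>'"
inductive_cases exec_NWriteE: "exec (NWrite a i x) \<sigma> t \<sigma>'"
inductive_cases exec_RWriteE: "exec (RWrite a i x) \<sigma> t \<sigma>'"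
inductive_cases exec_SeqE: "exec (Seq P Q) \<sigma> t \<sigma>'"
inductive_cases exec_CondE: "exec (Cond b P Q) \<sigma> t \<sigma>'"
inductive_cases exec_WhileE: "exec (While b P) \<sigma> t \<sigma>'"

lemma exec_deterministic:
  "\<lbrakk>exec P \<sigma> t \<sigma>'; exec P \<sigma> u \<tau>\<rbrakk> \<Longrightarrow> u = t \<and> \<tau> = \<sigma>'"
proof (induction arbitrary: u \<tau> rule: exec.induct)
  case (Seq P \<sigma> t \<sigma>' Q t' \<sigma>'')
  from Seq.prems show ?case
    by (rule exec_SeqE) (auto dest!: Seq.IH)
next
  case (CondTrue b \<sigma> P t \<sigma>' Q)
  from CondTrue.prems show ?case
    by (rule exec_CondE) (auto dest!: CondTrue.IH simp: CondTrue.hyps)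
next
  case (CondFalse b \<sigma> Q t \<sigma>' P)
  from CondFalse.prems show ?case
    by (rule exec_CondE) (auto dest!: CondFalse.IH simp: CondFalse.hyps)
next
  case (WhileFalse b \<sigma> P)
  from WhileFalse.prems show ?case
    by (rule exec_WhileE) (simp_all add: WhileFalse.hyps)
next
  case (WhileTrue b \<sigma> P t \<sigma>' t' \<sigma>'')
  from WhileTrue.prems show ?case
  proof (rule exec_WhileE)
    assume "\<not> beval b \<sigma>"
    with WhileTrue.hyps(1) show ?thesis by simp
  next
    fix v \<rho> v'
    assume u: "u = Suc (bcost b + v + v')" and 1: "exec P \<sigma> v \<rho>" and 2: "exec (While b P) \<rho> v' \<tau>"
    from WhileTrue.IH(1)[OF 1] have eq: "v = t" "\<rho> = \<sigma>'" by simp_all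
    from WhileTrue.IH(2) 2 have "v' = t' \<and> \<tau> = \<sigma>''" unfolding eq by simp
    with u eq show ?thesis by simp
  qed
qed (erule exec_SkipE exec_NWriteE exec_RWriteE, simp)+


section \<open>Dynamic set systems\<close>

text \<open>
  The collection consists of \<open>m\<close> sets with indices \<open>0, \<dots>, m - 1\<close>; elements are named by natural
  numbers. A set system is a pair of the universe and the family of sets.
\<close>

type_synonym set_system = "nat set \<times> (nat \<Rightarrow> nat set)"

datatype update = Insert nat "nat list" | Delete nat

primrec apply_update :: "update \<Rightarrow> set_system \<Rightarrow> set_system" where
  "apply_update (Insert e ss) X =
     (insert e (fst X), \<lambda>s. if s \<in> set ss then insert e (snd X s) else snd X s)"
| "apply_update (Delete e) X = (fst X - {e}, \<lambda>s. snd X s - {e})"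

definition system_after :: "update list \<Rightarrow> set_system" where
  "system_after us = fold apply_update us ({}, \<lambda>s. {})"

text \<open>An inserted element lies in at least one set, since otherwise no cover exists.\<close>

primrec valid_update :: "nat \<Rightarrow> nat \<Rightarrow> set_system \<Rightarrow> update \<Rightarrow> bool" where
  "valid_update m f X (Insert e ss) \<longleftrightarrow>
     e \<notin> fst X \<and> distinct ss \<and> ss \<noteq> [] \<and> set ss \<subseteq> {..<m} \<and> length ss \<le> f"
| "valid_update m f X (Delete e) \<longleftrightarrow> e \<in> fst X"

definition valid_updates :: "nat \<Rightarrow> nat \<Rightarrow> update list \<Rightarrow> bool" where
  "valid_updates m f us \<longleftrightarrow>
     (\<forall>k<length us. valid_update m f (system_after (take k us)) (us ! k))"

definition max_elements :: "update list \<Rightarrow> nat" where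
  "max_elements us = Max ((\<lambda>k. card (fst (system_after (take k us)))) ` {..length us})"

definition cover :: "set_system \<Rightarrow> nat set \<Rightarrow> bool" where
  "cover X I \<longleftrightarrow> (\<forall>e\<in>fst X. \<exists>s\<in>I. e \<in> snd X s)"

definition total_cost :: "(nat \<Rightarrow> real) \<Rightarrow> nat set \<Rightarrow> real" where
  "total_cost c I = (\<Sum>s\<in>I. c s)"

definition OPT :: "nat \<Rightarrow> (nat \<Rightarrow> real) \<Rightarrow> set_system \<Rightarrow> real" where
  "OPT m c X = Min {total_cost c I | I. I \<subseteq> {..<m} \<and> cover X I}"


section \<open>Dynamic algorithms\<close>

text \<open>
  Initially the memory holds the accuracy, the parameters \<open>C\<close>, \<open>f\<close>, \<open>m\<close> and the set costs, and is
  zero elsewhere. In particular the algorithm is not told the number of elements in advance, and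
  there is no preprocessing whose time would not be counted.
\<close>

definition initial_mem :: "real \<Rightarrow> real \<Rightarrow> nat \<Rightarrow> nat \<Rightarrow> (nat \<Rightarrow> real) \<Rightarrow> mem" where
  "initial_mem \<epsilon> C f m c =
     \<lparr>nmem = (\<lambda>a i. if a = 0 \<and> i = 0 then f else if a = 0 \<and> i = 1 then m else 0),
      rmem = (\<lambda>a i. if a = 0 \<and> i = 0 then \<epsilon> else if a = 0 \<and> i = 1 then C
                    else if a = 1 \<and> i < m then c i else 0)\<rparr>"

text \<open>
  Before each run of the program, natural-number array 1 is overwritten with the description of
  the update: operation code, element, number of sets, indices of the sets.
\<close>

primrec encode_update :: "update \<Rightarrow> nat list" where
  "encode_update (Insert e ss) = [1, e, length ss] @ ss"
| "encode_update (Delete e) = [0, e]"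

definition load_update :: "update \<Rightarrow> mem \<Rightarrow> mem" where
  "load_update u \<sigma> = \<sigma>\<lparr>nmem := (nmem \<sigma>)
     (1 := (\<lambda>i. if i < length (encode_update u) then encode_update u ! i else 0))\<rparr>"

text \<open>The maintained collection is represented by its membership array, natural-number array 2.\<close>

definition solution :: "mem \<Rightarrow> nat set" where
  "solution \<sigma> = {s. nmem \<sigma> 2 s \<noteq> 0}"

text \<open>
  \<open>process P \<sigma> us rs\<close>: started in \<open>\<sigma>\<close>, the program \<open>P\<close> is run once for each update in \<open>us\<close>, and \<open>rs\<close>
  lists the time of each of these runs and the memory after it.
\<close>

primrec process :: "com \<Rightarrow> mem \<Rightarrow> update list \<Rightarrow> (nat \<times> mem) list \<Rightarrow> bool" where
  "process P \<sigma> [] rs \<longleftrightarrow> rs = []"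
| "process P \<sigma> (u # us) rs \<longleftrightarrow>
     (\<exists>t \<sigma>' rs'. rs = (t, \<sigma>') # rs' \<and> exec P (load_update u \<sigma>) t \<sigma>' \<and> process P \<sigma>' us rs')"

definition amortized_time :: "nat list \<Rightarrow> real \<Rightarrow> bool" where
  "amortized_time ts t \<longleftrightarrow> (\<forall>k\<le>length ts. real (sum_list (take k ts)) \<le> real k * t)"

end

theory Submission
  imports Defs
begin

text \<open>
  Every element carries a dual weight such that the weights in a set \<open>s\<close> sum to at most its cost \<open>c s\<close>; the
  solution consists of sets that are tight up to a factor \<open>1 + x\<close>. An element at level \<open>j\<close> has weight
  at most \<open>1 / (1 + x) ^ j\<close>, with equality if it is active. A new element gets weight 0 if one of its
  sets has positive level; otherwise its weight is raised until one of them is tight. A deleted element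
  keeps its weight until, for some level \<open>k\<close>, the deleted elements on levels up to \<open>k\<close> outnumber an
  \<open>x\<close> fraction of the active ones there. Then these levels are rebuilt: the deleted elements are
  dropped, the active ones restart with the weight of level \<open>k + 1\<close>, passive ones take as much
  weight as fits, and the weights of elements in no tight set are raised by factors \<open>1 + x\<close> until all
  are covered. Summation by parts turns the bound on the numbers of deleted elements into a bound on
  their weight, and weak duality gives the approximation ratio. The rebuilding time of active
  elements is charged to the deleted ones; a passive element either becomes active for good or rises
  to level \<open>k + 1\<close>.
\<close>

section \<open>Weakest preconditions with time credits\<close>

text \<open>Lowering weights at a deletion could leave sets in the solution that are no longer
  tight, so the weight of a deleted element stays and enters the cost bound as an error. The
  condition is imposed on prefixes of levels because weights fall geometrically with the level and
  only active elements have a known weight. Tightness and deleted weight cost a factor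
  \<open>1 + x\<close> each, and with \<open>x = \<epsilon> / 4\<close> the product is at most
  \<open>1 + \<epsilon>\<close>. Rebuilding the longest bad prefix repairs all prefixes at once:
  longer ones were good and lose only deleted elements.

  One factor \<open>1 / \<epsilon>\<close> of the running time is the number \<open>M\<close> of
  active elements for which a deleted one pays; the other comes from the number of levels, about
  \<open>ln (C * n) / x\<close>. The levels cannot be fixed beforehand, since the program does not
  know \<open>n\<close>. A new top level is opened only by a rebuild of all levels, when a tight set
  must be filled by live elements of small weight, and this bounds its index.\<close>

text \<open>A run that starts with \<open>n\<close> credits pays one credit per time unit; \<open>Q\<close> receives the rest.\<close>

definition wp :: "com \<Rightarrow> (mem \<Rightarrow> nat \<Rightarrow> bool) \<Rightarrow> mem \<Rightarrow> nat \<Rightarrow> bool" where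
  "wp P Q \<sigma> n \<longleftrightarrow> (\<exists>t \<sigma>'. exec P \<sigma> t \<sigma>' \<and> t \<le> n \<and> Q \<sigma>' (n - t))"

definition nset :: "nat \<Rightarrow> nat \<Rightarrow> nat \<Rightarrow> mem \<Rightarrow> mem" where
  "nset a i v \<sigma> = \<sigma>\<lparr>nmem := (nmem \<sigma>)(a := (nmem \<sigma> a)(i := v))\<rparr>"

definition rset :: "nat \<Rightarrow> nat \<Rightarrow> real \<Rightarrow> mem \<Rightarrow> mem" where
  "rset a i v \<sigma> = \<sigma>\<lparr>rmem := (rmem \<sigma>)(a := (rmem \<sigma> a)(i := v))\<rparr>"

lemma mem_set [simp]:
  "nmem (nset a i v \<sigma>) = (nmem \<sigma>)(a := (nmem \<sigma> a)(i := v))"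
  "rmem (nset a i v \<sigma>) = rmem \<sigma>"
  "rmem (rset a i r \<sigma>) = (rmem \<sigma>)(a := (rmem \<sigma> a)(i := r))"
  "nmem (rset a i r \<sigma>) = nmem \<sigma>"
  by (simp_all add: nset_def rset_def)

lemma wp_Skip [simp]: "wp Skip Q \<sigma> n \<longleftrightarrow> 1 \<le> n \<and> Q \<sigma> (n - 1)"
  unfolding wp_def using exec.Skip[of \<sigma>] by (metis exec_SkipE)

lemma wp_NWrite [simp]:
  "wp (NWrite a i x) Q \<sigma> n \<longleftrightarrow> 1 + ncost i + ncost x \<le> n \<and>
     Q (nset a (neval i \<sigma>) (neval x \<sigma>) \<sigma>) (n - (1 + ncost i + ncost x))"
  by (auto simp: wp_def nset_def elim!: exec_NWriteE intro: exec.NWrite[simplified])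

lemma wp_RWrite [simp]:
  "wp (RWrite a i x) Q \<sigma> n \<longleftrightarrow> 1 + ncost i + rcost x \<le> n \<and>
     Q (rset a (neval i \<sigma>) (reval x \<sigma>) \<sigma>) (n - (1 + ncost i + rcost x))"
  by (auto simp: wp_def rset_def elim!: exec_RWriteE intro: exec.RWrite[simplified])

lemma wp_Seq [simp]: "wp (Seq P R) Q = wp P (wp R Q)"
proof (intro ext iffI)
  fix \<sigma> n
  assume "wp (Seq P R) Q \<sigma> n"
  then obtain t \<sigma>' where e: "exec (Seq P R) \<sigma> t \<sigma>'" "t \<le> n" "Q \<sigma>' (n - t)"
    by (auto simp: wp_def)
  from e(1) obtain t1 t2 \<rho> where "t = t1 + t2" "exec P \<sigma> t1 \<rho>" "exec R \<rho> t2 \<sigma>'"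
    by (rule exec_SeqE)
  with e show "wp P (wp R Q) \<sigma> n"
    unfolding wp_def
    by (intro exI[of _ t1] exI[of _ \<rho>] conjI exI[of _ t2] exI[of _ \<sigma>']) auto
next
  fix \<sigma> n
  assume "wp P (wp R Q) \<sigma> n"
  then obtain t1 \<rho> t2 \<sigma>' where "exec P \<sigma> t1 \<rho>" "t1 \<le> n" "exec R \<rho> t2 \<sigma>'" "t2 \<le> n - t1"
      "Q \<sigma>' (n - t1 - t2)"
    by (auto simp: wp_def)
  then show "wp (Seq P R) Q \<sigma> n"
    unfolding wp_def by (intro exI[of _ "t1 + t2"] exI[of _ \<sigma>']) (auto intro: exec.Seq)
qed

lemma wp_Cond [simp]:
  "wp (Cond b P R) Q \<sigma> n \<longleftrightarrow> 1 + bcost b \<le> n \<and>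
     (if beval b \<sigma> then wp P Q \<sigma> (n - (1 + bcost b)) else wp R Q \<sigma> (n - (1 + bcost b)))"
proof
  assume "wp (Cond b P R) Q \<sigma> n"
  then obtain t \<sigma>' where e: "exec (Cond b P R) \<sigma> t \<sigma>'" "t \<le> n" "Q \<sigma>' (n - t)"
    by (auto simp: wp_def)
  from e(1) show "1 + bcost b \<le> n \<and>
     (if beval b \<sigma> then wp P Q \<sigma> (n - (1 + bcost b)) else wp R Q \<sigma> (n - (1 + bcost b)))"
  proof (rule exec_CondE)
    fix t' assume "t = Suc (bcost b + t')" "beval b \<sigma>" "exec P \<sigma> t' \<sigma>'"
    with e show ?thesis by (auto simp: wp_def intro!: exI[of _ t'] exI[of _ \<sigma>'])
  next
    fix t' assume "t = Suc (bcost b + t')" "\<not> beval b \<sigma>" "exec R \<sigma> t' \<sigma>'"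
    with e show ?thesis by (auto simp: wp_def intro!: exI[of _ t'] exI[of _ \<sigma>'])
  qed
next
  assume a: "1 + bcost b \<le> n \<and>
     (if beval b \<sigma> then wp P Q \<sigma> (n - (1 + bcost b)) else wp R Q \<sigma> (n - (1 + bcost b)))"
  show "wp (Cond b P R) Q \<sigma> n"
  proof (cases "beval b \<sigma>")
    case True
    with a obtain t \<sigma>' where "exec P \<sigma> t \<sigma>'" "t \<le> n - (1 + bcost b)" "Q \<sigma>' (n - (1 + bcost b) - t)"
      by (auto simp: wp_def)
    with a True show ?thesis
      unfolding wp_def
      by (intro exI[of _ "1 + bcost b + t"] exI[of _ \<sigma>']) (auto intro: exec.CondTrue[simplified])
  next
    case False
    with a obtain t \<sigma>' where "exec R \<sigma> t \<sigma>'" "t \<le> n - (1 + bcost b)" "Q \<sigma>' (n - (1 + bcost b) - t)"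
      by (auto simp: wp_def)
    with a False show ?thesis
      unfolding wp_def
      by (intro exI[of _ "1 + bcost b + t"] exI[of _ \<sigma>']) (auto intro: exec.CondFalse[simplified])
  qed
qed

section \<open>Frame conditions: the arrays that a program can write\<close>

primrec nwr :: "com \<Rightarrow> nat set" where
  "nwr Skip = {}"
| "nwr (NWrite a i x) = {a}"
| "nwr (RWrite a i x) = {}"
| "nwr (Seq P Q) = nwr P \<union> nwr Q"
| "nwr (Cond b P Q) = nwr P \<union> nwr Q"
| "nwr (While b P) = nwr P"

primrec rwr :: "com \<Rightarrow> nat set" where
  "rwr Skip = {}"
| "rwr (NWrite a i x) = {}"
| "rwr (RWrite a i x) = {a}"
| "rwr (Seq P Q) = rwr P \<union> rwr Q"
| "rwr (Cond b P Q) = rwr P \<union> rwr Q"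
| "rwr (While b P) = rwr P"

definition frame :: "com \<Rightarrow> mem \<Rightarrow> mem \<Rightarrow> bool" where
  "frame P \<sigma> \<sigma>' \<longleftrightarrow> (\<forall>a. a \<notin> nwr P \<longrightarrow> nmem \<sigma>' a = nmem \<sigma> a) \<and> (\<forall>a. a \<notin> rwr P \<longrightarrow> rmem \<sigma>' a = rmem \<sigma> a)"

lemma exec_frame: "exec P \<sigma> t \<sigma>' \<Longrightarrow> frame P \<sigma> \<sigma>'"
  by (induction rule: exec.induct) (auto simp: frame_def)

lemma frame_refl [simp]: "frame P \<sigma> \<sigma>"
  by (simp add: frame_def)

lemma frame_trans: "frame P \<sigma> \<sigma>' \<Longrightarrow> frame P \<sigma>' \<sigma>'' \<Longrightarrow> frame P \<sigma> \<sigma>''"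
  by (simp add: frame_def)

lemma frame_While [simp]: "frame (While b P) = frame P"
  by (simp add: frame_def fun_eq_iff)

text \<open>Specifications then need to state only what a program changes: that the other arrays are
  as before and that credits do not grow is supplied by the syntax of the program.\<close>

lemma wp_mono_frame:
  assumes "wp P Q0 \<sigma> n" "\<And>\<sigma>' n'. frame P \<sigma> \<sigma>' \<Longrightarrow> n' \<le> n \<Longrightarrow> Q0 \<sigma>' n' \<Longrightarrow> Q \<sigma>' n'"
  shows "wp P Q \<sigma> n"
  using assms unfolding wp_def by (metis diff_le_self exec_frame)

lemma wp_mono: "wp P Q0 \<sigma> n \<Longrightarrow> (\<And>\<sigma>' n'. Q0 \<sigma>' n' \<Longrightarrow> Q \<sigma>' n') \<Longrightarrow> wp P Q \<sigma> n"
  by (rule wp_mono_frame)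

text \<open>Every test costs at least one credit, so no separate variant is needed: the induction
  runs over the credits left. Frame facts relative to the state before the loop need not be part of
  \<open>I\<close>.\<close>

lemma wp_While:
  assumes init: "I \<sigma>0 n0"
    and step: "\<And>\<sigma> n. frame P \<sigma>0 \<sigma> \<Longrightarrow> I \<sigma> n \<Longrightarrow> beval b \<sigma> \<Longrightarrow>
      1 + bcost b \<le> n \<and> wp P I \<sigma> (n - (1 + bcost b))"
    and exit: "\<And>\<sigma> n. frame P \<sigma>0 \<sigma> \<Longrightarrow> I \<sigma> n \<Longrightarrow> \<not> beval b \<sigma> \<Longrightarrow>
      1 + bcost b \<le> n \<and> Q \<sigma> (n - (1 + bcost b))"
  shows "wp (While b P) Q \<sigma>0 n0"
proof -
  have "frame P \<sigma>0 \<sigma> \<Longrightarrow> I \<sigma> n \<Longrightarrow> wp (While b P) Q \<sigma> n" for \<sigma> n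
  proof (induction n arbitrary: \<sigma> rule: less_induct)
    case (less n)
    show ?case
    proof (cases "beval b \<sigma>")
      case True
      with step[OF less.prems] have n: "1 + bcost b \<le> n" and "wp P I \<sigma> (n - (1 + bcost b))"
        by auto
      then obtain t \<sigma>' where e: "exec P \<sigma> t \<sigma>'" "t \<le> n - (1 + bcost b)" "I \<sigma>' (n - (1 + bcost b) - t)"
        by (auto simp: wp_def)
      have "frame P \<sigma>0 \<sigma>'"
        using exec_frame[OF e(1)] less.prems(1) frame_trans by blast
      from less.IH[OF _ this e(3)] n obtain t' \<sigma>'' where
        "exec (While b P) \<sigma>' t' \<sigma>''" "t' \<le> n - (1 + bcost b) - t" "Q \<sigma>'' (n - (1 + bcost b) - t - t')"
        by (auto simp: wp_def)
      with e n True show ?thesis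
        unfolding wp_def
        by (intro exI[of _ "1 + bcost b + t + t'"] exI[of _ \<sigma>'']) (auto intro: exec.WhileTrue[simplified])
    next
      case False
      with exit[OF less.prems] show ?thesis
        unfolding wp_def
        by (intro exI[of _ "1 + bcost b"] exI[of _ \<sigma>]) (auto intro: exec.WhileFalse[simplified])
    qed
  qed
  with init show ?thesis by simp
qed

section \<open>Linked lists in memory\<close>

primrec chain :: "(nat \<Rightarrow> nat) \<Rightarrow> nat \<Rightarrow> nat list \<Rightarrow> bool" where
  "chain nx h [] \<longleftrightarrow> h = 0"
| "chain nx h (y # ys) \<longleftrightarrow> h = Suc y \<and> chain nx (nx y) ys"

lemma chain_upd [simp]: "y \<notin> set ys \<Longrightarrow> chain (nx(y := v)) h ys \<longleftrightarrow> chain nx h ys"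
  by (induction ys arbitrary: h) auto

lemma chain_Suc: "chain nx h ys \<Longrightarrow> 0 < h \<Longrightarrow> \<exists>zs. ys = (h - 1) # zs \<and> chain nx (nx (h - 1)) zs"
  by (cases ys) auto

section \<open>The program\<close>

text \<open>
  An insertion creates a fresh index \<open>t\<close>; the sets containing the element are stored as the segment
  \<open>[start t, start (t + 1))\<close> of a pool. Natural-number arrays: 2 solution, 3 level of a set, 4 pool,
  5 start, 6 live flag, 7 active flag, 8 level of an element, 9 successor in linked lists (which
  store \<open>t + 1\<close>, and 0 at the end), 10 index of a named element, 11 list heads by level, 12 number
  of live active elements by level, 13 number of dead elements by level. Registers (cell 0): 14
  number of indices, 15 top level, 16 and 17 lists of unplaced elements, 18 current element, 19
  position in its segment, 20 current level, 21 starting level of a rebuild, 22 list cursor, 23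
  flag, 24 and 25 prefix sums. Real arrays: 2 weight of a set, 3 weight of an element, 4 weight of
  a level, 5 a register.
\<close>

abbreviation NV :: "nat \<Rightarrow> nexp" where "NV a \<equiv> NRead a (NConst 0)"
abbreviation NSet :: "nat \<Rightarrow> nexp \<Rightarrow> com" where "NSet a x \<equiv> NWrite a (NConst 0) x"
abbreviation cur_set :: nexp where "cur_set \<equiv> NRead 4 (NV 19)"

definition eps1 :: rexp where
  "eps1 = RDiv (RRead 0 (NConst 0)) (ROfNat (NConst 4))"

definition foreach :: "com \<Rightarrow> com" where
  "foreach P = Seq (NSet 19 (NRead 5 (NV 18)))
     (While (NLess (NV 19) (NRead 5 (NAdd (NV 18) (NConst 1))))
        (Seq P (NSet 19 (NAdd (NV 19) (NConst 1)))))"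

definition for_queue :: "com \<Rightarrow> com" where
  "for_queue P = Seq (NSet 22 (NV 16))
     (While (NLess (NConst 0) (NV 22))
        (Seq (NSet 18 (NSub (NV 22) (NConst 1)))
          (Seq P (NSet 22 (NRead 9 (NSub (NV 22) (NConst 1)))))))"

text \<open>The entry of the element itself is overwritten last, because every step of the loop
  still reads its old value.\<close>

definition set_weight :: com where
  "set_weight = Seq (foreach (RWrite 2 cur_set
       (RAdd (RRead 2 cur_set) (RSub (RRead 5 (NConst 0)) (RRead 3 (NV 18))))))
     (RWrite 3 (NV 18) (RRead 5 (NConst 0)))"

definition reset_sets :: com where
  "reset_sets = foreach (Seq (NWrite 2 cur_set (NConst 0)) (NWrite 3 cur_set (NConst 0)))"

definition min_slack :: com where
  "min_slack = foreach (Cond (RLess (RSub (RRead 1 cur_set) (RRead 2 cur_set)) (RRead 5 (NConst 0)))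
     (RWrite 5 (NConst 0) (RSub (RRead 1 cur_set) (RRead 2 cur_set))) Skip)"

definition mark_tight :: com where
  "mark_tight = Seq (NSet 23 (NConst 0))
     (foreach (Cond (RLess (RMul (RAdd (ROfNat (NConst 1)) eps1) (RRead 2 cur_set)) (RRead 1 cur_set)) Skip
       (Seq (NWrite 2 cur_set (NConst 1)) (Seq (NWrite 3 cur_set (NV 20)) (NSet 23 (NConst 1))))))"

definition fill :: com where
  "fill = for_queue (Cond (NEq (NRead 7 (NV 18)) (NConst 0))
     (Seq (RWrite 5 (NConst 0) (RRead 4 (NV 21)))
       (Seq min_slack
         (Seq set_weight
           (Cond (RLess (RRead 5 (NConst 0)) (RRead 4 (NV 21))) Skip
             (NWrite 7 (NV 18) (NConst 1)))))) Skip)"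

definition lift_queue :: com where
  "lift_queue = for_queue (Seq (RWrite 5 (NConst 0) (RRead 4 (NSub (NV 20) (NConst 1)))) set_weight)"

definition place :: com where
  "place = Seq (NWrite 9 (NV 18) (NRead 11 (NV 20)))
     (Seq (NWrite 11 (NV 20) (NAdd (NV 18) (NConst 1)))
       (Seq (NWrite 8 (NV 18) (NV 20))
         (Seq (NWrite 12 (NV 20) (NAdd (NRead 12 (NV 20)) (NRead 7 (NV 18))))
           (Cond (NLess (NV 15) (NV 20)) (NSet 15 (NV 20)) Skip))))"

definition freeze :: com where
  "freeze = Seq (NSet 17 (NConst 0))
     (Seq (While (NLess (NConst 0) (NV 16))
        (Seq (NSet 18 (NSub (NV 16) (NConst 1)))
          (Seq (NSet 16 (NRead 9 (NV 18)))
            (Seq mark_tight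
              (Cond (NEq (NV 23) (NConst 0))
                (Seq (NWrite 9 (NV 18) (NV 17)) (NSet 17 (NAdd (NV 18) (NConst 1))))
                place)))))
       (NSet 16 (NV 17)))"

text \<open>Register 20 starts one above the starting level because each round begins by
  decrementing it.\<close>

definition settle :: com where
  "settle = Seq fill (Seq (NSet 20 (NAdd (NV 21) (NConst 1)))
     (While (NLess (NConst 0) (NV 20))
       (Seq (NSet 20 (NSub (NV 20) (NConst 1))) (Seq freeze lift_queue))))"

definition collect :: com where
  "collect = Seq (NSet 20 (NConst 0)) (Seq (NSet 16 (NConst 0))
     (While (NLess (NV 20) (NV 21))
       (Cond (NEq (NRead 11 (NV 20)) (NConst 0))
         (Seq (NWrite 12 (NV 20) (NConst 0)) (Seq (NWrite 13 (NV 20) (NConst 0))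
           (NSet 20 (NAdd (NV 20) (NConst 1)))))
         (Seq (NSet 18 (NSub (NRead 11 (NV 20)) (NConst 1)))
           (Seq (NWrite 11 (NV 20) (NRead 9 (NV 18)))
             (Seq (Cond (BAnd (BNot (NEq (NRead 6 (NV 18)) (NConst 0))) (BNot (NEq (NRead 7 (NV 18)) (NConst 0))))
                    (RWrite 5 (NConst 0) (RRead 4 (NV 21))) (RWrite 5 (NConst 0) (ROfNat (NConst 0))))
               (Seq set_weight
                 (Seq reset_sets
                   (Cond (NEq (NRead 6 (NV 18)) (NConst 0)) Skip
                     (Seq (NWrite 9 (NV 18) (NV 16)) (NSet 16 (NAdd (NV 18) (NConst 1)))))))))))))"

text \<open>Register 21 is the length of a prefix: the value \<open>i\<close> stands for the levels
  below \<open>i\<close>, and 0 says that no prefix is bad. The last assignment wins, so the longest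
  bad prefix is found.\<close>

definition scan :: com where
  "scan = Seq (NSet 20 (NConst 0)) (Seq (NSet 24 (NConst 0)) (Seq (NSet 25 (NConst 0))
     (Seq (NSet 21 (NConst 0))
       (While (NLess (NV 20) (NAdd (NV 15) (NConst 1)))
         (Seq (NSet 24 (NAdd (NV 24) (NRead 12 (NV 20))))
           (Seq (NSet 25 (NAdd (NV 25) (NRead 13 (NV 20))))
             (Seq (NSet 20 (NAdd (NV 20) (NConst 1)))
               (Cond (RLess (RMul eps1 (ROfNat (NV 24))) (ROfNat (NV 25)))
                 (NSet 21 (NV 20)) Skip))))))))"

definition delete :: com where
  "delete = Seq (NSet 18 (NRead 10 (NRead 1 (NConst 1))))
     (Seq (NWrite 6 (NV 18) (NConst 0))
       (Seq (NWrite 12 (NRead 8 (NV 18)) (NSub (NRead 12 (NRead 8 (NV 18))) (NRead 7 (NV 18))))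
         (Seq (NWrite 13 (NRead 8 (NV 18)) (NAdd (NRead 13 (NRead 8 (NV 18))) (NConst 1)))
           (Seq scan
             (Cond (NLess (NConst 0) (NV 21))
               (Seq (RWrite 4 (NV 21) (RDiv (RRead 4 (NSub (NV 21) (NConst 1))) (RAdd (ROfNat (NConst 1)) eps1)))
                 (Seq collect settle)) Skip)))))"

text \<open>The end of the new segment is at first equal to its start and grows with each set read,
  so it doubles as the write position.\<close>

definition read_sets :: com where
  "read_sets = Seq (NWrite 5 (NAdd (NV 14) (NConst 1)) (NRead 5 (NV 14)))
     (Seq (NSet 19 (NConst 0))
       (While (NLess (NV 19) (NRead 1 (NConst 2)))
         (Seq (NWrite 4 (NRead 5 (NAdd (NV 14) (NConst 1))) (NRead 1 (NAdd (NV 19) (NConst 3))))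
           (Seq (NWrite 5 (NAdd (NV 14) (NConst 1)) (NAdd (NRead 5 (NAdd (NV 14) (NConst 1))) (NConst 1)))
             (NSet 19 (NAdd (NV 19) (NConst 1)))))))"

definition max_level :: com where
  "max_level = Seq (NSet 20 (NConst 0))
     (foreach (Cond (NLess (NV 20) (NRead 3 cur_set)) (NSet 20 (NRead 3 cur_set)) Skip))"

definition insert_element :: com where
  "insert_element = Seq read_sets
     (Seq (NSet 18 (NV 14))
       (Seq (NSet 14 (NAdd (NV 14) (NConst 1)))
         (Seq (NWrite 10 (NRead 1 (NConst 1)) (NV 18))
           (Seq (NWrite 6 (NV 18) (NConst 1))
             (Seq (NWrite 7 (NV 18) (NConst 0))
               (Seq (RWrite 3 (NV 18) (ROfNat (NConst 0)))
                 (Seq max_level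
                   (Cond (NLess (NConst 0) (NV 20)) place
                     (Seq (NWrite 9 (NV 18) (NConst 0))
                       (Seq (NSet 16 (NAdd (NV 18) (NConst 1)))
                         (Seq (NSet 21 (NConst 0)) settle)))))))))))"

definition program :: com where
  "program = Seq (RWrite 4 (NConst 0) (ROfNat (NConst 1)))
     (Cond (NEq (NRead 1 (NConst 0)) (NConst 0)) delete insert_element)"

section \<open>Loops over the sets of an element and over the queue\<close>

text \<open>The order of the sets is irrelevant, so \<open>J\<close> speaks only of the collection
  \<open>D\<close> of those already treated. By \<open>inj\<close> no set is treated twice, which an
  additive update would notice. The credits left are bounded from below, so the costs of consecutive
  programs add up without truncated subtraction.\<close>

lemma wp_foreach:
  assumes disj: "4 \<notin> nwr P" "5 \<notin> nwr P" "18 \<notin> nwr P" "19 \<notin> nwr P"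
    and ab: "nmem \<sigma> 5 (nmem \<sigma> 18 0) = a" "nmem \<sigma> 5 (Suc (nmem \<sigma> 18 0)) = b" "a \<le> b"
    and inj: "inj_on (nmem \<sigma> 4) {a..<b}" and S: "S = nmem \<sigma> 4 ` {a..<b}"
    and n: "(cb + 20) * (b - a) + 20 \<le> n"
    and J0: "J {} \<sigma>"
    and Jmove: "\<And>D \<sigma>' i. J D \<sigma>' \<Longrightarrow> J D (nset 19 0 i \<sigma>')"
    and step: "\<And>D \<sigma>' s k. \<lbrakk>frame (foreach P) \<sigma> \<sigma>'; J D \<sigma>'; D \<subseteq> S; s \<in> S; s \<notin> D;
      nmem \<sigma>' 4 (nmem \<sigma>' 19 0) = s; cb \<le> k\<rbrakk> \<Longrightarrow>
      wp P (\<lambda>\<sigma>'' k'. J (insert s D) \<sigma>'' \<and> k \<le> k' + cb) \<sigma>' k"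
  shows "wp (foreach P) (\<lambda>\<sigma>' n'. J S \<sigma>' \<and> n \<le> n' + ((cb + 20) * (b - a) + 20)) \<sigma> n"
proof -
  \<comment> \<open>Credits that must be left at the end; the invariant demands those of the
    remaining iterations on top.\<close>
  let ?N = "n - ((cb + 20) * (b - a) + 20)"
  define I where "I \<sigma>' k \<longleftrightarrow> frame (foreach P) \<sigma> \<sigma>' \<and> (\<exists>i. nmem \<sigma>' 19 0 = i \<and> a \<le> i \<and> i \<le> b \<and>
    J (nmem \<sigma> 4 ` {a..<i}) \<sigma>' \<and> ?N + (cb + 20) * (b - i) + 10 \<le> k)" for \<sigma>' k
  have fr: "nmem \<sigma>' 5 = nmem \<sigma> 5" "nmem \<sigma>' 18 = nmem \<sigma> 18" "nmem \<sigma>' 4 = nmem \<sigma> 4"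
    if "frame (foreach P) \<sigma> \<sigma>'" for \<sigma>'
    using that disj by (auto simp: frame_def foreach_def)
  have "wp (While (NLess (NV 19) (NRead 5 (NAdd (NV 18) (NConst 1))))
        (Seq P (NSet 19 (NAdd (NV 19) (NConst 1)))))
        (\<lambda>\<sigma>' n'. J S \<sigma>' \<and> n \<le> n' + ((cb + 20) * (b - a) + 20)) (nset 19 0 a \<sigma>) (n - 5)"
  proof (rule wp_While[where I = I], goal_cases)
    case 1
    show ?case
      using n J0 ab(3) by (auto simp: I_def frame_def foreach_def Jmove)
  next
    case (2 \<sigma>' k)
    then obtain i where i: "nmem \<sigma>' 19 0 = i" "a \<le> i" "i \<le> b" "J (nmem \<sigma> 4 ` {a..<i}) \<sigma>'"
      "?N + (cb + 20) * (b - i) + 10 \<le> k" and f: "frame (foreach P) \<sigma> \<sigma>'"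
      by (auto simp: I_def)
    have ib: "i < b"
      using 2(3) i f by (simp add: fr[OF f] ab)
    have k: "?N + (cb + 20) * (b - Suc i) + (cb + 20) + 10 \<le> k"
      using i(5) by (simp add: Suc_diff_Suc[OF ib, symmetric])
    have ins: "insert (nmem \<sigma> 4 i) (nmem \<sigma> 4 ` {a..<i}) = nmem \<sigma> 4 ` {a..<Suc i}"
      using i(2) by (auto simp: atLeastLessThanSuc)
    have new: "nmem \<sigma> 4 i \<notin> nmem \<sigma> 4 ` {a..<i}"
      using inj_on_image_mem_iff[OF inj, of i "{a..<i}"] ib i(2) by auto
    have "wp P (\<lambda>\<sigma>'' k'. J (insert (nmem \<sigma> 4 i) (nmem \<sigma> 4 ` {a..<i})) \<sigma>'' \<and> k - 9 \<le> k' + cb) \<sigma>' (k - 9)"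
      by (rule step[OF f i(4)]) (use i ib k new in \<open>auto simp: S fr[OF f]\<close>)
    then have "wp P (wp (NSet 19 (NAdd (NV 19) (NConst 1))) I) \<sigma>' (k - 9)"
    proof (rule wp_mono_frame)
      fix \<sigma>'' k' assume f2: "frame P \<sigma>' \<sigma>''" and *: "J (insert (nmem \<sigma> 4 i) (nmem \<sigma> 4 ` {a..<i})) \<sigma>'' \<and> k - 9 \<le> k' + cb"
      have "nmem \<sigma>'' 19 = nmem \<sigma>' 19"
        using f2 disj by (auto simp: frame_def)
      moreover have "frame (foreach P) \<sigma> (nset 19 0 (Suc i) \<sigma>'')"
        using f f2 by (auto simp: frame_def foreach_def)
      ultimately show "wp (NSet 19 (NAdd (NV 19) (NConst 1))) I \<sigma>'' k'"
        using i(1,2) ib * k by (auto simp: I_def Jmove ins)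
    qed
    then show ?case
      using k by (simp add: numeral_2_eq_2[symmetric])
  next
    case (3 \<sigma>' k)
    then obtain i where i: "nmem \<sigma>' 19 0 = i" "a \<le> i" "i \<le> b" "J (nmem \<sigma> 4 ` {a..<i}) \<sigma>'"
      "?N + (cb + 20) * (b - i) + 10 \<le> k" and f: "frame (foreach P) \<sigma> \<sigma>'"
      by (auto simp: I_def)
    have "i = b"
      using 3(3) i f by (simp add: fr[OF f] ab)
    with i n show ?case
      by (auto simp: S)
  qed
  then show ?thesis
    using n ab by (simp add: foreach_def numeral_2_eq_2[symmetric])
qed

text \<open>The body may not write array 9, so the successor read after it is still the one of the
  initial chain.\<close>

lemma wp_for_queue:
  assumes disj: "9 \<notin> nwr P" "22 \<notin> nwr P"
    and ch: "chain (nmem \<sigma> 9) (nmem \<sigma> 16 0) qs" and dist: "distinct qs"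
    and n: "(cb + 20) * length qs + 20 \<le> n"
    and J0: "J {} \<sigma>"
    and Jmove: "\<And>D \<sigma>' i. J D \<sigma>' \<Longrightarrow> J D (nset 18 0 i \<sigma>')" "\<And>D \<sigma>' i. J D \<sigma>' \<Longrightarrow> J D (nset 22 0 i \<sigma>')"
    and step: "\<And>D \<sigma>' t k. \<lbrakk>frame (for_queue P) \<sigma> \<sigma>'; J D \<sigma>'; D \<subseteq> set qs; t \<in> set qs; t \<notin> D;
      nmem \<sigma>' 18 0 = t; cb \<le> k\<rbrakk> \<Longrightarrow>
      wp P (\<lambda>\<sigma>'' k'. J (insert t D) \<sigma>'' \<and> k \<le> k' + cb) \<sigma>' k"
  shows "wp (for_queue P) (\<lambda>\<sigma>' n'. J (set qs) \<sigma>' \<and> n \<le> n' + ((cb + 20) * length qs + 20)) \<sigma> n"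
proof -
  let ?N = "n - ((cb + 20) * length qs + 20)"
  define I where "I \<sigma>' k \<longleftrightarrow> frame (for_queue P) \<sigma> \<sigma>' \<and> (\<exists>ds rs. qs = ds @ rs \<and>
    chain (nmem \<sigma> 9) (nmem \<sigma>' 22 0) rs \<and> J (set ds) \<sigma>' \<and> ?N + (cb + 20) * length rs + 10 \<le> k)" for \<sigma>' k
  have fr: "nmem \<sigma>' 9 = nmem \<sigma> 9" if "frame (for_queue P) \<sigma> \<sigma>'" for \<sigma>'
    using that disj by (auto simp: frame_def for_queue_def)
  have "wp (While (NLess (NConst 0) (NV 22))
        (Seq (NSet 18 (NSub (NV 22) (NConst 1)))
          (Seq P (NSet 22 (NRead 9 (NSub (NV 22) (NConst 1)))))))
        (\<lambda>\<sigma>' n'. J (set qs) \<sigma>' \<and> n \<le> n' + ((cb + 20) * length qs + 20)) (nset 22 0 (nmem \<sigma> 16 0) \<sigma>) (n - 4)"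
  proof (rule wp_While[where I = I], goal_cases)
    case 1
    show ?case
      unfolding I_def
      by (intro conjI exI[of _ "[]"] exI[of _ qs])
        (use n J0 ch in \<open>auto simp: frame_def for_queue_def Jmove\<close>)
  next
    case (2 \<sigma>' k)
    then obtain ds rs where i: "qs = ds @ rs" "chain (nmem \<sigma> 9) (nmem \<sigma>' 22 0) rs" "J (set ds) \<sigma>'"
      "?N + (cb + 20) * length rs + 10 \<le> k" and f: "frame (for_queue P) \<sigma> \<sigma>'"
      by (auto simp: I_def)
    define t where "t = nmem \<sigma>' 22 0 - Suc 0"
    obtain rs' where rs: "rs = t # rs'" "chain (nmem \<sigma> 9) (nmem \<sigma> 9 t) rs'"
      using chain_Suc[OF i(2)] 2(3) by (auto simp: t_def)
    have k: "?N + (cb + 20) * length rs' + (cb + 20) + 10 \<le> k"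
      using i(4) rs by simp
    then have ck: "cb + 30 \<le> k"
      by linarith
    let ?\<sigma> = "nset 18 0 t \<sigma>'"
    have f': "frame (for_queue P) \<sigma> ?\<sigma>"
      using f by (auto simp: frame_def for_queue_def)
    have "wp P (\<lambda>\<sigma>'' k'. J (insert t (set ds)) \<sigma>'' \<and> k - 11 \<le> k' + cb) ?\<sigma> (k - 11)"
      by (rule step[OF f' Jmove(1)[OF i(3)]]) (use i(1) rs dist k in auto)
    then have "wp P (wp (NSet 22 (NRead 9 (NSub (NV 22) (NConst 1)))) I) ?\<sigma> (k - 11)"
    proof (rule wp_mono_frame)
      fix \<sigma>'' k' assume f2: "frame P ?\<sigma> \<sigma>''" and *: "J (insert t (set ds)) \<sigma>'' \<and> k - 11 \<le> k' + cb"
      have eq: "nmem \<sigma>'' 22 = nmem \<sigma>' 22" "nmem \<sigma>'' 9 = nmem \<sigma> 9"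
        using f2 disj fr[OF f] by (auto simp: frame_def)
      have f3: "frame (for_queue P) \<sigma> (nset 22 0 i \<sigma>'')" for i
        using f' f2 by (auto simp: frame_def for_queue_def)
      have "I (nset 22 0 (nmem \<sigma> 9 t) \<sigma>'') (k' - 7)"
        unfolding I_def using f3 i(1) rs * k
        by (intro conjI exI[of _ "ds @ [t]"] exI[of _ rs']) (auto simp: Jmove)
      then show "wp (NSet 22 (NRead 9 (NSub (NV 22) (NConst 1)))) I \<sigma>'' k'"
        using * ck by (auto simp: eq t_def[symmetric] numeral_2_eq_2[symmetric])
    qed
    then show ?case
      using k by (simp add: t_def numeral_2_eq_2[symmetric])
  next
    case (3 \<sigma>' k)
    then obtain ds rs where i: "qs = ds @ rs" "chain (nmem \<sigma> 9) (nmem \<sigma>' 22 0) rs" "J (set ds) \<sigma>'"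
      "?N + (cb + 20) * length rs + 10 \<le> k" by (auto simp: I_def)
    then have "rs = []"
      using 3(3) by (cases rs) auto
    with i n show ?case
      by auto
  qed
  then show ?thesis
    using n by (simp add: for_queue_def numeral_2_eq_2[symmetric])
qed

section \<open>Operations on the sets of one element\<close>

definition SS :: "mem \<Rightarrow> nat \<Rightarrow> nat set" where
  "SS \<sigma> t = nmem \<sigma> 4 ` {nmem \<sigma> 5 t..<nmem \<sigma> 5 (Suc t)}"

lemma SS_cong: "nmem \<sigma>' 4 = nmem \<sigma> 4 \<Longrightarrow> nmem \<sigma>' 5 = nmem \<sigma> 5 \<Longrightarrow> SS \<sigma>' = SS \<sigma>"
  by (simp add: SS_def fun_eq_iff)

lemma SS_set [simp]:
  "a \<noteq> 4 \<Longrightarrow> a \<noteq> 5 \<Longrightarrow> SS (nset a i v \<sigma>) = SS \<sigma>"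
  "SS (rset a i r \<sigma>) = SS \<sigma>"
  by (simp_all add: SS_def fun_eq_iff)

text \<open>
  \<open>x\<close> is a quarter of the accuracy, \<open>n\<close> bounds the number of elements, \<open>B\<close> bounds the levels in use,
  and \<open>M\<close> is an integral upper bound of \<open>1 / x\<close>.
\<close>

locale dynamic_cover =
  fixes x C :: real and f m n B M :: nat and c :: "nat \<Rightarrow> real"
  assumes x_pos: "0 < x" and x_le: "x \<le> 1" and C: "1 < C"
    and c_ge: "\<And>s. s < m \<Longrightarrow> 1 / C \<le> c s" and c_le: "\<And>s. s < m \<Longrightarrow> c s \<le> 1"
    and B: "\<And>j. (1 + x) ^ j \<le> (1 + x) * C * real n \<Longrightarrow> j \<le> B"
    and M: "1 \<le> x * real M"
begin

definition p :: "nat \<Rightarrow> real" where "p j = (1 / (1 + x)) ^ j"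

lemma p_pos [simp]: "0 < p j"
  using x_pos by (simp add: p_def)

lemma p_0 [simp]: "p 0 = 1"
  by (simp add: p_def)

lemma p_Suc: "p (Suc j) = p j / (1 + x)"
  by (simp add: p_def)

lemma p_antimono: "i \<le> j \<Longrightarrow> p j \<le> p i"
  unfolding p_def using x_pos by (intro power_decreasing) auto

definition prm :: "mem \<Rightarrow> bool" where
  "prm \<sigma> \<longleftrightarrow> rmem \<sigma> 0 0 = 4 * x \<and> (\<forall>s<m. rmem \<sigma> 1 s = c s)"

definition sys :: "mem \<Rightarrow> bool" where
  "sys \<sigma> \<longleftrightarrow> (\<forall>t<nmem \<sigma> 14 0. nmem \<sigma> 5 t < nmem \<sigma> 5 (Suc t) \<and> nmem \<sigma> 5 (Suc t) \<le> nmem \<sigma> 5 t + f \<and>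
     inj_on (nmem \<sigma> 4) {nmem \<sigma> 5 t..<nmem \<sigma> 5 (Suc t)} \<and> SS \<sigma> t \<subseteq> {..<m})"

lemma sysD:
  assumes "sys \<sigma>" "t < nmem \<sigma> 14 0"
  shows "SS \<sigma> t \<subseteq> {..<m}" "SS \<sigma> t \<noteq> {}" "finite (SS \<sigma> t)" "card (SS \<sigma> t) \<le> f" "1 \<le> f"
proof -
  have *: "nmem \<sigma> 5 t < nmem \<sigma> 5 (Suc t)" "nmem \<sigma> 5 (Suc t) \<le> nmem \<sigma> 5 t + f" "SS \<sigma> t \<subseteq> {..<m}"
    using assms by (auto simp: sys_def)
  show "SS \<sigma> t \<subseteq> {..<m}" "SS \<sigma> t \<noteq> {}" "finite (SS \<sigma> t)" "1 \<le> f"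
    using * by (auto simp: SS_def)
  have "card (SS \<sigma> t) \<le> card {nmem \<sigma> 5 t..<nmem \<sigma> 5 (Suc t)}"
    unfolding SS_def by (rule card_image_le) simp
  then show "card (SS \<sigma> t) \<le> f"
    using * by simp
qed

text \<open>An element has at least one and at most \<open>f\<close> sets, so the constant part of
  the loop cost is absorbed into a multiple of \<open>f\<close>.\<close>

lemma wp_foreach_sys:
  assumes "4 \<notin> nwr P" "5 \<notin> nwr P" "18 \<notin> nwr P" "19 \<notin> nwr P"
    and s: "sys \<sigma>" and t: "nmem \<sigma> 18 0 = t" "t < nmem \<sigma> 14 0"
    and k: "(cb + 40) * f \<le> k"
    and J: "J {} \<sigma>" "\<And>D \<sigma>' i. J D \<sigma>' \<Longrightarrow> J D (nset 19 0 i \<sigma>')"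
    and step: "\<And>D \<sigma>' s k. \<lbrakk>frame (foreach P) \<sigma> \<sigma>'; J D \<sigma>'; D \<subseteq> SS \<sigma> t; s \<in> SS \<sigma> t; s \<notin> D;
      nmem \<sigma>' 4 (nmem \<sigma>' 19 0) = s; cb \<le> k\<rbrakk> \<Longrightarrow>
      wp P (\<lambda>\<sigma>'' k'. J (insert s D) \<sigma>'' \<and> k \<le> k' + cb) \<sigma>' k"
  shows "wp (foreach P) (\<lambda>\<sigma>' k'. J (SS \<sigma> t) \<sigma>' \<and> k \<le> k' + (cb + 40) * f) \<sigma> k"
proof -
  let ?a = "nmem \<sigma> 5 t" and ?b = "nmem \<sigma> 5 (Suc t)"
  have *: "?a < ?b" "?b \<le> ?a + f" "inj_on (nmem \<sigma> 4) {?a..<?b}"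
    using s t by (auto simp: sys_def)
  have "(cb + 20) * (?b - ?a) \<le> (cb + 20) * f"
    using * by (intro mult_le_mono) auto
  moreover have "20 \<le> 20 * f"
    using * by simp
  ultimately have le: "(cb + 20) * (?b - ?a) + 20 \<le> (cb + 40) * f"
    by (simp add: algebra_simps)
  have "wp (foreach P) (\<lambda>\<sigma>' k'. J (SS \<sigma> t) \<sigma>' \<and> k \<le> k' + ((cb + 20) * (?b - ?a) + 20)) \<sigma> k"
    by (rule wp_foreach[where J = J]) (use assms * le in \<open>auto simp: SS_def\<close>)
  then show ?thesis
    by (rule wp_mono) (use le in auto)
qed

section \<open>Specifications of the loops over the sets of one element\<close>

lemma nwr_set_ops [simp]:
  "nwr set_weight = {19}" "rwr set_weight = {2, 3}"
  "nwr reset_sets = {2, 3, 19}" "rwr reset_sets = {}"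
  "nwr min_slack = {19}" "rwr min_slack = {5}"
  "nwr mark_tight = {2, 3, 19, 23}" "rwr mark_tight = {}"
  "nwr max_level = {19, 20}" "rwr max_level = {}"
  by (auto simp: set_weight_def reset_sets_def min_slack_def mark_tight_def max_level_def foreach_def)

lemma wp_set_weight:
  assumes s: "sys \<sigma>" "nmem \<sigma> 18 0 = t" "t < nmem \<sigma> 14 0" and k: "80 * f \<le> k"
  shows "wp set_weight (\<lambda>\<sigma>' k'. k \<le> k' + 80 * f \<and>
      rmem \<sigma>' 2 = (\<lambda>s. rmem \<sigma> 2 s + (if s \<in> SS \<sigma> t then rmem \<sigma> 5 0 - rmem \<sigma> 3 t else 0)) \<and>
      rmem \<sigma>' 3 = (rmem \<sigma> 3)(t := rmem \<sigma> 5 0)) \<sigma> k"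
proof -
  let ?P = "RWrite 2 cur_set (RAdd (RRead 2 cur_set) (RSub (RRead 5 (NConst 0)) (RRead 3 (NV 18))))"
  define J where "J D \<sigma>' \<longleftrightarrow>
    rmem \<sigma>' 2 = (\<lambda>s. rmem \<sigma> 2 s + (if s \<in> D then rmem \<sigma> 5 0 - rmem \<sigma> 3 t else 0))" for D and \<sigma>' :: mem
  have f: "1 \<le> f"
    using sysD s by blast
  have "wp (foreach ?P) (\<lambda>\<sigma>' k'. J (SS \<sigma> t) \<sigma>' \<and> k \<le> k' + (15 + 40) * f) \<sigma> k"
    by (rule wp_foreach_sys[OF _ _ _ _ s])
      (use k s in \<open>auto simp: J_def fun_eq_iff frame_def foreach_def numeral_2_eq_2[symmetric]\<close>)
  then show ?thesis
    unfolding set_weight_def wp_Seq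
    by (rule wp_mono_frame)
      (use f s k in \<open>auto simp: J_def frame_def foreach_def numeral_2_eq_2[symmetric]\<close>)
qed

lemma wp_reset_sets:
  assumes s: "sys \<sigma>" "nmem \<sigma> 18 0 = t" "t < nmem \<sigma> 14 0" and k: "80 * f \<le> k"
  shows "wp reset_sets (\<lambda>\<sigma>' k'. k \<le> k' + 80 * f \<and>
      nmem \<sigma>' 2 = (\<lambda>s. if s \<in> SS \<sigma> t then 0 else nmem \<sigma> 2 s) \<and>
      nmem \<sigma>' 3 = (\<lambda>s. if s \<in> SS \<sigma> t then 0 else nmem \<sigma> 3 s)) \<sigma> k"
proof -
  let ?P = "Seq (NWrite 2 cur_set (NConst 0)) (NWrite 3 cur_set (NConst 0))"
  define J where "J D \<sigma>' \<longleftrightarrow> nmem \<sigma>' 2 = (\<lambda>s. if s \<in> D then 0 else nmem \<sigma> 2 s) \<and>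
    nmem \<sigma>' 3 = (\<lambda>s. if s \<in> D then 0 else nmem \<sigma> 3 s)" for D and \<sigma>' :: mem
  have "wp (foreach ?P) (\<lambda>\<sigma>' k'. J (SS \<sigma> t) \<sigma>' \<and> k \<le> k' + (40 + 40) * f) \<sigma> k"
    by (rule wp_foreach_sys[OF _ _ _ _ s])
      (use k s in \<open>auto simp: J_def fun_eq_iff frame_def foreach_def numeral_2_eq_2[symmetric]\<close>)
  then show ?thesis
    unfolding reset_sets_def by (rule wp_mono) (auto simp: J_def)
qed

lemma wp_min_slack:
  assumes s: "sys \<sigma>" "nmem \<sigma> 18 0 = t" "t < nmem \<sigma> 14 0" and k: "80 * f \<le> k" and prm: "prm \<sigma>"
  shows "wp min_slack (\<lambda>\<sigma>' k'. k \<le> k' + 80 * f \<and>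
      rmem \<sigma>' 5 0 \<le> rmem \<sigma> 5 0 \<and> (\<forall>s\<in>SS \<sigma> t. rmem \<sigma>' 5 0 \<le> c s - rmem \<sigma> 2 s) \<and>
      (rmem \<sigma>' 5 0 = rmem \<sigma> 5 0 \<or> (\<exists>s\<in>SS \<sigma> t. rmem \<sigma>' 5 0 = c s - rmem \<sigma> 2 s))) \<sigma> k"
proof -
  let ?P = "Cond (RLess (RSub (RRead 1 cur_set) (RRead 2 cur_set)) (RRead 5 (NConst 0)))
     (RWrite 5 (NConst 0) (RSub (RRead 1 cur_set) (RRead 2 cur_set))) Skip"
  define J where "J D \<sigma>' \<longleftrightarrow> rmem \<sigma>' 5 0 \<le> rmem \<sigma> 5 0 \<and> (\<forall>s\<in>D. rmem \<sigma>' 5 0 \<le> c s - rmem \<sigma> 2 s) \<and>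
    (rmem \<sigma>' 5 0 = rmem \<sigma> 5 0 \<or> (\<exists>s\<in>D. rmem \<sigma>' 5 0 = c s - rmem \<sigma> 2 s))" for D and \<sigma>' :: mem
  have sub: "SS \<sigma> t \<subseteq> {..<m}"
    using sysD s by blast
  have "wp (foreach ?P) (\<lambda>\<sigma>' k'. J (SS \<sigma> t) \<sigma>' \<and> k \<le> k' + (40 + 40) * f) \<sigma> k"
  proof (rule wp_foreach_sys[OF _ _ _ _ s], goal_cases)
    case (8 D \<sigma>' s k)
    then have "rmem \<sigma>' 1 s = c s" "rmem \<sigma>' 2 = rmem \<sigma> 2"
      using sub prm by (auto simp: frame_def foreach_def prm_def)
    with 8 show ?case
      by (auto simp: J_def numeral_2_eq_2[symmetric])
  qed (use k in \<open>auto simp: J_def\<close>)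
  then show ?thesis
    unfolding min_slack_def by (rule wp_mono) (auto simp: J_def)
qed

definition tight :: "mem \<Rightarrow> nat \<Rightarrow> bool" where
  "tight \<sigma> s \<longleftrightarrow> c s \<le> (1 + x) * rmem \<sigma> 2 s"

lemma wp_mark_tight:
  assumes s: "sys \<sigma>" "nmem \<sigma> 18 0 = t" "t < nmem \<sigma> 14 0" and k: "120 * f \<le> k" and prm: "prm \<sigma>"
  shows "wp mark_tight (\<lambda>\<sigma>' k'. k \<le> k' + 120 * f \<and>
      (nmem \<sigma>' 23 0 = 0 \<longleftrightarrow> (\<forall>s\<in>SS \<sigma> t. \<not> tight \<sigma> s)) \<and>
      nmem \<sigma>' 2 = (\<lambda>s. if s \<in> SS \<sigma> t \<and> tight \<sigma> s then 1 else nmem \<sigma> 2 s) \<and>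
      nmem \<sigma>' 3 = (\<lambda>s. if s \<in> SS \<sigma> t \<and> tight \<sigma> s then nmem \<sigma> 20 0 else nmem \<sigma> 3 s)) \<sigma> k"
proof -
  let ?P = "Cond (RLess (RMul (RAdd (ROfNat (NConst 1)) eps1) (RRead 2 cur_set)) (RRead 1 cur_set)) Skip
       (Seq (NWrite 2 cur_set (NConst 1)) (Seq (NWrite 3 cur_set (NV 20)) (NSet 23 (NConst 1))))"
  define J where "J D \<sigma>' \<longleftrightarrow> (nmem \<sigma>' 23 0 = 0 \<longleftrightarrow> (\<forall>s\<in>D. \<not> tight \<sigma> s)) \<and>
      nmem \<sigma>' 2 = (\<lambda>s. if s \<in> D \<and> tight \<sigma> s then 1 else nmem \<sigma> 2 s) \<and>
      nmem \<sigma>' 3 = (\<lambda>s. if s \<in> D \<and> tight \<sigma> s then nmem \<sigma> 20 0 else nmem \<sigma> 3 s)" for D and \<sigma>' :: mem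
  let ?\<sigma> = "nset 23 0 0 \<sigma>"
  have sub: "SS \<sigma> t \<subseteq> {..<m}" and f: "1 \<le> f"
    using sysD s by blast+
  have s': "sys ?\<sigma>"
    using s(1) by (simp add: sys_def)
  have "wp (foreach ?P) (\<lambda>\<sigma>' k'. J (SS ?\<sigma> t) \<sigma>' \<and> k - 3 \<le> k' + (60 + 40) * f) ?\<sigma> (k - 3)"
  proof (rule wp_foreach_sys[OF _ _ _ _ s'], goal_cases)
    case (10 D \<sigma>' s k)
    then have "rmem \<sigma>' 1 s = c s" "rmem \<sigma>' 2 = rmem \<sigma> 2" "rmem \<sigma>' 0 0 = 4 * x" "nmem \<sigma>' 20 = nmem \<sigma> 20"
      using sub prm by (auto simp: frame_def foreach_def prm_def)
    with 10 show ?case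
      by (auto simp: J_def numeral_2_eq_2[symmetric] eps1_def tight_def not_le fun_eq_iff)
  qed (use k f s in \<open>auto simp: J_def\<close>)
  then have "wp (foreach ?P) (\<lambda>\<sigma>' k'. J (SS \<sigma> t) \<sigma>' \<and> k \<le> k' + 120 * f) ?\<sigma> (k - 3)"
    by (rule wp_mono) (use f in auto)
  then show ?thesis
    using k f by (simp add: mark_tight_def numeral_2_eq_2[symmetric] J_def conj_ac cong: conj_cong)
qed

lemma wp_max_level:
  assumes s: "sys \<sigma>" "nmem \<sigma> 18 0 = t" "t < nmem \<sigma> 14 0" and k: "80 * f \<le> k"
  shows "wp max_level (\<lambda>\<sigma>' k'. k \<le> k' + 80 * f \<and>
      (\<forall>s\<in>SS \<sigma> t. nmem \<sigma> 3 s \<le> nmem \<sigma>' 20 0) \<and>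
      (nmem \<sigma>' 20 0 = 0 \<or> (\<exists>s\<in>SS \<sigma> t. nmem \<sigma> 3 s = nmem \<sigma>' 20 0))) \<sigma> k"
proof -
  let ?P = "Cond (NLess (NV 20) (NRead 3 cur_set)) (NSet 20 (NRead 3 cur_set)) Skip"
  define J where "J D \<sigma>' \<longleftrightarrow> (\<forall>s\<in>D. nmem \<sigma> 3 s \<le> nmem \<sigma>' 20 0) \<and>
      (nmem \<sigma>' 20 0 = 0 \<or> (\<exists>s\<in>D. nmem \<sigma> 3 s = nmem \<sigma>' 20 0))" for D and \<sigma>' :: mem
  let ?\<sigma> = "nset 20 0 0 \<sigma>"
  have f: "1 \<le> f"
    using sysD s by blast+
  have s': "sys ?\<sigma>"
    using s(1) by (simp add: sys_def)
  have "wp (foreach ?P) (\<lambda>\<sigma>' k'. J (SS ?\<sigma> t) \<sigma>' \<and> k - 3 \<le> k' + (30 + 40) * f) ?\<sigma> (k - 3)"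
  proof (rule wp_foreach_sys[OF _ _ _ _ s'], goal_cases)
    case (10 D \<sigma>' s k)
    then have "nmem \<sigma>' 3 = nmem \<sigma> 3"
      by (auto simp: frame_def foreach_def)
    with 10 show ?case
      by (auto simp: J_def numeral_2_eq_2[symmetric] intro: le_trans[OF _ less_imp_le])
  qed (use k f s in \<open>auto simp: J_def\<close>)
  then have "wp (foreach ?P) (\<lambda>\<sigma>' k'. J (SS \<sigma> t) \<sigma>' \<and> k \<le> k' + 80 * f) ?\<sigma> (k - 3)"
    by (rule wp_mono) (use f in auto)
  then show ?thesis
    using k f by (simp add: max_level_def numeral_2_eq_2[symmetric] J_def conj_ac cong: conj_cong)
qed

section \<open>Invariants\<close>

text \<open>All indices ever created are summed, deleted ones included: these keep their weight
  until they are purged and have weight 0 afterwards.\<close>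

definition load :: "mem \<Rightarrow> (nat \<Rightarrow> real) \<Rightarrow> nat \<Rightarrow> real" where
  "load \<sigma> g s = (\<Sum>t | t < nmem \<sigma> 14 0 \<and> s \<in> SS \<sigma> t. g t)"

lemma load_upd:
  assumes "t < nmem \<sigma> 14 0"
  shows "load \<sigma> (g(t := v)) s = load \<sigma> g s + (if s \<in> SS \<sigma> t then v - g t else 0)"
proof (cases "s \<in> SS \<sigma> t")
  case True
  let ?A = "{t. t < nmem \<sigma> 14 0 \<and> s \<in> SS \<sigma> t}"
  have fin: "finite ?A" and t: "t \<in> ?A"
    using assms True by auto
  have "(\<Sum>u\<in>?A - {t}. (g(t := v)) u) = (\<Sum>u\<in>?A - {t}. g u)"
    by (rule sum.cong) auto
  then show ?thesis
    using sum.remove[OF fin t, of g] sum.remove[OF fin t, of "g(t := v)"] True by (simp add: load_def)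
next
  case False
  then have "load \<sigma> (g(t := v)) s = load \<sigma> g s"
    unfolding load_def by (intro sum.cong) auto
  with False show ?thesis by simp
qed

lemma load_cong:
  "SS \<sigma>' = SS \<sigma> \<Longrightarrow> nmem \<sigma>' 14 0 = nmem \<sigma> 14 0 \<Longrightarrow> load \<sigma>' = load \<sigma>"
  by (simp add: load_def fun_eq_iff)

lemma load_mono: "(\<And>t. t < nmem \<sigma> 14 0 \<Longrightarrow> s \<in> SS \<sigma> t \<Longrightarrow> g t \<le> h t) \<Longrightarrow> load \<sigma> g s \<le> load \<sigma> h s"
  unfolding load_def by (rule sum_mono) auto

definition wsum :: "mem \<Rightarrow> bool" where
  "wsum \<sigma> \<longleftrightarrow> (\<forall>s<m. rmem \<sigma> 2 s = load \<sigma> (rmem \<sigma> 3) s)"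

lemma wsum_set_weight:
  assumes "wsum \<sigma>" "t < nmem \<sigma> 14 0" "SS \<sigma>' = SS \<sigma>" "nmem \<sigma>' 14 0 = nmem \<sigma> 14 0"
    and "rmem \<sigma>' 2 = (\<lambda>s. rmem \<sigma> 2 s + (if s \<in> SS \<sigma> t then v - rmem \<sigma> 3 t else 0))"
    and "rmem \<sigma>' 3 = (rmem \<sigma> 3)(t := v)"
  shows "wsum \<sigma>'"
  using assms unfolding wsum_def by (simp add: load_cong[OF assms(3,4)] load_upd)

text \<open>
  \<open>L j\<close> is the list of the elements placed at level \<open>j\<close>, which include deleted ones that have not
  been purged yet, and \<open>Q\<close> the set of the live elements waiting to be placed.
\<close>

definition lists :: "(nat \<Rightarrow> nat list) \<Rightarrow> nat set \<Rightarrow> mem \<Rightarrow> bool" where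
  "lists L Q \<sigma> \<longleftrightarrow> (\<forall>j. chain (nmem \<sigma> 9) (nmem \<sigma> 11 j) (L j) \<and> distinct (L j)) \<and>
     (\<forall>j. \<forall>t\<in>set (L j). t < nmem \<sigma> 14 0 \<and> nmem \<sigma> 8 t = j) \<and>
     (\<forall>t\<in>Q. t < nmem \<sigma> 14 0 \<and> nmem \<sigma> 6 t \<noteq> 0 \<and> (\<forall>j. t \<notin> set (L j))) \<and>
     (\<forall>t<nmem \<sigma> 14 0. nmem \<sigma> 6 t \<noteq> 0 \<longrightarrow> t \<in> Q \<or> t \<in> set (L (nmem \<sigma> 8 t))) \<and>
     (\<forall>t<nmem \<sigma> 14 0. nmem \<sigma> 7 t \<le> 1)"

text \<open>The exact weight of live active elements is what deleted weight is later compared with;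
  deleted elements only need the upper bound. The last clause makes purged elements harmless in
  \<open>load\<close>.\<close>

definition weights :: "(nat \<Rightarrow> nat list) \<Rightarrow> nat set \<Rightarrow> mem \<Rightarrow> bool" where
  "weights L Q \<sigma> \<longleftrightarrow> wsum \<sigma> \<and> (\<forall>s<m. rmem \<sigma> 2 s \<le> c s) \<and> (\<forall>t<nmem \<sigma> 14 0. 0 \<le> rmem \<sigma> 3 t) \<and>
     (\<forall>j. \<forall>t\<in>set (L j). rmem \<sigma> 3 t \<le> p j \<and> (nmem \<sigma> 6 t \<noteq> 0 \<and> nmem \<sigma> 7 t \<noteq> 0 \<longrightarrow> rmem \<sigma> 3 t = p j)) \<and>
     (\<forall>t<nmem \<sigma> 14 0. t \<notin> Q \<longrightarrow> (\<forall>j. t \<notin> set (L j)) \<longrightarrow> rmem \<sigma> 3 t = 0)"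

text \<open>Level 0 is shared with the sets outside the solution, hence the separate membership
  array. Because no set lies above one of its elements, the sets met while clearing the low levels
  never belong to a high level. The parameter \<open>J\<close> suspends the covering clause on the
  levels that are being rebuilt.\<close>

definition sets :: "nat \<Rightarrow> (nat \<Rightarrow> nat list) \<Rightarrow> mem \<Rightarrow> bool" where
  "sets J L \<sigma> \<longleftrightarrow> (\<forall>s. 0 < nmem \<sigma> 3 s \<longrightarrow> nmem \<sigma> 2 s \<noteq> 0) \<and>
     (\<forall>s. nmem \<sigma> 2 s \<noteq> 0 \<longrightarrow> s < m \<and> tight \<sigma> s) \<and>
     (\<forall>s. nmem \<sigma> 3 s \<le> nmem \<sigma> 15 0) \<and>
     (\<forall>j. \<forall>t\<in>set (L j). \<forall>s\<in>SS \<sigma> t. nmem \<sigma> 3 s \<le> j) \<and>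
     (\<forall>j\<ge>J. \<forall>t\<in>set (L j). nmem \<sigma> 6 t \<noteq> 0 \<longrightarrow> (\<exists>s\<in>SS \<sigma> t. nmem \<sigma> 2 s \<noteq> 0 \<and> nmem \<sigma> 3 s = j))"

definition mid :: "nat \<Rightarrow> (nat \<Rightarrow> nat list) \<Rightarrow> nat set \<Rightarrow> mem \<Rightarrow> bool" where
  "mid J L Q \<sigma> \<longleftrightarrow> prm \<sigma> \<and> sys \<sigma> \<and> lists L Q \<sigma> \<and> weights L Q \<sigma> \<and> sets J L \<sigma>"

definition count :: "(nat \<Rightarrow> nat list) \<Rightarrow> mem \<Rightarrow> nat \<Rightarrow> bool" where
  "count L \<sigma> i \<longleftrightarrow> nmem \<sigma> 12 i = card {t \<in> set (L i). nmem \<sigma> 6 t \<noteq> 0 \<and> nmem \<sigma> 7 t \<noteq> 0} \<and>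
     nmem \<sigma> 13 i = card {t \<in> set (L i). nmem \<sigma> 6 t = 0}"

section \<open>Stability of the invariants under changes of weights\<close>

lemma sys_cong:
  "nmem \<sigma>' 4 = nmem \<sigma> 4 \<Longrightarrow> nmem \<sigma>' 5 = nmem \<sigma> 5 \<Longrightarrow> nmem \<sigma>' 14 = nmem \<sigma> 14 \<Longrightarrow> sys \<sigma>' = sys \<sigma>"
  by (simp add: sys_def SS_def)

lemma tight_cong: "rmem \<sigma>' 2 = rmem \<sigma> 2 \<Longrightarrow> tight \<sigma>' = tight \<sigma>"
  by (simp add: tight_def fun_eq_iff)

lemma weights_set_weight:
  assumes w: "weights L Q \<sigma>" and t: "t < nmem \<sigma> 14 0" "t \<in> Q" "\<And>j. t \<notin> set (L j)" and v: "0 \<le> v"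
    and S: "SS \<sigma>' = SS \<sigma>" and N: "nmem \<sigma>' 14 0 = nmem \<sigma> 14 0" "nmem \<sigma>' 6 = nmem \<sigma> 6"
    and act: "\<And>u. u \<noteq> t \<Longrightarrow> nmem \<sigma>' 7 u = nmem \<sigma> 7 u"
    and r2: "rmem \<sigma>' 2 = (\<lambda>s. rmem \<sigma> 2 s + (if s \<in> SS \<sigma> t then v - rmem \<sigma> 3 t else 0))"
    and r3: "rmem \<sigma>' 3 = (rmem \<sigma> 3)(t := v)"
    and le: "\<And>s. s \<in> SS \<sigma> t \<Longrightarrow> s < m \<Longrightarrow> rmem \<sigma> 2 s + (v - rmem \<sigma> 3 t) \<le> c s"
  shows "weights L Q \<sigma>'"
proof -
  have "wsum \<sigma>'"
    by (rule wsum_set_weight[OF _ t(1) S N(1) r2 r3]) (use w in \<open>simp add: weights_def\<close>)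
  moreover have "rmem \<sigma>' 2 s \<le> c s" if "s < m" for s
    using that le w by (auto simp: r2 weights_def)
  moreover have "\<forall>j. \<forall>u\<in>set (L j). rmem \<sigma>' 3 u \<le> p j \<and>
      (nmem \<sigma>' 6 u \<noteq> 0 \<and> nmem \<sigma>' 7 u \<noteq> 0 \<longrightarrow> rmem \<sigma>' 3 u = p j)"
  proof (intro allI ballI)
    fix j u assume u: "u \<in> set (L j)"
    then have "u \<noteq> t" using t(3) by auto
    with u w show "rmem \<sigma>' 3 u \<le> p j \<and> (nmem \<sigma>' 6 u \<noteq> 0 \<and> nmem \<sigma>' 7 u \<noteq> 0 \<longrightarrow> rmem \<sigma>' 3 u = p j)"
      by (simp add: weights_def r3 N act)
  qed
  ultimately show ?thesis
    using w v t(2) unfolding weights_def by (auto simp: r3 N)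
qed

lemma sets_increase:
  assumes s: "sets J L \<sigma>" and eq: "nmem \<sigma>' 2 = nmem \<sigma> 2" "nmem \<sigma>' 3 = nmem \<sigma> 3" "nmem \<sigma>' 15 = nmem \<sigma> 15"
    "nmem \<sigma>' 6 = nmem \<sigma> 6" "SS \<sigma>' = SS \<sigma>" and le: "\<And>s. s < m \<Longrightarrow> rmem \<sigma> 2 s \<le> rmem \<sigma>' 2 s"
  shows "sets J L \<sigma>'"
proof -
  have "tight \<sigma>' s" if "s < m" "tight \<sigma> s" for s
    unfolding tight_def
    using that(2)[unfolded tight_def] mult_left_mono[OF le[OF that(1)], of "1 + x"] x_pos by linarith
  then show ?thesis
    using s unfolding sets_def eq by auto
qed

section \<open>Distributing weight among unplaced elements\<close>

lemma nwr_queue_ops [simp]: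
  "nwr fill = {7, 18, 19, 22}" "rwr fill = {2, 3, 5}"
  "nwr lift_queue = {18, 19, 22}" "rwr lift_queue = {2, 3, 5}"
  by (auto simp: fill_def lift_queue_def for_queue_def)

text \<open>A passive element that stops short of \<open>p kk\<close> has met the slack of one of
  its sets, which is then full and hence tight. This is why elements that stay passive leave the
  queue in the first round of settling.\<close>

lemma wp_fill:
  assumes mid: "mid 0 L (set qs) \<sigma>"
    and ch: "chain (nmem \<sigma> 9) (nmem \<sigma> 16 0) qs" and dist: "distinct qs"
    and pw: "rmem \<sigma> 4 (nmem \<sigma> 21 0) = p kk"
    and Q: "\<And>t. t \<in> set qs \<Longrightarrow> rmem \<sigma> 3 t = (if nmem \<sigma> 7 t = 0 then 0 else p kk)"
    and k: "300 * f * length qs + 20 \<le> k"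
  shows "wp fill (\<lambda>\<sigma>' k'. k \<le> k' + 300 * f * length qs + 20 \<and> mid 0 L (set qs) \<sigma>' \<and>
      (\<forall>t. t \<notin> set qs \<longrightarrow> nmem \<sigma>' 7 t = nmem \<sigma> 7 t) \<and>
      (\<forall>t\<in>set qs. rmem \<sigma>' 3 t \<le> p kk \<and> (nmem \<sigma>' 7 t \<noteq> 0 \<longrightarrow> rmem \<sigma>' 3 t = p kk) \<and>
        (nmem \<sigma> 7 t \<noteq> 0 \<longrightarrow> nmem \<sigma>' 7 t \<noteq> 0) \<and> (nmem \<sigma>' 7 t = 0 \<longrightarrow> (\<exists>s\<in>SS \<sigma> t. tight \<sigma>' s)))) \<sigma> k"
proof -
  define J where "J D \<sigma>' \<longleftrightarrow> weights L (set qs) \<sigma>' \<and> (\<forall>t<nmem \<sigma> 14 0. nmem \<sigma>' 7 t \<le> 1) \<and>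
    (\<forall>t\<in>set qs - D. nmem \<sigma>' 7 t = nmem \<sigma> 7 t \<and> rmem \<sigma>' 3 t = rmem \<sigma> 3 t) \<and>
    (\<forall>t. t \<notin> set qs \<longrightarrow> nmem \<sigma>' 7 t = nmem \<sigma> 7 t) \<and>
    (\<forall>t\<in>D. rmem \<sigma>' 3 t \<le> p kk \<and> (nmem \<sigma>' 7 t \<noteq> 0 \<longrightarrow> rmem \<sigma>' 3 t = p kk) \<and>
        (nmem \<sigma> 7 t \<noteq> 0 \<longrightarrow> nmem \<sigma>' 7 t \<noteq> 0) \<and> (nmem \<sigma>' 7 t = 0 \<longrightarrow> (\<exists>s\<in>SS \<sigma> t. c s \<le> rmem \<sigma>' 2 s))) \<and>
    (\<forall>s<m. rmem \<sigma> 2 s \<le> rmem \<sigma>' 2 s) \<and>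
    nmem \<sigma>' 4 = nmem \<sigma> 4 \<and> nmem \<sigma>' 5 = nmem \<sigma> 5 \<and> nmem \<sigma>' 14 = nmem \<sigma> 14 \<and> nmem \<sigma>' 6 = nmem \<sigma> 6" for D and \<sigma>' :: mem
  have li: "lists L (set qs) \<sigma>" and we: "weights L (set qs) \<sigma>" and sy: "sys \<sigma>" and pr: "prm \<sigma>"
    and se: "sets 0 L \<sigma>"
    using mid by (auto simp: mid_def)
  have qN: "t < nmem \<sigma> 14 0" "\<And>j. t \<notin> set (L j)" if "t \<in> set qs" for t
    using li that by (auto simp: lists_def)
  have f: "1 \<le> f" if "t \<in> set qs" for t
    using that qN sysD(5)[OF sy] by blast
  have cost: "(220 * f + 20) * length qs \<le> 300 * f * length qs"
  proof (cases qs)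
    case (Cons t ts)
    then have "220 * f + 20 \<le> 300 * f" using f[of t] by simp
    then show ?thesis by (rule mult_le_mono1)
  qed simp
  have "wp fill (\<lambda>\<sigma>' k'. J (set qs) \<sigma>' \<and> k \<le> k' + ((220 * f + 20) * length qs + 20)) \<sigma> k"
    unfolding fill_def
  proof (rule wp_for_queue[OF _ _ ch dist], goal_cases)
    case 3
    show ?case using k cost by linarith
  next
    case 4
    show ?case using we li by (simp add: J_def lists_def)
  next
    case (5 D \<sigma>' i)
    then show ?case
      by (auto simp: J_def weights_def wsum_def load_def)
  next
    case (6 D \<sigma>' i)
    then show ?case
      by (auto simp: J_def weights_def wsum_def load_def)
  next
    case (7 D \<sigma>1 t k1)
    have fr: "nmem \<sigma>1 4 = nmem \<sigma> 4" "nmem \<sigma>1 5 = nmem \<sigma> 5" "nmem \<sigma>1 14 = nmem \<sigma> 14" "nmem \<sigma>1 21 = nmem \<sigma> 21"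
      "rmem \<sigma>1 4 = rmem \<sigma> 4" "rmem \<sigma>1 0 = rmem \<sigma> 0" "rmem \<sigma>1 1 = rmem \<sigma> 1"
      using 7(1) by (auto simp: frame_def for_queue_def)
    have S1: "SS \<sigma>1 = SS \<sigma>" using fr by (simp add: SS_def fun_eq_iff)
    note f = f[OF 7(4)]
    have t: "t < nmem \<sigma> 14 0" "\<And>j. t \<notin> set (L j)" using qN 7 by auto
    have sub: "SS \<sigma> t \<subseteq> {..<m}" using sysD sy t by blast
    show ?case
    proof (cases "nmem \<sigma>1 7 t = 0")
      case False
      then have "J (insert t D) \<sigma>1"
        using 7 Q[OF 7(4)] by (auto simp: J_def)
      with False 7 f show ?thesis by (auto simp: numeral_2_eq_2[symmetric])
    next
      case True
      then have wt0: "rmem \<sigma>1 3 t = 0" and a0: "nmem \<sigma> 7 t = 0"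
        using 7 Q[OF 7(4)] by (auto simp: J_def)
      let ?\<sigma>2 = "rset 5 0 (p kk) \<sigma>1"
      have s2: "sys ?\<sigma>2" "prm ?\<sigma>2"
        using sy pr fr by (auto simp: sys_def prm_def SS_def)
      have m: "wp min_slack (\<lambda>\<sigma>' k'. k1 - 11 \<le> k' + 80 * f \<and>
          rmem \<sigma>' 5 0 \<le> p kk \<and> (\<forall>s\<in>SS \<sigma> t. rmem \<sigma>' 5 0 \<le> c s - rmem \<sigma>1 2 s) \<and>
          (rmem \<sigma>' 5 0 = p kk \<or> (\<exists>s\<in>SS \<sigma> t. rmem \<sigma>' 5 0 = c s - rmem \<sigma>1 2 s))) ?\<sigma>2 (k1 - 11)"
        using wp_min_slack[OF s2(1) _ _ _ s2(2), of t "k1 - 11"] 7(6,7) t fr S1 f by simp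
      have "wp min_slack (wp set_weight (wp (Cond (RLess (RRead 5 (NConst 0)) (RRead 4 (NV 21))) Skip
             (NWrite 7 (NV 18) (NConst 1))) (\<lambda>\<sigma>'' k'. J (insert t D) \<sigma>'' \<and> k1 \<le> k' + 220 * f))) ?\<sigma>2 (k1 - 11)"
      proof (rule wp_mono_frame[OF m])
        fix \<sigma>3 k3
        assume f3: "frame min_slack ?\<sigma>2 \<sigma>3" and k3: "k3 \<le> k1 - 11" and
         c3: "k1 - 11 \<le> k3 + 80 * f \<and>
          rmem \<sigma>3 5 0 \<le> p kk \<and> (\<forall>s\<in>SS \<sigma> t. rmem \<sigma>3 5 0 \<le> c s - rmem \<sigma>1 2 s) \<and>
          (rmem \<sigma>3 5 0 = p kk \<or> (\<exists>s\<in>SS \<sigma> t. rmem \<sigma>3 5 0 = c s - rmem \<sigma>1 2 s))"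
        have fr3: "a \<noteq> 19 \<Longrightarrow> nmem \<sigma>3 a = nmem \<sigma>1 a" "a \<noteq> 5 \<Longrightarrow> rmem \<sigma>3 a = rmem \<sigma>1 a" for a
          using f3 by (auto simp: frame_def)
        have s3: "sys \<sigma>3" using sy fr fr3 by (simp add: sys_def SS_def)
        have S3: "SS \<sigma>3 = SS \<sigma>" using fr fr3 by (simp add: SS_def fun_eq_iff)
        let ?v = "rmem \<sigma>3 5 0"
        have v0: "0 \<le> ?v"
        proof -
          have "0 \<le> c s - rmem \<sigma>1 2 s" if "s \<in> SS \<sigma> t" for s
            using that sub 7(2) by (auto simp: J_def weights_def)
          with c3 show ?thesis by (auto simp: less_imp_le)
        qed
        have k3f: "80 * f \<le> k3" using c3 7(7) f by linarith
        have sw: "wp set_weight (\<lambda>\<sigma>' k'. k3 \<le> k' + 80 * f \<and>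
            rmem \<sigma>' 2 = (\<lambda>s. rmem \<sigma>1 2 s + (if s \<in> SS \<sigma> t then ?v - 0 else 0)) \<and>
            rmem \<sigma>' 3 = (rmem \<sigma>1 3)(t := ?v)) \<sigma>3 k3"
          using wp_set_weight[OF s3, of t k3] 7(6) t fr fr3 S3 wt0 k3f by (simp cong: if_cong)
        show "wp set_weight (wp (Cond (RLess (RRead 5 (NConst 0)) (RRead 4 (NV 21))) Skip
             (NWrite 7 (NV 18) (NConst 1))) (\<lambda>\<sigma>'' k'. J (insert t D) \<sigma>'' \<and> k1 \<le> k' + 220 * f)) \<sigma>3 k3"
        proof (rule wp_mono_frame[OF sw])
          fix \<sigma>4 k4
          assume f4: "frame set_weight \<sigma>3 \<sigma>4" and c4: "k3 \<le> k4 + 80 * f \<and>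
            rmem \<sigma>4 2 = (\<lambda>s. rmem \<sigma>1 2 s + (if s \<in> SS \<sigma> t then ?v - 0 else 0)) \<and>
            rmem \<sigma>4 3 = (rmem \<sigma>1 3)(t := ?v)"
          have fr4: "a \<noteq> 19 \<Longrightarrow> nmem \<sigma>4 a = nmem \<sigma>1 a" "a \<noteq> 2 \<Longrightarrow> a \<noteq> 3 \<Longrightarrow> a \<noteq> 5 \<Longrightarrow> rmem \<sigma>4 a = rmem \<sigma>1 a"
             "rmem \<sigma>4 5 = rmem \<sigma>3 5" for a
            using f4 fr3 by (auto simp: frame_def)
          \<comment> \<open>Both outcomes of the final test are treated at once as writing the flag
            \<open>a\<close>; if the element stays passive, this rewrites the 0 that is already
            there.\<close>
          have up: "J (insert t D) \<sigma>5" if "rmem \<sigma>5 = rmem \<sigma>4" "nmem \<sigma>5 = (nmem \<sigma>4)(7 := (nmem \<sigma>4 7)(t := a))"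
            "a = (if ?v < p kk then 0 else 1)" for \<sigma>5 :: mem and a
          proof -
            have S5: "SS \<sigma>5 = SS \<sigma>1" using that fr4 by (simp add: SS_def fun_eq_iff)
            have "weights L (set qs) \<sigma>5"
              by (rule weights_set_weight[where \<sigma> = \<sigma>1 and t = t and v = ?v])
                (use 7 t that fr4 v0 c3 c4 S5 S1 wt0 fr in \<open>auto simp: J_def\<close>)
            moreover have "\<exists>s\<in>SS \<sigma> t. c s \<le> rmem \<sigma>5 2 s" if "?v < p kk"
            proof -
              obtain s where "s \<in> SS \<sigma> t" "?v = c s - rmem \<sigma>1 2 s" using c3 \<open>?v < p kk\<close> by auto
              then show ?thesis using c4 \<open>rmem \<sigma>5 = rmem \<sigma>4\<close> by (intro bexI[of _ s]) auto
            qed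
            moreover have "\<exists>s\<in>SS \<sigma> u. c s \<le> rmem \<sigma>5 2 s" if "\<exists>s\<in>SS \<sigma> u. c s \<le> rmem \<sigma>1 2 s" for u
              using that c4 v0 \<open>rmem \<sigma>5 = rmem \<sigma>4\<close> by (force intro: order_trans)
            moreover have "\<forall>s<m. rmem \<sigma> 2 s \<le> rmem \<sigma>5 2 s"
              using 7(2) c4 v0 \<open>rmem \<sigma>5 = rmem \<sigma>4\<close> by (auto simp: J_def intro: order_trans)
            moreover have "?v = p kk" if "\<not> ?v < p kk"
              using that c3 by auto
            ultimately show ?thesis
              using 7(2,3,4,5) that fr4 c4 c3 a0 t fr unfolding J_def by (auto split: if_splits)
          qed
          have e: "nmem \<sigma>4 18 0 = t" "rmem \<sigma>4 4 (nmem \<sigma>4 21 0) = p kk" "rmem \<sigma>4 5 0 = ?v"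
            using fr4 fr pw 7(6) by auto
          have "11 \<le> k4" using c4 c3 7(7) f by linarith
          moreover have "nmem \<sigma>4 = (nmem \<sigma>4)(7 := (nmem \<sigma>4 7)(t := 0))"
            using True fr4 by (auto simp: fun_eq_iff)
          ultimately show "wp (Cond (RLess (RRead 5 (NConst 0)) (RRead 4 (NV 21))) Skip
             (NWrite 7 (NV 18) (NConst 1))) (\<lambda>\<sigma>'' k'. J (insert t D) \<sigma>'' \<and> k1 \<le> k' + 220 * f) \<sigma>4 k4"
            using c4 c3 f 7(7) up[of \<sigma>4 0] up[of "nset 7 t 1 \<sigma>4" 1]
            by (auto simp: e numeral_2_eq_2[symmetric])
        qed
      qed
      then show ?thesis
        using True 7(6,7) f pw fr by (simp add: numeral_2_eq_2[symmetric])
    qed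
  qed auto
  then show ?thesis
  proof (rule wp_mono_frame)
    fix \<sigma>' k' assume f': "frame fill \<sigma> \<sigma>'" and *: "J (set qs) \<sigma>' \<and> k \<le> k' + ((220 * f + 20) * length qs + 20)"
    have fr: "nmem \<sigma>' 4 = nmem \<sigma> 4" "nmem \<sigma>' 5 = nmem \<sigma> 5" "nmem \<sigma>' 14 = nmem \<sigma> 14" "nmem \<sigma>' 2 = nmem \<sigma> 2" "nmem \<sigma>' 3 = nmem \<sigma> 3"
        "nmem \<sigma>' 6 = nmem \<sigma> 6" "nmem \<sigma>' 8 = nmem \<sigma> 8" "nmem \<sigma>' 9 = nmem \<sigma> 9" "nmem \<sigma>' 11 = nmem \<sigma> 11" "nmem \<sigma>' 15 = nmem \<sigma> 15"
        "rmem \<sigma>' 0 = rmem \<sigma> 0" "rmem \<sigma>' 1 = rmem \<sigma> 1"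
      using f' by (auto simp: frame_def)
    have S: "SS \<sigma>' = SS \<sigma>" using fr by (simp add: SS_def fun_eq_iff)
    have "lists L (set qs) \<sigma>'"
      using li * unfolding lists_def fr by (auto simp: J_def)
    moreover have "sets 0 L \<sigma>'"
      by (rule sets_increase[OF se]) (use fr S * in \<open>auto simp: J_def\<close>)
    moreover have "sys \<sigma>'" "prm \<sigma>'"
      using sy pr fr S by (auto simp: sys_def prm_def)
    ultimately have m: "mid 0 L (set qs) \<sigma>'"
      using * by (auto simp: mid_def J_def)
    have "tight \<sigma>' s" if "s \<in> SS \<sigma> t" "t \<in> set qs" "c s \<le> rmem \<sigma>' 2 s" for s t
    proof -
      have sm: "s < m" using that qN sysD(1)[OF sy] by blast
      have "0 \<le> c s" using c_ge[OF sm] C by (meson divide_nonneg_pos less_trans order_trans zero_less_one zero_le_one)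
      then have "0 \<le> x * rmem \<sigma>' 2 s" using that x_pos by simp
      then show ?thesis using that by (simp add: tight_def algebra_simps)
    qed
    then have "\<exists>s\<in>SS \<sigma> t. tight \<sigma>' s" if "t \<in> set qs" "\<exists>s\<in>SS \<sigma> t. c s \<le> rmem \<sigma>' 2 s" for t
      using that by blast
    moreover have "k \<le> k' + 300 * f * length qs + 20"
      using * cost by linarith
    ultimately show "k \<le> k' + 300 * f * length qs + 20 \<and> mid 0 L (set qs) \<sigma>' \<and>
      (\<forall>t. t \<notin> set qs \<longrightarrow> nmem \<sigma>' 7 t = nmem \<sigma> 7 t) \<and>
      (\<forall>t\<in>set qs. rmem \<sigma>' 3 t \<le> p kk \<and> (nmem \<sigma>' 7 t \<noteq> 0 \<longrightarrow> rmem \<sigma>' 3 t = p kk) \<and>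
        (nmem \<sigma> 7 t \<noteq> 0 \<longrightarrow> nmem \<sigma>' 7 t \<noteq> 0) \<and> (nmem \<sigma>' 7 t = 0 \<longrightarrow> (\<exists>s\<in>SS \<sigma> t. tight \<sigma>' s)))"
      using * m by (simp add: J_def)
  qed
qed

text \<open>Lifting multiplies each queued weight by \<open>1 + x\<close>, so the total of a set
  grows by at most this factor, and a set that is not tight has that much room. For
  \<open>r = 0\<close> the queue is empty by \<open>Q\<close>, so the truncated
  \<open>r - Suc 0\<close> does no harm.\<close>

lemma wp_lift_queue:
  assumes mid: "mid 0 L (set qs) \<sigma>"
    and ch: "chain (nmem \<sigma> 9) (nmem \<sigma> 16 0) qs" and dist: "distinct qs"
    and r: "nmem \<sigma> 20 0 = r" and pw: "rmem \<sigma> 4 (r - 1) = p (r - Suc 0)"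
    and Q: "\<And>t. t \<in> set qs \<Longrightarrow> 0 < r \<and> rmem \<sigma> 3 t = p r"
    and nt: "\<And>t s. t \<in> set qs \<Longrightarrow> s \<in> SS \<sigma> t \<Longrightarrow> \<not> tight \<sigma> s"
    and k: "200 * f * length qs + 20 \<le> k"
  shows "wp lift_queue (\<lambda>\<sigma>' k'. k \<le> k' + 200 * f * length qs + 20 \<and> mid 0 L (set qs) \<sigma>' \<and>
      (\<forall>t\<in>set qs. rmem \<sigma>' 3 t = p (r - Suc 0))) \<sigma> k"
proof -
  \<comment> \<open>Only the sums are tracked during the loop; the bound by the costs is recovered
    at the end by comparing the loads before and after.\<close>
  define J where "J D \<sigma>' \<longleftrightarrow> wsum \<sigma>' \<and> rmem \<sigma>' 3 = (\<lambda>t. if t \<in> D then p (r - Suc 0) else rmem \<sigma> 3 t)"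
    for D and \<sigma>' :: mem
  have li: "lists L (set qs) \<sigma>" and we: "weights L (set qs) \<sigma>" and sy: "sys \<sigma>" and pr: "prm \<sigma>"
    and se: "sets 0 L \<sigma>"
    using mid by (auto simp: mid_def)
  have qN: "t < nmem \<sigma> 14 0" "\<And>j. t \<notin> set (L j)" if "t \<in> set qs" for t
    using li that by (auto simp: lists_def)
  have f: "1 \<le> f" if "t \<in> set qs" for t
    using that qN sysD(5)[OF sy] by blast
  have cost: "(100 * f + 20) * length qs \<le> 200 * f * length qs"
  proof (cases qs)
    case (Cons t ts)
    then have "100 * f + 20 \<le> 200 * f" using f[of t] by simp
    then show ?thesis by (rule mult_le_mono1)
  qed simp
  have "wp lift_queue (\<lambda>\<sigma>' k'. J (set qs) \<sigma>' \<and> k \<le> k' + ((100 * f + 20) * length qs + 20)) \<sigma> k"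
    unfolding lift_queue_def
  proof (rule wp_for_queue[OF _ _ ch dist], goal_cases)
    case 3
    show ?case using k cost by linarith
  next
    case 4
    show ?case using we by (simp add: J_def weights_def)
  next
    case (5 D \<sigma>' i)
    then show ?case by (auto simp: J_def wsum_def load_def)
  next
    case (6 D \<sigma>' i)
    then show ?case by (auto simp: J_def wsum_def load_def)
  next
    case (7 D \<sigma>1 t k1)
    have fr: "nmem \<sigma>1 4 = nmem \<sigma> 4" "nmem \<sigma>1 5 = nmem \<sigma> 5" "nmem \<sigma>1 14 = nmem \<sigma> 14" "nmem \<sigma>1 20 = nmem \<sigma> 20"
      "rmem \<sigma>1 4 = rmem \<sigma> 4"
      using 7(1) by (auto simp: frame_def for_queue_def)
    note f = f[OF 7(4)]
    have t: "t < nmem \<sigma> 14 0" using qN 7 by auto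
    let ?\<sigma>2 = "rset 5 0 (p (r - Suc 0)) \<sigma>1"
    have s2: "sys ?\<sigma>2" using sy fr by (simp add: sys_def SS_def)
    have S1: "SS \<sigma>1 = SS \<sigma>" using fr by (simp add: SS_def fun_eq_iff)
    have sw: "wp set_weight (\<lambda>\<sigma>' k'. k1 - 7 \<le> k' + 80 * f \<and>
            rmem \<sigma>' 2 = (\<lambda>s. rmem \<sigma>1 2 s + (if s \<in> SS \<sigma> t then p (r - Suc 0) - rmem \<sigma>1 3 t else 0)) \<and>
            rmem \<sigma>' 3 = (rmem \<sigma>1 3)(t := p (r - Suc 0))) ?\<sigma>2 (k1 - 7)"
      using wp_set_weight[OF s2, of t "k1 - 7"] 7(6,7) t fr f S1 by (simp cong: if_cong)
    have "wp set_weight (\<lambda>\<sigma>'' k'. J (insert t D) \<sigma>'' \<and> k1 \<le> k' + 100 * f) ?\<sigma>2 (k1 - 7)"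
    proof (rule wp_mono_frame[OF sw])
      fix \<sigma>3 k3 assume f3: "frame set_weight ?\<sigma>2 \<sigma>3" and c3: "k1 - 7 \<le> k3 + 80 * f \<and>
            rmem \<sigma>3 2 = (\<lambda>s. rmem \<sigma>1 2 s + (if s \<in> SS \<sigma> t then p (r - Suc 0) - rmem \<sigma>1 3 t else 0)) \<and>
            rmem \<sigma>3 3 = (rmem \<sigma>1 3)(t := p (r - Suc 0))"
      have fr3: "nmem \<sigma>3 4 = nmem \<sigma>1 4" "nmem \<sigma>3 5 = nmem \<sigma>1 5" "nmem \<sigma>3 14 = nmem \<sigma>1 14"
        using f3 by (auto simp: frame_def)
      have "wsum \<sigma>3"
        by (rule wsum_set_weight[where \<sigma> = \<sigma>1 and t = t and v = "p (r - Suc 0)"])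
          (use 7(2) t fr fr3 c3 S1 in \<open>auto simp: J_def SS_def fun_eq_iff\<close>)
      with 7(2) c3 f 7(7) show "J (insert t D) \<sigma>3 \<and> k1 \<le> k3 + 100 * f"
        by (auto simp: J_def fun_eq_iff)
    qed
    then show ?case
      using 7(7) f fr r pw by (simp add: numeral_2_eq_2[symmetric])
  qed auto
  then show ?thesis
  proof (rule wp_mono_frame)
    fix \<sigma>' k' assume f': "frame lift_queue \<sigma> \<sigma>'" and *: "J (set qs) \<sigma>' \<and> k \<le> k' + ((100 * f + 20) * length qs + 20)"
    have fr: "nmem \<sigma>' 4 = nmem \<sigma> 4" "nmem \<sigma>' 5 = nmem \<sigma> 5" "nmem \<sigma>' 14 = nmem \<sigma> 14" "nmem \<sigma>' 2 = nmem \<sigma> 2" "nmem \<sigma>' 3 = nmem \<sigma> 3"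
        "nmem \<sigma>' 6 = nmem \<sigma> 6" "nmem \<sigma>' 7 = nmem \<sigma> 7" "nmem \<sigma>' 8 = nmem \<sigma> 8" "nmem \<sigma>' 9 = nmem \<sigma> 9" "nmem \<sigma>' 11 = nmem \<sigma> 11" "nmem \<sigma>' 15 = nmem \<sigma> 15"
        "rmem \<sigma>' 0 = rmem \<sigma> 0" "rmem \<sigma>' 1 = rmem \<sigma> 1"
      using f' by (auto simp: frame_def)
    have S: "SS \<sigma>' = SS \<sigma>" using fr by (simp add: SS_def fun_eq_iff)
    have wt: "rmem \<sigma>' 3 = (\<lambda>t. if t \<in> set qs then p (r - Suc 0) else rmem \<sigma> 3 t)" and ws: "wsum \<sigma>'"
      using * by (auto simp: J_def)
    have nonneg: "0 \<le> rmem \<sigma> 3 t" if "t < nmem \<sigma> 14 0" for t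
      using that we by (auto simp: weights_def)
    have pr1: "p (r - Suc 0) = (1 + x) * p r" if "t \<in> set qs" for t
      using Q[OF that] p_Suc[of "r - 1"] x_pos by (simp add: field_simps)
    have ld: "load \<sigma>' (rmem \<sigma>' 3) s = load \<sigma> (rmem \<sigma>' 3) s" "rmem \<sigma> 2 s = load \<sigma> (rmem \<sigma> 3) s"
      "rmem \<sigma>' 2 s = load \<sigma>' (rmem \<sigma>' 3) s" if "s < m" for s
      using that ws we load_cong[OF S] fr by (auto simp: wsum_def weights_def)
    have up: "rmem \<sigma> 3 t \<le> rmem \<sigma>' 3 t \<and> rmem \<sigma>' 3 t \<le> (1 + x) * rmem \<sigma> 3 t" if "t < nmem \<sigma> 14 0" for t
      using nonneg[OF that] x_pos Q pr1 p_pos[of r] by (auto simp: wt algebra_simps less_imp_le)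
    have ge: "rmem \<sigma> 2 s \<le> rmem \<sigma>' 2 s" if "s < m" for s
      using ld[OF that] load_mono[of \<sigma> s "rmem \<sigma> 3" "rmem \<sigma>' 3"] up by auto
    have le: "rmem \<sigma>' 2 s \<le> c s" if s: "s < m" for s
    proof (cases "\<exists>t\<in>set qs. s \<in> SS \<sigma> t")
      case True
      then obtain t where "t \<in> set qs" "s \<in> SS \<sigma> t" by auto
      then have "(1 + x) * rmem \<sigma> 2 s < c s"
        using nt[of t s] by (simp add: tight_def)
      moreover have "load \<sigma> (rmem \<sigma>' 3) s \<le> load \<sigma> (\<lambda>t. (1 + x) * rmem \<sigma> 3 t) s"
        by (rule load_mono) (use up in auto)
      moreover have "load \<sigma> (\<lambda>t. (1 + x) * rmem \<sigma> 3 t) s = (1 + x) * load \<sigma> (rmem \<sigma> 3) s"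
        by (simp add: load_def sum_distrib_left)
      ultimately show ?thesis using ld[OF s] by simp
    next
      case False
      then have "load \<sigma> (rmem \<sigma>' 3) s = load \<sigma> (rmem \<sigma> 3) s"
        unfolding load_def by (intro sum.cong) (auto simp: wt)
      moreover have "rmem \<sigma> 2 s \<le> c s" using we s by (auto simp: weights_def)
      ultimately show ?thesis using ld[OF s] by simp
    qed
    have "weights L (set qs) \<sigma>'"
      using we ws le qN unfolding weights_def fr wt by (auto simp: less_imp_le)
    moreover have "lists L (set qs) \<sigma>'"
      using li unfolding lists_def fr by auto
    moreover have "sets 0 L \<sigma>'"
      by (rule sets_increase[OF se]) (use fr S ge in auto)
    moreover have "sys \<sigma>'" "prm \<sigma>'"
      using sy pr fr S by (auto simp: sys_def prm_def)
    moreover have "k \<le> k' + 200 * f * length qs + 20"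
      using * cost by linarith
    ultimately show "k \<le> k' + 200 * f * length qs + 20 \<and> mid 0 L (set qs) \<sigma>' \<and>
      (\<forall>t\<in>set qs. rmem \<sigma>' 3 t = p (r - Suc 0))"
      by (simp add: mid_def wt)
  qed
qed

section \<open>Placing tight elements\<close>

lemma nwr_place [simp]: "nwr place = {8, 9, 11, 12, 15}" "rwr place = {}"
  by (auto simp: place_def)

lemma wp_place:
  assumes "nmem \<sigma> 18 0 = t" "nmem \<sigma> 20 0 = r" "80 \<le> k"
  shows "wp place (\<lambda>\<sigma>' k'. k \<le> k' + 80 \<and> nmem \<sigma>' 9 = (nmem \<sigma> 9)(t := nmem \<sigma> 11 r) \<and>
      nmem \<sigma>' 11 = (nmem \<sigma> 11)(r := Suc t) \<and> nmem \<sigma>' 8 = (nmem \<sigma> 8)(t := r) \<and>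
      nmem \<sigma>' 12 = (nmem \<sigma> 12)(r := nmem \<sigma> 12 r + nmem \<sigma> 7 t) \<and>
      nmem \<sigma>' 15 0 = max (nmem \<sigma> 15 0) r) \<sigma> k"
  using assms by (auto simp: place_def numeral_2_eq_2[symmetric])

lemma lists_place:
  assumes li: "lists L Q \<sigma>" and t: "t \<in> Q"
    and eq: "nmem \<sigma>' 9 = (nmem \<sigma> 9)(t := nmem \<sigma> 11 r)" "nmem \<sigma>' 11 = (nmem \<sigma> 11)(r := Suc t)"
      "nmem \<sigma>' 8 = (nmem \<sigma> 8)(t := r)" "nmem \<sigma>' 14 = nmem \<sigma> 14" "nmem \<sigma>' 6 = nmem \<sigma> 6" "nmem \<sigma>' 7 = nmem \<sigma> 7"
  shows "lists (L(r := t # L r)) (Q - {t}) \<sigma>'"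
proof -
  have tn: "t \<notin> set (L j)" for j using li t by (auto simp: lists_def)
  have "\<forall>j. chain (nmem \<sigma>' 9) (nmem \<sigma>' 11 j) ((L(r := t # L r)) j) \<and> distinct ((L(r := t # L r)) j)"
    using li tn by (auto simp: lists_def eq)
  moreover have "\<forall>j. \<forall>u\<in>set ((L(r := t # L r)) j). u < nmem \<sigma>' 14 0 \<and> nmem \<sigma>' 8 u = j"
    using li t tn unfolding lists_def eq by (auto split: if_splits) 
  moreover have "\<forall>u\<in>Q - {t}. u < nmem \<sigma>' 14 0 \<and> nmem \<sigma>' 6 u \<noteq> 0 \<and> (\<forall>j. u \<notin> set ((L(r := t # L r)) j))"
    using li by (auto simp: lists_def eq)
  moreover have "\<forall>u<nmem \<sigma>' 14 0. nmem \<sigma>' 6 u \<noteq> 0 \<longrightarrow> u \<in> Q - {t} \<or> u \<in> set ((L(r := t # L r)) (nmem \<sigma>' 8 u))"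
    using li by (auto simp: lists_def eq)
  ultimately show ?thesis
    using li unfolding lists_def by (simp add: eq)
qed

lemma weights_place:
  assumes w: "weights L Q \<sigma>" and t: "rmem \<sigma> 3 t \<le> p r" "nmem \<sigma> 7 t \<noteq> 0 \<Longrightarrow> rmem \<sigma> 3 t = p r"
    and eq: "nmem \<sigma>' 14 = nmem \<sigma> 14" "nmem \<sigma>' 6 = nmem \<sigma> 6" "nmem \<sigma>' 7 = nmem \<sigma> 7"
      "rmem \<sigma>' 2 = rmem \<sigma> 2" "rmem \<sigma>' 3 = rmem \<sigma> 3" "SS \<sigma>' = SS \<sigma>"
  shows "weights (L(r := t # L r)) (Q - {t}) \<sigma>'"
proof -
  have "load \<sigma>' = load \<sigma>" by (rule load_cong) (simp_all add: eq)
  then show ?thesis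
    using w t unfolding weights_def wsum_def by (auto simp: eq)
qed

lemma count_place:
  assumes li: "lists L Q \<sigma>" and t: "t \<in> Q" and co: "\<forall>i. count L \<sigma> i"
    and eq: "nmem \<sigma>' 12 = (nmem \<sigma> 12)(r := nmem \<sigma> 12 r + nmem \<sigma> 7 t)" "nmem \<sigma>' 13 = nmem \<sigma> 13"
       "nmem \<sigma>' 6 = nmem \<sigma> 6" "nmem \<sigma>' 7 = nmem \<sigma> 7"
  shows "\<forall>i. count (L(r := t # L r)) \<sigma>' i"
proof
  fix i
  have t': "t \<notin> set (L r)" "nmem \<sigma> 6 t \<noteq> 0" "nmem \<sigma> 7 t \<le> 1" using li t by (auto simp: lists_def)
  show "count (L(r := t # L r)) \<sigma>' i"
  proof (cases "i = r")
    case True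
    have "{u \<in> set (t # L r). nmem \<sigma> 6 u \<noteq> 0 \<and> nmem \<sigma> 7 u \<noteq> 0} =
       (if nmem \<sigma> 7 t = 0 then {} else {t}) \<union> {u \<in> set (L r). nmem \<sigma> 6 u \<noteq> 0 \<and> nmem \<sigma> 7 u \<noteq> 0}"
       "{u \<in> set (t # L r). nmem \<sigma> 6 u = 0} = {u \<in> set (L r). nmem \<sigma> 6 u = 0}"
      using t' by auto
    then have "card {u \<in> set (t # L r). nmem \<sigma> 6 u \<noteq> 0 \<and> nmem \<sigma> 7 u \<noteq> 0} =
        card {u \<in> set (L r). nmem \<sigma> 6 u \<noteq> 0 \<and> nmem \<sigma> 7 u \<noteq> 0} + nmem \<sigma> 7 t"
      "{u \<in> set (t # L r). nmem \<sigma> 6 u = 0} = {u \<in> set (L r). nmem \<sigma> 6 u = 0}"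
      using t' by (auto simp: le_Suc_eq)
    with co True show ?thesis
      unfolding count_def by (simp add: eq del: list.set)
  qed (use co in \<open>auto simp: count_def eq\<close>)
qed

text \<open>
  The last but one clause says that a new top level is only opened when no deleted elements are
  left; this is what bounds the number of levels in terms of the current number of elements.
\<close>

definition ready :: "nat \<Rightarrow> (nat \<Rightarrow> nat list) \<Rightarrow> nat set \<Rightarrow> mem \<Rightarrow> bool" where
  "ready r L Q \<sigma> \<longleftrightarrow> mid 0 L Q \<sigma> \<and> (\<forall>i. count L \<sigma> i) \<and> (\<forall>j>nmem \<sigma> 15 0. L j = []) \<and>
     nmem \<sigma> 15 0 \<le> B \<and> r \<le> Suc (nmem \<sigma> 15 0) \<and> (\<forall>i. \<forall>t\<in>set (L i). r \<le> i) \<and>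
     (nmem \<sigma> 15 0 < r \<longrightarrow> (\<forall>j. \<forall>t\<in>set (L j). nmem \<sigma> 6 t \<noteq> 0)) \<and>
     card {t. t < nmem \<sigma> 14 0 \<and> nmem \<sigma> 6 t \<noteq> 0} \<le> n"

lemma chain_cong: "(\<And>y. y \<in> set ys \<Longrightarrow> nx' y = nx y) \<Longrightarrow> chain nx' h ys = chain nx h ys"
  by (induction ys arbitrary: h) auto

text \<open>Successor entries matter only for members of the level lists. Those of queued elements
  may change freely, which is needed when the queue is relinked.\<close>

lemma mid_cong:
  assumes m: "mid J L Q \<sigma>"
    and eq: "nmem \<sigma>' 2 = nmem \<sigma> 2" "nmem \<sigma>' 3 = nmem \<sigma> 3" "nmem \<sigma>' 4 = nmem \<sigma> 4" "nmem \<sigma>' 5 = nmem \<sigma> 5"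
      "nmem \<sigma>' 6 = nmem \<sigma> 6" "nmem \<sigma>' 7 = nmem \<sigma> 7" "nmem \<sigma>' 8 = nmem \<sigma> 8" "nmem \<sigma>' 11 = nmem \<sigma> 11"
      "nmem \<sigma>' 14 = nmem \<sigma> 14" "nmem \<sigma>' 15 = nmem \<sigma> 15"
      "rmem \<sigma>' 0 = rmem \<sigma> 0" "rmem \<sigma>' 1 = rmem \<sigma> 1" "rmem \<sigma>' 2 = rmem \<sigma> 2" "rmem \<sigma>' 3 = rmem \<sigma> 3"
    and nx: "\<And>j t. t \<in> set (L j) \<Longrightarrow> nmem \<sigma>' 9 t = nmem \<sigma> 9 t"
  shows "mid J L Q \<sigma>'"
proof -
  have S: "SS \<sigma>' = SS \<sigma>" using eq by (simp add: SS_def fun_eq_iff)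
  have ch: "chain (nmem \<sigma>' 9) h (L j) = chain (nmem \<sigma> 9) h (L j)" for j h
    by (rule chain_cong) (rule nx)
  have ld: "load \<sigma>' = load \<sigma>" by (rule load_cong) (simp_all add: eq S)
  have tg: "tight \<sigma>' = tight \<sigma>" by (rule tight_cong) (simp add: eq)
  have "mid J L Q \<sigma>' = mid J L Q \<sigma>"
    by (simp only: mid_def prm_def sys_def lists_def weights_def sets_def wsum_def S eq ch ld tg)
  with m show ?thesis by simp
qed

lemma ready_cong:
  assumes m: "ready r L Q \<sigma>"
    and eq: "nmem \<sigma>' 2 = nmem \<sigma> 2" "nmem \<sigma>' 3 = nmem \<sigma> 3" "nmem \<sigma>' 4 = nmem \<sigma> 4" "nmem \<sigma>' 5 = nmem \<sigma> 5"
      "nmem \<sigma>' 6 = nmem \<sigma> 6" "nmem \<sigma>' 7 = nmem \<sigma> 7" "nmem \<sigma>' 8 = nmem \<sigma> 8" "nmem \<sigma>' 11 = nmem \<sigma> 11"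
      "nmem \<sigma>' 12 = nmem \<sigma> 12" "nmem \<sigma>' 13 = nmem \<sigma> 13"
      "nmem \<sigma>' 14 = nmem \<sigma> 14" "nmem \<sigma>' 15 = nmem \<sigma> 15"
      "rmem \<sigma>' 0 = rmem \<sigma> 0" "rmem \<sigma>' 1 = rmem \<sigma> 1" "rmem \<sigma>' 2 = rmem \<sigma> 2" "rmem \<sigma>' 3 = rmem \<sigma> 3"
    and nx: "\<And>j t. t \<in> set (L j) \<Longrightarrow> nmem \<sigma>' 9 t = nmem \<sigma> 9 t"
  shows "ready r L Q \<sigma>'"
proof -
  have "mid 0 L Q \<sigma>" using m by (simp add: ready_def)
  moreover from this have "mid 0 L Q \<sigma>'"
    by (rule mid_cong) (use eq nx in auto)
  ultimately have mid: "mid 0 L Q \<sigma>' = mid 0 L Q \<sigma>" by blast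
  have co: "count L \<sigma>' = count L \<sigma>"
    by (simp add: count_def fun_eq_iff eq)
  have "ready r L Q \<sigma>' = ready r L Q \<sigma>"
    by (simp only: ready_def eq mid co)
  with m show ?thesis by simp
qed

text \<open>A tight set costs at least \<open>1 / C\<close>. If deleted elements weigh nothing, its
  weight comes from at most \<open>n\<close> live elements of weight at most \<open>p r\<close>
  each; comparing the two bounds limits \<open>r\<close>.\<close>

lemma level_le_B:
  assumes we: "weights L Q \<sigma>" and s: "s < m" "tight \<sigma> s"
    and le: "\<And>t. t < nmem \<sigma> 14 0 \<Longrightarrow> rmem \<sigma> 3 t \<le> p r"
    and z: "\<And>t. t < nmem \<sigma> 14 0 \<Longrightarrow> nmem \<sigma> 6 t = 0 \<Longrightarrow> rmem \<sigma> 3 t = 0"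
    and n: "card {t. t < nmem \<sigma> 14 0 \<and> nmem \<sigma> 6 t \<noteq> 0} \<le> n"
  shows "r \<le> B"
proof (rule B)
  let ?A = "{t. t < nmem \<sigma> 14 0 \<and> s \<in> SS \<sigma> t}" and ?V = "{t. t < nmem \<sigma> 14 0 \<and> nmem \<sigma> 6 t \<noteq> 0}"
  have "rmem \<sigma> 2 s = (\<Sum>t\<in>?A. rmem \<sigma> 3 t)"
    using we s by (auto simp: weights_def wsum_def load_def)
  also have "\<dots> = (\<Sum>t\<in>?A \<inter> ?V. rmem \<sigma> 3 t)"
    by (rule sum.mono_neutral_right) (use z in auto)
  also have "\<dots> \<le> (\<Sum>t\<in>?V. p r)"
    by (rule order_trans[OF sum_mono[of _ _ "\<lambda>_. p r"] sum_mono2]) (use le in \<open>auto simp: less_imp_le\<close>)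
  also have "\<dots> \<le> real n * p r"
    using n by (simp add: mult_right_mono less_imp_le)
  finally have "rmem \<sigma> 2 s \<le> real n * p r" .
  moreover have "1 / C \<le> (1 + x) * rmem \<sigma> 2 s"
    using s c_ge by (force simp: tight_def)
  ultimately have "1 / C \<le> (1 + x) * (real n * p r)"
    using x_pos by (meson mult_left_mono add_nonneg_nonneg less_imp_le order_trans zero_le_one)
  then show "(1 + x) ^ r \<le> (1 + x) * C * real n"
    using C x_pos by (simp add: p_def field_simps)
qed

text \<open>Level \<open>r\<close> is no higher than any level in use, so giving it to the tight
  sets of \<open>t\<close> puts no set above one of its elements. By \<open>lev\<close> these sets
  had level 0 or \<open>r\<close> before, so no element on a higher level loses the set that covers
  it.\<close>

lemma ready_place:
  assumes re: "ready r L Q \<sigma>" and t: "t \<in> Q"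
    and Qw: "\<And>u. u \<in> Q \<Longrightarrow> rmem \<sigma> 3 u \<le> p r" and act: "nmem \<sigma> 7 t \<noteq> 0 \<Longrightarrow> rmem \<sigma> 3 t = p r"
    and lev: "\<And>s. s \<in> SS \<sigma> t \<Longrightarrow> nmem \<sigma> 3 s = 0 \<or> nmem \<sigma> 3 s = r"
    and ti: "\<exists>s\<in>SS \<sigma> t. tight \<sigma> s"
    and m2: "nmem \<sigma>' 2 = (\<lambda>s. if s \<in> SS \<sigma> t \<and> tight \<sigma> s then 1 else nmem \<sigma> 2 s)"
    and m3: "nmem \<sigma>' 3 = (\<lambda>s. if s \<in> SS \<sigma> t \<and> tight \<sigma> s then r else nmem \<sigma> 3 s)"
    and eq: "nmem \<sigma>' 9 = (nmem \<sigma> 9)(t := nmem \<sigma> 11 r)" "nmem \<sigma>' 11 = (nmem \<sigma> 11)(r := Suc t)"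
      "nmem \<sigma>' 8 = (nmem \<sigma> 8)(t := r)" "nmem \<sigma>' 12 = (nmem \<sigma> 12)(r := nmem \<sigma> 12 r + nmem \<sigma> 7 t)"
      "nmem \<sigma>' 15 0 = max (nmem \<sigma> 15 0) r" "nmem \<sigma>' 4 = nmem \<sigma> 4" "nmem \<sigma>' 5 = nmem \<sigma> 5"
      "nmem \<sigma>' 6 = nmem \<sigma> 6" "nmem \<sigma>' 7 = nmem \<sigma> 7" "nmem \<sigma>' 13 = nmem \<sigma> 13" "nmem \<sigma>' 14 = nmem \<sigma> 14"
      "rmem \<sigma>' = rmem \<sigma>"
  shows "ready r (L(r := t # L r)) (Q - {t}) \<sigma>'"
proof -
  have mid: "prm \<sigma>" "sys \<sigma>" "lists L Q \<sigma>" "weights L Q \<sigma>" "sets 0 L \<sigma>" and co: "\<forall>i. count L \<sigma> i"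
    and low: "\<And>i t. t \<in> set (L i) \<Longrightarrow> r \<le> i" and T: "nmem \<sigma> 15 0 \<le> B" "r \<le> Suc (nmem \<sigma> 15 0)" "\<forall>j>nmem \<sigma> 15 0. L j = []"
    and cn: "card {t. t < nmem \<sigma> 14 0 \<and> nmem \<sigma> 6 t \<noteq> 0} \<le> n"
    and top: "nmem \<sigma> 15 0 < r \<Longrightarrow> (\<forall>j. \<forall>t\<in>set (L j). nmem \<sigma> 6 t \<noteq> 0)"
    using re by (auto simp: ready_def mid_def)
  have S: "SS \<sigma>' = SS \<sigma>" using eq by (simp add: SS_def fun_eq_iff)
  have tg: "tight \<sigma>' = tight \<sigma>" by (rule tight_cong) (simp add: eq)
  have Q: "u < nmem \<sigma> 14 0" "nmem \<sigma> 6 u \<noteq> 0" if "u \<in> Q" for u using mid(3) that by (auto simp: lists_def)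
  have tN: "t < nmem \<sigma> 14 0" "nmem \<sigma> 6 t \<noteq> 0" using Q t by auto
  have sm: "s < m" if "s \<in> SS \<sigma> t" for s using sysD(1)[OF mid(2) tN(1)] that by auto
  \<comment> \<open>Only a new top level needs an argument: then no list contains a deleted element,
    and all weights are at most \<open>p r\<close> because every element in a list is at level
    \<open>r\<close> or above.\<close>
  have rB: "r \<le> B" if "nmem \<sigma> 15 0 < r"
  proof -
    obtain s where s: "s \<in> SS \<sigma> t" "tight \<sigma> s" using ti by blast
    have pl: "rmem \<sigma> 3 u \<le> p r" if u: "u < nmem \<sigma> 14 0" for u
    proof (cases "u \<in> Q \<or> (\<forall>j. u \<notin> set (L j))")
      case True
      with mid(4) u Qw show ?thesis by (cases "u \<in> Q") (auto simp: weights_def less_imp_le)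
    next
      case False
      then obtain j where j: "u \<in> set (L j)" by auto
      then have "r \<le> j" using low[of _ j] by auto
      with j mid(4) p_antimono[of r j] show ?thesis by (fastforce simp: weights_def)
    qed
    have ze: "rmem \<sigma> 3 u = 0" if u: "u < nmem \<sigma> 14 0" "nmem \<sigma> 6 u = 0" for u
    proof -
      have "u \<notin> Q" using Q(2)[of u] u by auto
      moreover have "\<forall>j. u \<notin> set (L j)" using u top[OF \<open>nmem \<sigma> 15 0 < r\<close>] by fastforce
      ultimately have "u \<notin> Q" "\<forall>j. u \<notin> set (L j)" by auto
      with mid(4) u show ?thesis by (auto simp: weights_def)
    qed
    show ?thesis
      by (rule level_le_B[OF mid(4) sm[OF s(1)] s(2) pl ze cn])
  qed
  then have rB: "r \<le> B" using T by (cases "nmem \<sigma> 15 0 < r") auto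
  have "sets 0 (L(r := t # L r)) \<sigma>'"
    unfolding sets_def S tg eq
  proof (intro conjI allI impI ballI, goal_cases)
    case (1 s)
    then show ?case using mid(5) by (auto simp: m2 m3 sets_def split: if_splits)
  next
    case (2 s)
    then show ?case using mid(5) sm by (auto simp: m2 sets_def split: if_splits)
  next
    case (3 s)
    then show ?case using mid(5) sm by (auto simp: m2 sets_def split: if_splits)
  next
    case (4 s)
    have "nmem \<sigma> 3 s \<le> nmem \<sigma> 15 0" using mid(5) by (auto simp: sets_def)
    then show ?case by (auto simp: m3)
  next
    case (5 j u s)
    show ?case
    proof (cases "j = r \<and> u = t")
      case True
      then show ?thesis using 5 lev[of s] by (auto simp: m3)
    next
      case False
      then have u: "u \<in> set (L j)" using 5(1) by (auto split: if_splits)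
      then have "r \<le> j" "nmem \<sigma> 3 s \<le> j" using low[of _ j] mid(5) 5(2) by (auto simp: sets_def)
      then show ?thesis by (auto simp: m3)
    qed
  next
    case (6 j u)
    show ?case
    proof (cases "j = r \<and> u = t")
      case True
      then show ?thesis using ti by (auto simp: m2 m3)
    next
      case False
      then have u: "u \<in> set (L j)" using 6(2) by (auto split: if_splits)
      then have rj: "r \<le> j" using low[of _ j] by auto
      obtain s where "s \<in> SS \<sigma> u" "nmem \<sigma> 2 s \<noteq> 0" "nmem \<sigma> 3 s = j"
        using mid(5) 6(3) u unfolding sets_def by (meson le0)
      with lev[of s] rj show ?thesis by (intro bexI[of _ s]) (auto simp: m2 m3)
    qed
  qed
  moreover have "lists (L(r := t # L r)) (Q - {t}) \<sigma>'"
    by (rule lists_place[OF mid(3) t]) (simp_all add: eq)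
  moreover have "weights (L(r := t # L r)) (Q - {t}) \<sigma>'"
    by (rule weights_place[OF mid(4) Qw[OF t] act]) (simp_all add: eq S)
  moreover have "\<forall>i. count (L(r := t # L r)) \<sigma>' i"
    by (rule count_place[OF mid(3) t co]) (simp_all add: eq)
  moreover have "prm \<sigma>'" "sys \<sigma>'"
    using mid(1,2) S by (auto simp: prm_def sys_def eq)
  ultimately show ?thesis
    using T rB low top cn tN unfolding ready_def mid_def
    by (auto simp: eq split: if_splits)
qed

lemma nwr_freeze [simp]: "nwr freeze = {2, 3, 8, 9, 11, 12, 15, 16, 17, 18, 19, 23}" "rwr freeze = {}"
  by (auto simp: freeze_def)

text \<open>Freezing changes no weight, so tightness can be expressed throughout in terms of the
  initial memory. The elements kept for the next round are relinked into a second list that shares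
  the successor array.\<close>

lemma wp_freeze:
  assumes re: "ready r L (set qs) \<sigma>"
    and ch: "chain (nmem \<sigma> 9) (nmem \<sigma> 16 0) qs" and dist: "distinct qs"
    and r: "nmem \<sigma> 20 0 = r"
    and Qw: "\<And>t. t \<in> set qs \<Longrightarrow> rmem \<sigma> 3 t \<le> p r \<and> (nmem \<sigma> 7 t \<noteq> 0 \<longrightarrow> rmem \<sigma> 3 t = p r)"
    and lev: "\<And>t s. t \<in> set qs \<Longrightarrow> s \<in> SS \<sigma> t \<Longrightarrow> nmem \<sigma> 3 s = 0"
    and k: "300 * f * length qs + 40 \<le> k"
  shows "wp freeze (\<lambda>\<sigma>' k'. k \<le> k' + 300 * f * length qs + 40 \<and> (\<exists>L' qs'. ready r L' (set qs') \<sigma>' \<and>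
      chain (nmem \<sigma>' 9) (nmem \<sigma>' 16 0) qs' \<and> distinct qs' \<and> set qs' \<subseteq> set qs \<and>
      (\<forall>t\<in>set qs'. \<forall>s\<in>SS \<sigma> t. \<not> tight \<sigma> s) \<and>
      (\<forall>t\<in>set qs - set qs'. nmem \<sigma>' 8 t = r) \<and> (\<forall>t. t \<notin> set qs \<longrightarrow> nmem \<sigma>' 8 t = nmem \<sigma> 8 t) \<and>
      nmem \<sigma> 15 0 \<le> nmem \<sigma>' 15 0 \<and> nmem \<sigma>' 15 0 \<le> max (nmem \<sigma> 15 0) r)) \<sigma> k"
proof -
  let ?K = "k - (300 * f * length qs + 40)"
  define I where "I \<sigma>' k' \<longleftrightarrow> (\<exists>L' ys zs. ready r L' (set ys \<union> set zs) \<sigma>' \<and>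
      chain (nmem \<sigma>' 9) (nmem \<sigma>' 16 0) ys \<and> chain (nmem \<sigma>' 9) (nmem \<sigma>' 17 0) zs \<and> distinct (ys @ zs) \<and>
      set ys \<union> set zs \<subseteq> set qs \<and>
      (\<forall>t\<in>set ys \<union> set zs. \<forall>s\<in>SS \<sigma> t. nmem \<sigma>' 3 s = 0 \<or> nmem \<sigma>' 3 s = r) \<and>
      (\<forall>t\<in>set zs. \<forall>s\<in>SS \<sigma> t. \<not> tight \<sigma> s) \<and>
      (\<forall>t\<in>set qs - (set ys \<union> set zs). nmem \<sigma>' 8 t = r) \<and> (\<forall>t. t \<notin> set qs \<longrightarrow> nmem \<sigma>' 8 t = nmem \<sigma> 8 t) \<and>
      nmem \<sigma> 15 0 \<le> nmem \<sigma>' 15 0 \<and> nmem \<sigma>' 15 0 \<le> max (nmem \<sigma> 15 0) r \<and>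
      ?K + 300 * f * length ys + 20 \<le> k')" for \<sigma>' k'
  let ?body = "Seq (NSet 18 (NSub (NV 16) (NConst 1)))
          (Seq (NSet 16 (NRead 9 (NV 18)))
            (Seq mark_tight
              (Cond (NEq (NV 23) (NConst 0))
                (Seq (NWrite 9 (NV 18) (NV 17)) (NSet 17 (NAdd (NV 18) (NConst 1))))
                place)))"
  let ?Q = "\<lambda>\<sigma>' k'. k \<le> k' + 300 * f * length qs + 40 \<and> (\<exists>L' qs'. ready r L' (set qs') \<sigma>' \<and>
      chain (nmem \<sigma>' 9) (nmem \<sigma>' 16 0) qs' \<and> distinct qs' \<and> set qs' \<subseteq> set qs \<and>
      (\<forall>t\<in>set qs'. \<forall>s\<in>SS \<sigma> t. \<not> tight \<sigma> s) \<and>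
      (\<forall>t\<in>set qs - set qs'. nmem \<sigma>' 8 t = r) \<and> (\<forall>t. t \<notin> set qs \<longrightarrow> nmem \<sigma>' 8 t = nmem \<sigma> 8 t) \<and>
      nmem \<sigma> 15 0 \<le> nmem \<sigma>' 15 0 \<and> nmem \<sigma>' 15 0 \<le> max (nmem \<sigma> 15 0) r)"
  have sy: "sys \<sigma>" and pr: "prm \<sigma>" and li: "lists L (set qs) \<sigma>" using re by (auto simp: ready_def mid_def)
  have "wp (While (NLess (NConst 0) (NV 16)) ?body) (wp (NSet 16 (NV 17)) ?Q) (nset 17 0 0 \<sigma>) (k - 3)"
  proof (rule wp_While[where I = I], goal_cases)
    case 1
    have "ready r L (set qs) (nset 17 0 0 \<sigma>)" by (rule ready_cong[OF re]) simp_all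
    with ch dist lev k show ?case
      unfolding I_def by (intro exI[of _ L] exI[of _ qs] exI[of _ "[]"]) auto
  next
    case (2 \<sigma>1 k1)
    then obtain L' ys zs where re1: "ready r L' (set ys \<union> set zs) \<sigma>1" and
      c1: "chain (nmem \<sigma>1 9) (nmem \<sigma>1 16 0) ys" "chain (nmem \<sigma>1 9) (nmem \<sigma>1 17 0) zs" "distinct (ys @ zs)"
        "set ys \<union> set zs \<subseteq> set qs" and
      l1: "\<forall>t\<in>set ys \<union> set zs. \<forall>s\<in>SS \<sigma> t. nmem \<sigma>1 3 s = 0 \<or> nmem \<sigma>1 3 s = r" and
      n1: "\<forall>t\<in>set zs. \<forall>s\<in>SS \<sigma> t. \<not> tight \<sigma> s" and
      e1: "\<forall>t\<in>set qs - (set ys \<union> set zs). nmem \<sigma>1 8 t = r" "\<forall>t. t \<notin> set qs \<longrightarrow> nmem \<sigma>1 8 t = nmem \<sigma> 8 t" and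
      t1: "nmem \<sigma> 15 0 \<le> nmem \<sigma>1 15 0" "nmem \<sigma>1 15 0 \<le> max (nmem \<sigma> 15 0) r" and
      k1: "?K + 300 * f * length ys + 20 \<le> k1"
      unfolding I_def by blast
    define t where "t = nmem \<sigma>1 16 0 - Suc 0"
    obtain ys' where ys: "ys = t # ys'" "chain (nmem \<sigma>1 9) (nmem \<sigma>1 9 t) ys'"
      using chain_Suc[OF c1(1)] 2(3) by (auto simp: t_def)
    have tq: "t \<in> set qs" using c1 ys by auto
    have tN: "t < nmem \<sigma> 14 0" using tq li by (auto simp: lists_def)
    have f: "1 \<le> f" using sysD(5)[OF sy tN] .
    have fr1: "nmem \<sigma>1 4 = nmem \<sigma> 4" "nmem \<sigma>1 5 = nmem \<sigma> 5" "nmem \<sigma>1 14 = nmem \<sigma> 14" "nmem \<sigma>1 20 = nmem \<sigma> 20"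
      "nmem \<sigma>1 7 = nmem \<sigma> 7" "rmem \<sigma>1 = rmem \<sigma>"
      using 2(1) by (auto simp: frame_def)
    have S1: "SS \<sigma>1 = SS \<sigma>" using fr1 by (simp add: SS_def fun_eq_iff)
    have tg1: "tight \<sigma>1 = tight \<sigma>" by (rule tight_cong) (simp add: fr1)
    let ?\<sigma>2 = "nset 16 0 (nmem \<sigma>1 9 t) (nset 18 0 t \<sigma>1)"
    have s2: "sys ?\<sigma>2" "prm ?\<sigma>2"
      using sy pr fr1 by (auto simp: sys_def prm_def SS_def)
    have kk: "?K + 300 * f * length ys' + 20 + 300 * f \<le> k1" using k1 ys by (simp add: algebra_simps)
    then have k300: "300 \<le> k1" using f by linarith
    have S2: "SS ?\<sigma>2 = SS \<sigma>" "tight ?\<sigma>2 = tight \<sigma>" using S1 fr1 by (auto simp: tight_def fun_eq_iff)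
    have mt: "wp mark_tight (\<lambda>\<sigma>' k'. k1 - 16 \<le> k' + 120 * f \<and>
      (nmem \<sigma>' 23 0 = 0 \<longleftrightarrow> (\<forall>s\<in>SS \<sigma> t. \<not> tight \<sigma> s)) \<and>
      nmem \<sigma>' 2 = (\<lambda>s. if s \<in> SS \<sigma> t \<and> tight \<sigma> s then 1 else nmem \<sigma>1 2 s) \<and>
      nmem \<sigma>' 3 = (\<lambda>s. if s \<in> SS \<sigma> t \<and> tight \<sigma> s then r else nmem \<sigma>1 3 s)) ?\<sigma>2 (k1 - 16)"
    proof -
      have "120 * f \<le> k1 - 16" using kk f by linarith
      from wp_mark_tight[OF s2(1) _ _ this s2(2), of t] tN show ?thesis
        unfolding S2 using fr1 r by (simp cong: if_cong)
    qed
    have "wp mark_tight (wp (Cond (NEq (NV 23) (NConst 0))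
                (Seq (NWrite 9 (NV 18) (NV 17)) (NSet 17 (NAdd (NV 18) (NConst 1))))
                place) I) ?\<sigma>2 (k1 - 16)"
    proof (rule wp_mono_frame[OF mt], goal_cases)
      case (1 \<sigma>3 k3)
      then have f3: "frame mark_tight ?\<sigma>2 \<sigma>3" and k3: "k1 - 16 \<le> k3 + 120 * f" and
        fl: "nmem \<sigma>3 23 0 = 0 \<longleftrightarrow> (\<forall>s\<in>SS \<sigma> t. \<not> tight \<sigma> s)" and
        m2: "nmem \<sigma>3 2 = (\<lambda>s. if s \<in> SS \<sigma> t \<and> tight \<sigma> s then 1 else nmem \<sigma>1 2 s)" and
        m3: "nmem \<sigma>3 3 = (\<lambda>s. if s \<in> SS \<sigma> t \<and> tight \<sigma> s then r else nmem \<sigma>1 3 s)" by auto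
      have fr3: "a \<notin> {2, 3, 16, 18, 19, 23} \<Longrightarrow> nmem \<sigma>3 a = nmem \<sigma>1 a" "rmem \<sigma>3 = rmem \<sigma>1"
        "nmem \<sigma>3 18 0 = t" "nmem \<sigma>3 16 0 = nmem \<sigma>1 9 t" for a
        using f3 by (auto simp: frame_def fun_eq_iff)
      have k3': "?K + 300 * f * length ys' + 20 + 160 * f \<le> k3" using kk k3 f by linarith
      show ?case
      proof (cases "nmem \<sigma>3 23 0 = 0")
        case True
        then have nt: "\<forall>s\<in>SS \<sigma> t. \<not> tight \<sigma> s" using fl by simp
        then have m: "nmem \<sigma>3 2 = nmem \<sigma>1 2" "nmem \<sigma>3 3 = nmem \<sigma>1 3" by (auto simp: m2 m3 fun_eq_iff)
        let ?\<sigma>4 = "nset 17 0 (Suc t) (nset 9 t (nmem \<sigma>1 17 0) \<sigma>3)"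
        have nL: "t \<notin> set (L' j)" for j
          using re1 ys(1) by (auto simp: ready_def mid_def lists_def)
        have "ready r L' (set ys \<union> set zs) ?\<sigma>4"
          by (rule ready_cong[OF re1]) (use m fr3 nL in auto)
        then have "ready r L' (set ys' \<union> set (t # zs)) ?\<sigma>4" using ys(1) by simp
        moreover have "chain (nmem ?\<sigma>4 9) (nmem ?\<sigma>4 16 0) ys'" "chain (nmem ?\<sigma>4 9) (nmem ?\<sigma>4 17 0) (t # zs)"
          using ys c1 fr3 by auto
        moreover have "distinct (ys' @ t # zs)" "set ys' \<union> set (t # zs) \<subseteq> set qs" using c1(3,4) ys(1) by auto
        moreover have "\<forall>u\<in>set ys' \<union> set (t # zs). \<forall>s\<in>SS \<sigma> u. nmem ?\<sigma>4 3 s = 0 \<or> nmem ?\<sigma>4 3 s = r"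
          using l1 ys(1) m by auto
        moreover have "\<forall>u\<in>set (t # zs). \<forall>s\<in>SS \<sigma> u. \<not> tight \<sigma> s" using n1 nt by auto
        moreover have "\<forall>u\<in>set qs - (set ys' \<union> set (t # zs)). nmem ?\<sigma>4 8 u = r"
          "\<forall>u. u \<notin> set qs \<longrightarrow> nmem ?\<sigma>4 8 u = nmem \<sigma> 8 u" "nmem ?\<sigma>4 15 0 = nmem \<sigma>1 15 0"
          using e1 ys(1) fr3(1) by auto
        moreover have "?K + 300 * f * length ys' + 20 \<le> k3 - 16" using k3' f by linarith
        ultimately have "I ?\<sigma>4 (k3 - 16)"
          unfolding I_def using t1 by metis
        then show ?thesis
          using True k3' f fr3 by (auto simp: numeral_2_eq_2[symmetric])
      next
        case False
        then have ti: "\<exists>s\<in>SS \<sigma> t. tight \<sigma> s" using fl by auto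
        have k80: "80 \<le> k3 - 5" using k3' f by linarith
        have "nmem \<sigma>3 20 0 = r" using fr3 fr1 r by auto
        have "wp place I \<sigma>3 (k3 - 5)"
        proof (rule wp_mono_frame[OF wp_place[OF fr3(3) \<open>nmem \<sigma>3 20 0 = r\<close> k80]], goal_cases)
          case (1 \<sigma>4 k4)
          have fr4: "a \<notin> {2, 3, 8, 9, 11, 12, 15, 16, 18, 19, 23} \<Longrightarrow> nmem \<sigma>4 a = nmem \<sigma>1 a" "rmem \<sigma>4 = rmem \<sigma>1"
            "nmem \<sigma>4 2 = nmem \<sigma>3 2" "nmem \<sigma>4 3 = nmem \<sigma>3 3" "nmem \<sigma>4 16 0 = nmem \<sigma>1 9 t" for a
            using 1(1) fr3 by (auto simp: frame_def fun_eq_iff)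
          have "ready r (L'(r := t # L' r)) (set ys \<union> set zs - {t}) \<sigma>4"
          proof (rule ready_place[OF re1], goal_cases)
            case 1 show ?case using ys by simp
          next
            case (2 u) then show ?case using c1(4) Qw fr1 by auto
          next
            case 3 then show ?case using tq Qw fr1 by auto
          next
            case (4 s) then show ?case using l1 ys S1 by auto
          next
            case 5 show ?case using ti by (simp add: S1 tg1)
          next
            case 6 show ?case using fr4 m2 by (simp add: S1 tg1)
          next
            case 7 show ?case using fr4 m3 by (simp add: S1 tg1)
          qed (use 1 fr3 fr4 in auto)
          moreover have "set ys \<union> set zs - {t} = set ys' \<union> set zs" using ys c1 by auto
          ultimately have re4: "ready r (L'(r := t # L' r)) (set ys' \<union> set zs) \<sigma>4" by simp
          have nx: "nmem \<sigma>4 9 = (nmem \<sigma>1 9)(t := nmem \<sigma>1 11 r)" using 1 fr3 by auto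
          have l4: "\<forall>u\<in>set ys' \<union> set zs. \<forall>s\<in>SS \<sigma> u. nmem \<sigma>4 3 s = 0 \<or> nmem \<sigma>4 3 s = r"
            using l1 ys fr4 m3 by auto
          have "t \<notin> set ys'" "t \<notin> set zs" using c1(3) ys(1) by auto
          then have "chain (nmem \<sigma>4 9) (nmem \<sigma>4 16 0) ys'" "chain (nmem \<sigma>4 9) (nmem \<sigma>4 17 0) zs"
            using ys(2) c1(2) fr4 by (simp_all add: nx)
          moreover have "distinct (ys' @ zs)" "set ys' \<union> set zs \<subseteq> set qs" using c1(3,4) ys(1) by auto
          moreover have e8: "nmem \<sigma>4 8 = (nmem \<sigma>1 8)(t := r)" using 1 fr3 by auto
          have "\<forall>u\<in>set qs - (set ys' \<union> set zs). nmem \<sigma>4 8 u = r" "\<forall>u. u \<notin> set qs \<longrightarrow> nmem \<sigma>4 8 u = nmem \<sigma> 8 u"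
            using e1 ys(1) tq unfolding e8 by auto
          moreover have "nmem \<sigma> 15 0 \<le> nmem \<sigma>4 15 0" "nmem \<sigma>4 15 0 \<le> max (nmem \<sigma> 15 0) r"
            using 1(3) t1 fr3(1)[of 15] by auto
          moreover have "?K + 300 * f * length ys' + 20 \<le> k4" using k3' 1(3) f by linarith
          ultimately show ?case
            unfolding I_def using re4 l4 n1 by metis
        qed
        then show ?thesis
          using False k3' f by (simp add: numeral_2_eq_2[symmetric])
      qed
    qed
    then show ?case
      using k300 fr1 by (auto simp: numeral_2_eq_2[symmetric] t_def)
  next
    case (3 \<sigma>1 k1)
    then obtain L' ys zs where re1: "ready r L' (set ys \<union> set zs) \<sigma>1" and
      c1: "chain (nmem \<sigma>1 9) (nmem \<sigma>1 16 0) ys" "chain (nmem \<sigma>1 9) (nmem \<sigma>1 17 0) zs" "distinct (ys @ zs)"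
        "set ys \<union> set zs \<subseteq> set qs" and
      n1: "\<forall>t\<in>set zs. \<forall>s\<in>SS \<sigma> t. \<not> tight \<sigma> s" and
      e1: "\<forall>t\<in>set qs - (set ys \<union> set zs). nmem \<sigma>1 8 t = r" "\<forall>t. t \<notin> set qs \<longrightarrow> nmem \<sigma>1 8 t = nmem \<sigma> 8 t" and
      t1: "nmem \<sigma> 15 0 \<le> nmem \<sigma>1 15 0" "nmem \<sigma>1 15 0 \<le> max (nmem \<sigma> 15 0) r" and
      k1: "?K + 300 * f * length ys + 20 \<le> k1"
      unfolding I_def by blast
    have ys: "ys = []" using 3(3) c1(1) by (cases ys) auto
    have "ready r L' (set ys \<union> set zs) (nset 16 0 (nmem \<sigma>1 17 0) \<sigma>1)"
      by (rule ready_cong[OF re1]) auto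
    then have "?Q (nset 16 0 (nmem \<sigma>1 17 0) \<sigma>1) (k1 - 9)"
      using c1 n1 e1 t1 k1 ys k by (intro conjI exI[of _ L'] exI[of _ zs]) auto
    then show ?case
      using k1 by (simp add: numeral_2_eq_2[symmetric])
  qed
  then show ?thesis
    using k by (simp add: freeze_def numeral_2_eq_2[symmetric])
qed

section \<open>Settling the queue from the starting level down to level 0\<close>

lemma nwr_settle [simp]:
  "nwr settle = {2, 3, 7, 8, 9, 11, 12, 15, 16, 17, 18, 19, 20, 22, 23}" "rwr settle = {2, 3, 5}"
  by (auto simp: settle_def)

text \<open>No cost exceeds 1, so a single element of weight 1, the weight of level 0, makes all its
  sets tight. Hence the last round empties the queue.\<close>

lemma ready_tight_0:
  assumes re: "ready r L Q \<sigma>" and t: "t < nmem \<sigma> 14 0" "s \<in> SS \<sigma> t" "1 \<le> rmem \<sigma> 3 t"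
  shows "tight \<sigma> s"
proof -
  have we: "weights L Q \<sigma>" and sy: "sys \<sigma>" using re by (auto simp: ready_def mid_def)
  have sm: "s < m" using sysD(1)[OF sy t(1)] t by auto
  have "rmem \<sigma> 3 t \<le> load \<sigma> (rmem \<sigma> 3) s"
    unfolding load_def by (rule member_le_sum) (use t we in \<open>auto simp: weights_def\<close>)
  then have w1: "1 \<le> rmem \<sigma> 2 s" using t we sm by (auto simp: weights_def wsum_def)
  have "rmem \<sigma> 2 s \<le> (1 + x) * rmem \<sigma> 2 s" using w1 x_pos by (simp add: algebra_simps)
  then show ?thesis unfolding tight_def using w1 c_le[OF sm] by linarith
qed

text \<open>It is not known in advance which passive elements become active, so the credits required
  are those of the worst case, in which every element takes part in all \<open>kk + 1\<close>
  rounds. The postcondition charges an element that stays passive for one round only and returns the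
  difference.\<close>

lemma wp_settle:
  assumes re: "ready kk L (set qs) \<sigma>"
    and ch: "chain (nmem \<sigma> 9) (nmem \<sigma> 16 0) qs" and dist: "distinct qs"
    and kk: "nmem \<sigma> 21 0 = kk" and pw: "\<And>j. j \<le> kk \<Longrightarrow> rmem \<sigma> 4 j = p j"
    and Q: "\<And>t. t \<in> set qs \<Longrightarrow> rmem \<sigma> 3 t = (if nmem \<sigma> 7 t = 0 then 0 else p kk)"
    and lev: "\<And>t s. t \<in> set qs \<Longrightarrow> s \<in> SS \<sigma> t \<Longrightarrow> nmem \<sigma> 3 s = 0"
    and k: "300 * f * length qs + 500 * f * ((kk + 1) * length qs) + 100 * (kk + 2) \<le> k"
  shows "wp settle (\<lambda>\<sigma>' k'.
      k \<le> k' + 300 * f * length qs + 500 * f * (\<Sum>t\<in>set qs. if nmem \<sigma>' 7 t = 0 then 1 else kk + 1) + 100 * (kk + 2) \<and>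
      (\<exists>L'. ready 0 L' {} \<sigma>') \<and>
      (\<forall>t. t \<notin> set qs \<longrightarrow> nmem \<sigma>' 8 t = nmem \<sigma> 8 t \<and> nmem \<sigma>' 7 t = nmem \<sigma> 7 t) \<and>
      (\<forall>t\<in>set qs. nmem \<sigma>' 8 t \<le> kk \<and> (nmem \<sigma> 7 t \<noteq> 0 \<longrightarrow> nmem \<sigma>' 7 t \<noteq> 0) \<and> (nmem \<sigma>' 7 t = 0 \<longrightarrow> nmem \<sigma>' 8 t = kk)) \<and>
      nmem \<sigma> 15 0 \<le> nmem \<sigma>' 15 0 \<and> nmem \<sigma>' 15 0 \<le> max (nmem \<sigma> 15 0) kk) \<sigma> k"
proof -
  have mid: "mid 0 L (set qs) \<sigma>" using re by (simp add: ready_def)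
  have li: "lists L (set qs) \<sigma>" and sy: "sys \<sigma>" using mid by (auto simp: mid_def)
  have kf: "300 * f * length qs + 20 \<le> k" by (rule le_trans[OF _ k]) simp
  let ?body = "Seq (NSet 20 (NSub (NV 20) (NConst 1))) (Seq freeze lift_queue)"
  let ?post = "\<lambda>\<sigma>' k'.
      k \<le> k' + 300 * f * length qs + 500 * f * (\<Sum>t\<in>set qs. if nmem \<sigma>' 7 t = 0 then 1 else kk + 1) + 100 * (kk + 2) \<and>
      (\<exists>L'. ready 0 L' {} \<sigma>') \<and>
      (\<forall>t. t \<notin> set qs \<longrightarrow> nmem \<sigma>' 8 t = nmem \<sigma> 8 t \<and> nmem \<sigma>' 7 t = nmem \<sigma> 7 t) \<and>
      (\<forall>t\<in>set qs. nmem \<sigma>' 8 t \<le> kk \<and> (nmem \<sigma> 7 t \<noteq> 0 \<longrightarrow> nmem \<sigma>' 7 t \<noteq> 0) \<and> (nmem \<sigma>' 7 t = 0 \<longrightarrow> nmem \<sigma>' 8 t = kk)) \<and>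
      nmem \<sigma> 15 0 \<le> nmem \<sigma>' 15 0 \<and> nmem \<sigma>' 15 0 \<le> max (nmem \<sigma> 15 0) kk"
  have pwk: "rmem \<sigma> 4 (nmem \<sigma> 21 0) = p kk" using pw kk by simp
  have "wp fill (wp (NSet 20 (NAdd (NV 21) (NConst 1))) (wp (While (NLess (NConst 0) (NV 20)) ?body) ?post)) \<sigma> k"
  proof (rule wp_mono_frame[OF wp_fill[OF mid ch dist pwk Q kf]], goal_cases)
    case (2 \<sigma>1 k1)
    then have fr1: "a \<notin> {7, 18, 19, 22} \<Longrightarrow> nmem \<sigma>1 a = nmem \<sigma> a" "a \<notin> {2, 3, 5} \<Longrightarrow> rmem \<sigma>1 a = rmem \<sigma> a" for a
      by (auto simp: frame_def)
    have k1: "k \<le> k1 + 300 * f * length qs + 20" and mid1: "mid 0 L (set qs) \<sigma>1"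
      and act1: "\<And>t. t \<notin> set qs \<Longrightarrow> nmem \<sigma>1 7 t = nmem \<sigma> 7 t"
      and Q1: "\<And>t. t \<in> set qs \<Longrightarrow> rmem \<sigma>1 3 t \<le> p kk \<and> (nmem \<sigma>1 7 t \<noteq> 0 \<longrightarrow> rmem \<sigma>1 3 t = p kk) \<and>
        (nmem \<sigma> 7 t \<noteq> 0 \<longrightarrow> nmem \<sigma>1 7 t \<noteq> 0) \<and> (nmem \<sigma>1 7 t = 0 \<longrightarrow> (\<exists>s\<in>SS \<sigma> t. tight \<sigma>1 s))"
      using 2(3) by auto
    have S1: "SS \<sigma>1 = SS \<sigma>" using fr1 by (simp add: SS_def fun_eq_iff)
    have co1: "count L \<sigma>1 i" for i
    proof -
      have "nmem \<sigma>1 7 t = nmem \<sigma> 7 t" if "t \<in> set (L i)" for t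
        using act1 li that by (auto simp: lists_def)
      then have "{t \<in> set (L i). nmem \<sigma>1 6 t \<noteq> 0 \<and> nmem \<sigma>1 7 t \<noteq> 0} = {t \<in> set (L i). nmem \<sigma> 6 t \<noteq> 0 \<and> nmem \<sigma> 7 t \<noteq> 0}"
        using fr1 by auto
      moreover have "count L \<sigma> i" using re by (auto simp: ready_def)
      ultimately show ?thesis using fr1 by (simp add: count_def)
    qed
    have re1: "ready kk L (set qs) \<sigma>1"
      using re mid1 co1 fr1 by (simp add: ready_def)
    \<comment> \<open>\<open>g j t\<close> bounds the number of rounds that a queued
      \<open>t\<close> still takes part in when register 20 holds \<open>j\<close>: an element that
      stays passive leaves in the first round.\<close>
    define g where "g j t = (if nmem \<sigma>1 7 t = 0 then 1 else j)" for j t :: nat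
    have gle: "(\<Sum>t\<in>set qs. g (kk + 1) t) \<le> (kk + 1) * length qs"
    proof -
      have "(\<Sum>t\<in>set qs. g (kk + 1) t) \<le> (\<Sum>t\<in>set qs. kk + 1)"
        by (rule sum_mono) (auto simp: g_def)
      then show ?thesis using dist by (simp add: distinct_card mult.commute)
    qed
    have kK: "500 * f * (\<Sum>t\<in>set qs. g (kk + 1) t) + 100 * (kk + 1) + 20 + 6 \<le> k1"
    proof -
      have "500 * f * (\<Sum>t\<in>set qs. g (kk + 1) t) \<le> 500 * f * ((kk + 1) * length qs)"
        using gle by (rule mult_le_mono2)
      with k k1 show ?thesis by (simp only: distrib_left)
    qed
    define K0 where "K0 = k1 - (500 * f * (\<Sum>t\<in>set qs. g (kk + 1) t) + 100 * (kk + 1) + 20 + 6)"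
    have kK: "K0 + 500 * f * (\<Sum>t\<in>set qs. g (kk + 1) t) + 100 * (kk + 1) + 26 = k1"
      using kK by (simp add: K0_def)
    \<comment> \<open>At the loop head register 20 is one more than the level of the coming round,
      and the queued weights already fit that level. A passive element can be queued only before the
      first round, where it has a tight set.\<close>
    define I where "I \<sigma>' k' \<longleftrightarrow> (\<exists>L' qs'. nmem \<sigma>' 20 0 \<le> kk + 1 \<and> chain (nmem \<sigma>' 9) (nmem \<sigma>' 16 0) qs' \<and> distinct qs' \<and>
      set qs' \<subseteq> set qs \<and> ready (nmem \<sigma>' 20 0 - 1) L' (set qs') \<sigma>' \<and> (nmem \<sigma>' 20 0 = 0 \<longrightarrow> qs' = []) \<and>
      (\<forall>t\<in>set qs'. rmem \<sigma>' 3 t \<le> p (nmem \<sigma>' 20 0 - 1) \<and> (nmem \<sigma>1 7 t \<noteq> 0 \<longrightarrow> rmem \<sigma>' 3 t = p (nmem \<sigma>' 20 0 - 1)) \<and>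
        (\<forall>s\<in>SS \<sigma> t. nmem \<sigma>' 3 s = 0) \<and> (nmem \<sigma>1 7 t = 0 \<longrightarrow> nmem \<sigma>' 20 0 = kk + 1 \<and> (\<exists>s\<in>SS \<sigma> t. tight \<sigma>' s))) \<and>
      (\<forall>t\<in>set qs - set qs'. nmem \<sigma>' 8 t \<le> kk \<and> (nmem \<sigma>1 7 t = 0 \<longrightarrow> nmem \<sigma>' 8 t = kk)) \<and>
      (\<forall>t. t \<notin> set qs \<longrightarrow> nmem \<sigma>' 8 t = nmem \<sigma> 8 t) \<and>
      nmem \<sigma> 15 0 \<le> nmem \<sigma>' 15 0 \<and> nmem \<sigma>' 15 0 \<le> max (nmem \<sigma> 15 0) kk \<and>
      K0 + 500 * f * (\<Sum>t\<in>set qs'. g (nmem \<sigma>' 20 0) t) + 100 * nmem \<sigma>' 20 0 + 20 \<le> k')" for \<sigma>' k'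
    have "wp (While (NLess (NConst 0) (NV 20)) ?body) ?post (nset 20 0 (kk + 1) \<sigma>1) (k1 - 6)"
    proof (rule wp_While[where I = I], goal_cases)
      case 1
      have "ready kk L (set qs) (nset 20 0 (kk + 1) \<sigma>1)" by (rule ready_cong[OF re1]) simp_all
      moreover have "tight (nset 20 0 (kk + 1) \<sigma>1) = tight \<sigma>1" by (rule tight_cong) simp
      ultimately show ?case
        unfolding I_def using ch dist fr1 Q1 lev kK
        by (intro exI[of _ L] exI[of _ qs]) (auto simp: S1)
    next
      case (2 \<sigma>2 k2)
      then obtain L2 q2 where j2: "nmem \<sigma>2 20 0 \<le> kk + 1" and c2: "chain (nmem \<sigma>2 9) (nmem \<sigma>2 16 0) q2" "distinct q2"
        "set q2 \<subseteq> set qs" and re2: "ready (nmem \<sigma>2 20 0 - 1) L2 (set q2) \<sigma>2" and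
        Q2: "\<forall>t\<in>set q2. rmem \<sigma>2 3 t \<le> p (nmem \<sigma>2 20 0 - 1) \<and> (nmem \<sigma>1 7 t \<noteq> 0 \<longrightarrow> rmem \<sigma>2 3 t = p (nmem \<sigma>2 20 0 - 1)) \<and>
        (\<forall>s\<in>SS \<sigma> t. nmem \<sigma>2 3 s = 0) \<and> (nmem \<sigma>1 7 t = 0 \<longrightarrow> nmem \<sigma>2 20 0 = kk + 1 \<and> (\<exists>s\<in>SS \<sigma> t. tight \<sigma>2 s))" and
        e2: "\<forall>t\<in>set qs - set q2. nmem \<sigma>2 8 t \<le> kk \<and> (nmem \<sigma>1 7 t = 0 \<longrightarrow> nmem \<sigma>2 8 t = kk)"
          "\<forall>t. t \<notin> set qs \<longrightarrow> nmem \<sigma>2 8 t = nmem \<sigma> 8 t" and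
        t2: "nmem \<sigma> 15 0 \<le> nmem \<sigma>2 15 0" "nmem \<sigma>2 15 0 \<le> max (nmem \<sigma> 15 0) kk" and
        k2: "K0 + 500 * f * (\<Sum>t\<in>set q2. g (nmem \<sigma>2 20 0) t) + 100 * nmem \<sigma>2 20 0 + 20 \<le> k2"
        unfolding I_def by blast
      define r where "r = nmem \<sigma>2 20 0 - 1"
      have jr: "nmem \<sigma>2 20 0 = Suc r" using 2(3) by (simp add: r_def)
      have fr2: "a \<notin> {2, 3, 8, 9, 11, 12, 15, 16, 17, 18, 19, 20, 22, 23} \<Longrightarrow> nmem \<sigma>2 a = nmem \<sigma>1 a"
        "a \<notin> {2, 3, 5} \<Longrightarrow> rmem \<sigma>2 a = rmem \<sigma>1 a" for a
        using 2(1) by (auto simp: frame_def)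
      have S2: "SS \<sigma>2 = SS \<sigma>" using fr1 fr2 by (simp add: SS_def fun_eq_iff)
      let ?\<sigma>3 = "nset 20 0 r \<sigma>2"
      have re3: "ready r L2 (set q2) ?\<sigma>3" by (rule ready_cong[of r L2 "set q2" \<sigma>2]) (use re2 r_def in simp_all)
      have tg3: "tight ?\<sigma>3 = tight \<sigma>2" by (rule tight_cong) simp
      \<comment> \<open>One unit per queued element is for the current round; the survivors
        \<open>q'\<close>, all active, keep \<open>r\<close> units each for the rounds to
        come.\<close>
      have sum2: "length q2 + r * length q' \<le> (\<Sum>t\<in>set q2. g (Suc r) t)"
        if "set q' \<subseteq> set q2" "distinct q'" "\<forall>t\<in>set q'. nmem \<sigma>1 7 t \<noteq> 0" for q'
      proof -
        have "(\<Sum>t\<in>set q2. 1 + (if t \<in> set q' then r else 0)) \<le> (\<Sum>t\<in>set q2. g (Suc r) t)"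
          by (rule sum_mono) (use that in \<open>auto simp: g_def\<close>)
        moreover have "(\<Sum>t\<in>set q2. 1 + (if t \<in> set q' then r else 0)) = length q2 + r * length q'"
        proof -
          have "(\<Sum>t\<in>set q2. if t \<in> set q' then r else 0) = (\<Sum>t\<in>set q'. r)"
            by (rule sum.mono_neutral_cong_right) (use that in auto)
          then show ?thesis
            using that c2(2) by (simp only: sum.distrib sum_constant distinct_card mult.commute) simp
        qed
        ultimately show ?thesis by simp
      qed
      define G where "G = f * (\<Sum>t\<in>set q2. g (Suc r) t)"
      have k2': "K0 + 500 * G + 100 * r + 120 \<le> k2"
        using k2 unfolding jr G_def by (simp add: mult.assoc)
      have "f * length q2 \<le> G"
        unfolding G_def using sum2[of "[]"] by simp
      then have k3: "300 * f * length q2 + 40 \<le> k2 - 11"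
        using k2' unfolding mult.assoc[of 300] by linarith
      have "wp freeze (wp lift_queue I) ?\<sigma>3 (k2 - 11)"
      proof (rule wp_mono_frame[OF wp_freeze[OF re3 _ c2(2) _ _ _ k3]], goal_cases)
        case (5 \<sigma>4 k4)
        have fr4: "a \<notin> {2, 3, 8, 9, 11, 12, 15, 16, 17, 18, 19, 20, 23} \<Longrightarrow> nmem \<sigma>4 a = nmem \<sigma>2 a" "rmem \<sigma>4 = rmem \<sigma>2"
          "nmem \<sigma>4 20 0 = r" for a
          using 5(1) by (auto simp: frame_def fun_eq_iff)
        have S4: "SS \<sigma>4 = SS \<sigma>" using fr4 by (simp add: SS_def fun_eq_iff S2[unfolded SS_def fun_eq_iff])
        have tg4: "tight \<sigma>4 = tight \<sigma>2" by (rule tight_cong) (simp add: fr4)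
        obtain L4 q4 where re4: "ready r L4 (set q4) \<sigma>4" and c4: "chain (nmem \<sigma>4 9) (nmem \<sigma>4 16 0) q4" "distinct q4"
          "set q4 \<subseteq> set q2" and nt4: "\<forall>t\<in>set q4. \<forall>s\<in>SS \<sigma> t. \<not> tight \<sigma>2 s" and
          e4: "\<forall>t\<in>set q2 - set q4. nmem \<sigma>4 8 t = r" "\<forall>t. t \<notin> set q2 \<longrightarrow> nmem \<sigma>4 8 t = nmem \<sigma>2 8 t" and
          t4: "nmem \<sigma>2 15 0 \<le> nmem \<sigma>4 15 0" "nmem \<sigma>4 15 0 \<le> max (nmem \<sigma>2 15 0) r" and
          k4: "k2 - 11 \<le> k4 + 300 * f * length q2 + 40"
          using 5(3) by (auto simp: S2 tg3)
        have mid4: "mid 0 L4 (set q4) \<sigma>4" using re4 by (simp add: ready_def)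
        \<comment> \<open>An element without a tight set is not passive, since a passive one in the
          queue comes with a tight set.\<close>
        have a4: "nmem \<sigma>1 7 t \<noteq> 0" "rmem \<sigma>4 3 t = p r" if "t \<in> set q4" for t
        proof -
          show "nmem \<sigma>1 7 t \<noteq> 0" using that nt4 Q2 c4(3) by blast
          then show "rmem \<sigma>4 3 t = p r" using that Q2 c4(3) fr4 r_def by auto
        qed
        have r4: "0 < r" if "t \<in> set q4" for t
        proof (rule ccontr)
          assume "\<not> 0 < r"
          then have "1 \<le> rmem \<sigma>4 3 t" using a4(2)[OF that] by simp
          moreover have tN: "t < nmem \<sigma>4 14 0" "sys \<sigma>4" using mid4 that by (auto simp: mid_def lists_def)
          moreover obtain s where "s \<in> SS \<sigma>4 t" using sysD(2)[OF tN(2,1)] by blast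
          ultimately have "tight \<sigma>4 s" using ready_tight_0[OF re4] by blast
          with nt4 that \<open>s \<in> SS \<sigma>4 t\<close> S4 tg4 show False by auto
        qed
        \<comment> \<open>The 500 units per element and round are 300 for freezing \<open>q2\<close>
          and 200 for lifting \<open>q4\<close>, which is no longer than \<open>q2\<close>.\<close>
        have k4': "200 * f * length q4 + 20 \<le> k4" and
          k5': "K0 + 500 * f * (r * length q4) + 100 * r + 20 + (200 * f * length q4 + 20) \<le> k4"
        proof -
          have "f * (length q2 + r * length q4) \<le> G"
            unfolding G_def by (rule mult_le_mono2, rule sum2) (use c4 a4 in auto)
          then have "f * length q2 + f * (r * length q4) \<le> G" unfolding distrib_left .
          moreover have "length q4 \<le> length q2"
            using c4 c2(2) by (metis card_mono distinct_card List.finite_set)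
          then have "f * length q4 \<le> f * length q2" by (rule mult_le_mono2)
          ultimately show "200 * f * length q4 + 20 \<le> k4"
            "K0 + 500 * f * (r * length q4) + 100 * r + 20 + (200 * f * length q4 + 20) \<le> k4"
            using k2' k4 unfolding mult.assoc[of 200] mult.assoc[of 300] mult.assoc[of 500] by linarith+
        qed
        have pw4: "rmem \<sigma>4 4 (r - 1) = p (r - Suc 0)" using pw fr4 fr2 fr1 j2 jr by simp
        show ?case
        proof (rule wp_mono_frame[OF wp_lift_queue[OF mid4 c4(1,2) fr4(3) pw4 _ _ k4']], goal_cases)
          case (1 t) then show ?case using a4 r4 by auto
        next
          case (2 t s) then show ?case using nt4 S4 tg4 by auto
        next
          case (3 \<sigma>5 k5)
          have fr5: "a \<notin> {18, 19, 22} \<Longrightarrow> nmem \<sigma>5 a = nmem \<sigma>4 a" "a \<notin> {2, 3, 5} \<Longrightarrow> rmem \<sigma>5 a = rmem \<sigma>4 a" for a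
            using 3(1) by (auto simp: frame_def)
          have "count L4 \<sigma>5 = count L4 \<sigma>4" by (simp add: count_def fun_eq_iff fr5)
          then have re5: "ready (r - 1) L4 (set q4) \<sigma>5"
            using re4 3(3) fr5 by (auto simp: ready_def)
          have lev5: "nmem \<sigma>5 3 s = 0" if "t \<in> set q4" "s \<in> SS \<sigma> t" for t s
          proof -
            have "\<not> tight \<sigma>4 s" using nt4 that tg4 by auto
            then show ?thesis using mid4 fr5 by (auto simp: mid_def sets_def)
          qed
          have "(\<Sum>t\<in>set q4. g r t) = r * length q4"
          proof -
            have "(\<Sum>t\<in>set q4. g r t) = (\<Sum>t\<in>set q4. r)" by (rule sum.cong) (simp_all add: a4(1) g_def)
            then show ?thesis using c4(2) by (simp add: distinct_card mult.commute)
          qed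
          then have "K0 + 500 * f * (\<Sum>t\<in>set q4. g r t) + 100 * r + 20 \<le> k5" using k5' 3(3) by auto
          moreover have "r \<le> kk" using j2 jr by simp
          moreover have e5: "\<forall>t\<in>set qs - set q4. nmem \<sigma>5 8 t \<le> kk \<and> (nmem \<sigma>1 7 t = 0 \<longrightarrow> nmem \<sigma>5 8 t = kk)"
          proof
            fix t assume t: "t \<in> set qs - set q4"
            show "nmem \<sigma>5 8 t \<le> kk \<and> (nmem \<sigma>1 7 t = 0 \<longrightarrow> nmem \<sigma>5 8 t = kk)"
            proof (cases "t \<in> set q2")
              case True
              then have "nmem \<sigma>5 8 t = r" using e4 t fr5 by auto
              moreover have "r = kk" if "nmem \<sigma>1 7 t = 0" using Q2 True that jr by auto
              ultimately show ?thesis using \<open>r \<le> kk\<close> by auto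
            next
              case False
              then show ?thesis using e4 e2 t fr5 by auto
            qed
          qed
          moreover have "\<forall>t. t \<notin> set qs \<longrightarrow> nmem \<sigma>5 8 t = nmem \<sigma> 8 t"
            using e2 e4 c2(3) fr5 by auto
          moreover have "nmem \<sigma> 15 0 \<le> nmem \<sigma>5 15 0" "nmem \<sigma>5 15 0 \<le> max (nmem \<sigma> 15 0) kk"
            using t2 t4 fr5 \<open>r \<le> kk\<close> by auto
          moreover have j5: "nmem \<sigma>5 20 0 = r" using fr5 fr4 by simp
          moreover have "chain (nmem \<sigma>5 9) (nmem \<sigma>5 16 0) q4" using c4 fr5 by simp
          moreover have "set q4 \<subseteq> set qs" using c4 c2 by auto
          moreover have "r = 0 \<longrightarrow> q4 = []" using r4 by (cases q4) auto
          moreover have "\<forall>t\<in>set q4. rmem \<sigma>5 3 t \<le> p (r - 1) \<and> (nmem \<sigma>1 7 t \<noteq> 0 \<longrightarrow> rmem \<sigma>5 3 t = p (r - 1)) \<and>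
              (\<forall>s\<in>SS \<sigma> t. nmem \<sigma>5 3 s = 0) \<and> (nmem \<sigma>1 7 t = 0 \<longrightarrow> r = kk + 1 \<and> (\<exists>s\<in>SS \<sigma> t. tight \<sigma>5 s))"
            using 3(3) lev5 by (auto dest: a4(1))
          ultimately show ?case
            unfolding I_def j5 using re5 c4(2) le_SucI by (intro exI[of _ L4] exI[of _ q4]) auto
        qed
      next
        case 1 show ?case using c2 by simp
      next
        case 2 show ?case by simp
      next
        case (3 t) then show ?case using Q2 fr2 r_def by auto
      next
        case (4 t s) then show ?case using Q2 by (auto simp: S2)
      qed
      then show ?case
        using k2 jr by (auto simp: numeral_2_eq_2[symmetric])
    next
      case (3 \<sigma>2 k2)
      then have j0: "nmem \<sigma>2 20 0 = 0" by simp
      have a2: "nmem \<sigma>2 7 = nmem \<sigma>1 7" using 3(1) by (auto simp: frame_def)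
      obtain L2 where re2: "ready 0 L2 {} \<sigma>2" and
        e2: "\<forall>t\<in>set qs. nmem \<sigma>2 8 t \<le> kk \<and> (nmem \<sigma>1 7 t = 0 \<longrightarrow> nmem \<sigma>2 8 t = kk)"
          "\<forall>t. t \<notin> set qs \<longrightarrow> nmem \<sigma>2 8 t = nmem \<sigma> 8 t" and
        t2: "nmem \<sigma> 15 0 \<le> nmem \<sigma>2 15 0" "nmem \<sigma>2 15 0 \<le> max (nmem \<sigma> 15 0) kk" and
        k2: "K0 + 20 \<le> k2"
        using 3(2) unfolding I_def j0 by auto
      have "k \<le> k2 - 5 + 300 * f * length qs + 500 * f * (\<Sum>t\<in>set qs. g (kk + 1) t) + 100 * (kk + 2)"
        using k2 k1 kK unfolding distrib_left by linarith
      then have "?post \<sigma>2 (k2 - 5)"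
        using re2 e2 t2 act1 Q1 unfolding a2 g_def by auto
      then show ?case
        using k2 by (simp add: numeral_2_eq_2[symmetric])
    qed
    then show ?case
      using kK fr1 kk by (simp add: numeral_2_eq_2[symmetric])
  qed auto
  then show ?thesis
    by (simp add: settle_def)
qed

section \<open>Rebuilding the lower levels\<close>

text \<open>The new weight is at most the old one, so no set is overloaded. Every set whose weight
  changes is reset, so the sets left in the solution stay tight. A set of level at least
  \<open>kk\<close> cannot contain \<open>t\<close>, whose sets have level at most \<open>j\<close>;
  hence elements from level \<open>kk\<close> on stay covered.\<close>

lemma mid_collect:
  assumes mid: "mid kk L Q \<sigma>" and Lj: "L j = t # ts" and jk: "j < kk"
    and v: "v = (if nmem \<sigma> 6 t \<noteq> 0 \<and> nmem \<sigma> 7 t \<noteq> 0 then p kk else 0)"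
    and nx: "\<And>u. u \<noteq> t \<Longrightarrow> nmem \<sigma>' 9 u = nmem \<sigma> 9 u"
    and eq: "nmem \<sigma>' 11 = (nmem \<sigma> 11)(j := nmem \<sigma> 9 t)"
      "rmem \<sigma>' 2 = (\<lambda>s. rmem \<sigma> 2 s + (if s \<in> SS \<sigma> t then v - rmem \<sigma> 3 t else 0))"
      "rmem \<sigma>' 3 = (rmem \<sigma> 3)(t := v)"
      "nmem \<sigma>' 2 = (\<lambda>s. if s \<in> SS \<sigma> t then 0 else nmem \<sigma> 2 s)"
      "nmem \<sigma>' 3 = (\<lambda>s. if s \<in> SS \<sigma> t then 0 else nmem \<sigma> 3 s)"
      "nmem \<sigma>' 4 = nmem \<sigma> 4" "nmem \<sigma>' 5 = nmem \<sigma> 5" "nmem \<sigma>' 6 = nmem \<sigma> 6" "nmem \<sigma>' 7 = nmem \<sigma> 7"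
      "nmem \<sigma>' 8 = nmem \<sigma> 8" "nmem \<sigma>' 14 = nmem \<sigma> 14" "nmem \<sigma>' 15 = nmem \<sigma> 15"
      "rmem \<sigma>' 0 = rmem \<sigma> 0" "rmem \<sigma>' 1 = rmem \<sigma> 1"
  shows "mid kk (L(j := ts)) (if nmem \<sigma> 6 t \<noteq> 0 then insert t Q else Q) \<sigma>'"
proof -
  have pr: "prm \<sigma>" and sy: "sys \<sigma>" and li: "lists L Q \<sigma>" and we: "weights L Q \<sigma>" and se: "sets kk L \<sigma>"
    using mid by (auto simp: mid_def)
  have S: "SS \<sigma>' = SS \<sigma>" using eq by (simp add: SS_def fun_eq_iff)
  define L2 where "L2 = L(j := ts)"
  let ?Q = "if nmem \<sigma> 6 t \<noteq> 0 then insert t Q else Q"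
  have tj: "t \<in> set (L j)" using Lj by simp
  then have t: "t < nmem \<sigma> 14 0" "nmem \<sigma> 8 t = j" using li by (auto simp: lists_def)
  have sub: "u \<in> set (L2 i) \<Longrightarrow> u \<in> set (L i) \<and> u \<noteq> t" for u i
  proof -
    assume u: "u \<in> set (L2 i)"
    have dj: "distinct (L j)" using li by (auto simp: lists_def)
    show "u \<in> set (L i) \<and> u \<noteq> t"
    proof (cases "i = j")
      case True
      then show ?thesis using u dj Lj by (auto simp: L2_def)
    next
      case False
      then have "u \<in> set (L i)" using u by (simp add: L2_def)
      moreover have "nmem \<sigma> 8 u = i" using li calculation by (auto simp: lists_def)
      ultimately show ?thesis using False t by auto
    qed
  qed
  have mem: "u \<in> set (L i) \<Longrightarrow> u \<noteq> t \<Longrightarrow> u \<in> set (L2 i)" for u i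
    using Lj by (auto simp: L2_def)
  have vle: "v \<le> rmem \<sigma> 3 t"
  proof (cases "nmem \<sigma> 6 t \<noteq> 0 \<and> nmem \<sigma> 7 t \<noteq> 0")
    case True
    then have "rmem \<sigma> 3 t = p j" using we tj by (auto simp: weights_def)
    then show ?thesis using True v p_antimono[of j kk] jk by simp
  next
    case False
    then have "v = 0" unfolding v by (simp only: if_False)
    then show ?thesis using we t by (auto simp: weights_def)
  qed
  have v0: "0 \<le> v" unfolding v by (simp add: less_imp_le)
  have ch: "chain (nmem \<sigma>' 9) h xs = chain (nmem \<sigma> 9) h xs" if "t \<notin> set xs" for h xs
    by (rule chain_cong) (metis nx that)
  have "lists L2 ?Q \<sigma>'"
  proof -
    have "chain (nmem \<sigma>' 9) (nmem \<sigma>' 11 i) (L2 i) \<and> distinct (L2 i)" for i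
    proof (cases "i = j")
      case True
      have "chain (nmem \<sigma> 9) (nmem \<sigma> 11 j) (L j)" "distinct (L j)" using li by (auto simp: lists_def)
      then have "chain (nmem \<sigma> 9) (nmem \<sigma> 9 t) ts" "distinct ts" "t \<notin> set ts" using Lj by auto
      then show ?thesis using True ch by (simp add: eq L2_def)
    next
      case False
      then have "t \<notin> set (L i)" using li t by (auto simp: lists_def)
      then show ?thesis using False ch li by (simp add: eq lists_def L2_def)
    qed
    moreover have "\<forall>i. \<forall>u\<in>set (L2 i). u < nmem \<sigma>' 14 0 \<and> nmem \<sigma>' 8 u = i"
    proof (intro allI ballI)
      fix i u assume "u \<in> set (L2 i)"
      then have "u \<in> set (L i)" using sub by blast
      then show "u < nmem \<sigma>' 14 0 \<and> nmem \<sigma>' 8 u = i" using li by (auto simp: lists_def eq)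
    qed
    moreover have "\<forall>u\<in>?Q. u < nmem \<sigma>' 14 0 \<and> nmem \<sigma>' 6 u \<noteq> 0 \<and> (\<forall>i. u \<notin> set (L2 i))"
    proof
      fix u assume u: "u \<in> ?Q"
      then consider "u = t" "nmem \<sigma> 6 t \<noteq> 0" | "u \<in> Q" by (auto split: if_splits)
      then show "u < nmem \<sigma>' 14 0 \<and> nmem \<sigma>' 6 u \<noteq> 0 \<and> (\<forall>i. u \<notin> set (L2 i))"
      proof cases
        case 1 then show ?thesis using t sub[of t] by (auto simp: eq)
      next
        case 2
        then have "u < nmem \<sigma> 14 0 \<and> nmem \<sigma> 6 u \<noteq> 0 \<and> (\<forall>i. u \<notin> set (L i))" using li by (auto simp: lists_def)
        then show ?thesis using sub[of u] by (auto simp: eq)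
      qed
    qed
    moreover have "\<forall>u<nmem \<sigma>' 14 0. nmem \<sigma>' 6 u \<noteq> 0 \<longrightarrow> u \<in> ?Q \<or> u \<in> set (L2 (nmem \<sigma>' 8 u))"
    proof (intro allI impI)
      fix u assume u: "u < nmem \<sigma>' 14 0" "nmem \<sigma>' 6 u \<noteq> 0"
      then have "u \<in> Q \<or> u \<in> set (L (nmem \<sigma> 8 u))" using li by (auto simp: lists_def eq)
      then show "u \<in> ?Q \<or> u \<in> set (L2 (nmem \<sigma>' 8 u))"
        using u mem[of u] by (cases "u = t") (auto simp: eq)
    qed
    moreover have "\<forall>u<nmem \<sigma>' 14 0. nmem \<sigma>' 7 u \<le> 1" using li by (simp add: lists_def eq)
    ultimately show ?thesis unfolding lists_def by blast
  qed
  moreover have "weights L2 ?Q \<sigma>'"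
  proof -
    have "wsum \<sigma>'"
      by (rule wsum_set_weight[OF _ t(1) S _ eq(2,3)]) (use we eq in \<open>auto simp: weights_def\<close>)
    moreover have "\<forall>s<m. rmem \<sigma>' 2 s \<le> c s"
    proof (intro allI impI)
      fix s assume "s < m"
      then have "rmem \<sigma> 2 s \<le> c s" using we by (auto simp: weights_def)
      then show "rmem \<sigma>' 2 s \<le> c s" using vle by (auto simp: eq)
    qed
    moreover have "\<forall>u<nmem \<sigma>' 14 0. 0 \<le> rmem \<sigma>' 3 u" using we v0 by (auto simp: weights_def eq)
    moreover have "\<forall>i. \<forall>u\<in>set (L2 i). rmem \<sigma>' 3 u \<le> p i \<and> (nmem \<sigma>' 6 u \<noteq> 0 \<and> nmem \<sigma>' 7 u \<noteq> 0 \<longrightarrow> rmem \<sigma>' 3 u = p i)"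
    proof (intro allI ballI)
      fix i u assume "u \<in> set (L2 i)"
      then have "u \<in> set (L i)" "u \<noteq> t" using sub by blast+
      then show "rmem \<sigma>' 3 u \<le> p i \<and> (nmem \<sigma>' 6 u \<noteq> 0 \<and> nmem \<sigma>' 7 u \<noteq> 0 \<longrightarrow> rmem \<sigma>' 3 u = p i)"
        using we by (auto simp: weights_def eq)
    qed
    moreover have "\<forall>u<nmem \<sigma>' 14 0. u \<notin> ?Q \<longrightarrow> (\<forall>i. u \<notin> set (L2 i)) \<longrightarrow> rmem \<sigma>' 3 u = 0"
    proof (intro allI impI)
      fix u assume u: "u < nmem \<sigma>' 14 0" "u \<notin> ?Q" "\<forall>i. u \<notin> set (L2 i)"
      show "rmem \<sigma>' 3 u = 0"
      proof (cases "u = t")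
        case True
        then show ?thesis using u(2) v by (auto simp: eq split: if_splits)
      next
        case False
        then have "u \<notin> Q" "\<forall>i. u \<notin> set (L i)" using u mem[of u] by (auto split: if_splits)
        then show ?thesis using False we u(1) by (auto simp: weights_def eq)
      qed
    qed
    ultimately show ?thesis unfolding weights_def by blast
  qed
  moreover have "sets kk L2 \<sigma>'"
    unfolding sets_def S
  proof (intro conjI allI impI ballI, goal_cases)
    case (1 s)
    then show ?case using se by (auto simp: sets_def eq split: if_splits)
  next
    case (2 s)
    then show ?case using se by (auto simp: sets_def eq split: if_splits)
  next
    case (3 s)
    then have "s \<notin> SS \<sigma> t" "nmem \<sigma> 2 s \<noteq> 0" by (auto simp: eq split: if_splits)
    then show ?case using se by (auto simp: sets_def eq tight_def)
  next
    case (4 s)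
    then show ?case using se by (auto simp: sets_def eq)
  next
    case (5 i u s)
    then have "nmem \<sigma> 3 s \<le> i" using se sub[of u i] unfolding sets_def by blast
    then show ?case by (auto simp: eq)
  next
    case (6 i u)
    then have u: "u \<in> set (L i)" "nmem \<sigma> 6 u \<noteq> 0" using sub[of u i] by (auto simp: eq)
    then obtain s where s: "s \<in> SS \<sigma> u" "nmem \<sigma> 2 s \<noteq> 0" "nmem \<sigma> 3 s = i"
      using se 6(1) unfolding sets_def by meson
    moreover have "s \<notin> SS \<sigma> t"
    proof
      assume "s \<in> SS \<sigma> t"
      then have "nmem \<sigma> 3 s \<le> j" using se tj unfolding sets_def by blast
      then show False using s(3) 6(1) jk by simp
    qed
    ultimately show ?case by (intro bexI[of _ s]) (auto simp: eq)
  qed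
  moreover have "prm \<sigma>'" "sys \<sigma>'"
    using pr sy unfolding prm_def sys_def S eq by auto
  ultimately show ?thesis unfolding mid_def L2_def by blast
qed

lemma wp_NSet_const: "3 \<le> k \<Longrightarrow> wp P Q (nset a 0 v \<sigma>) (k - 3) \<Longrightarrow> wp (Seq (NSet a (NConst v)) P) Q \<sigma> k"
  by (simp add: numeral_2_eq_2[symmetric])

lemma nwr_collect [simp]:
  "nwr collect = {2, 3, 9, 11, 12, 13, 16, 18, 19, 20}" "rwr collect = {2, 3, 5}"
  by (auto simp: collect_def)

text \<open>A reset may uncover elements that still wait on a low level, so inside the loop the
  covering clause is kept only from level \<open>kk\<close> on; once the low lists are empty, it
  holds for all levels. Afterwards every set of a queued element has level 0, so settling can assign
  levels afresh.\<close>

lemma wp_collect: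
  assumes mid: "mid 0 L {} \<sigma>" and co: "\<forall>i. count L \<sigma> i"
    and kk: "nmem \<sigma> 21 0 = kk" and pw: "rmem \<sigma> 4 kk = p kk"
    and k: "300 * (f * (\<Sum>i<kk. length (L i))) + 50 * (kk + 1) \<le> k"
  shows "wp collect (\<lambda>\<sigma>' k'. k \<le> k' + 300 * (f * (\<Sum>i<kk. length (L i))) + 50 * (kk + 1) \<and>
      (\<exists>qs. mid 0 (\<lambda>i. if i < kk then [] else L i) (set qs) \<sigma>' \<and>
        chain (nmem \<sigma>' 9) (nmem \<sigma>' 16 0) qs \<and> distinct qs \<and>
        set qs = {t. t < nmem \<sigma> 14 0 \<and> nmem \<sigma> 6 t \<noteq> 0 \<and> nmem \<sigma> 8 t < kk} \<and>
        (\<forall>t\<in>set qs. rmem \<sigma>' 3 t = (if nmem \<sigma> 7 t = 0 then 0 else p kk) \<and> (\<forall>s\<in>SS \<sigma> t. nmem \<sigma>' 3 s = 0))) \<and>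
      (\<forall>i. count (\<lambda>i. if i < kk then [] else L i) \<sigma>' i) \<and>
      (\<forall>i. nmem \<sigma>' 13 i = (if i < kk then 0 else nmem \<sigma> 13 i))) \<sigma> k"
proof -
  define K0 where "K0 = k - (300 * (f * (\<Sum>i<kk. length (L i))) + 50 * (kk + 1))"
  have kK: "K0 + (300 * (f * (\<Sum>i<kk. length (L i))) + 50 * (kk + 1)) = k" using k by (simp add: K0_def)
  \<comment> \<open>Nothing is said about the counters of the levels from register 20 up to
    \<open>kk\<close>: they lag behind the lists and are cleared only when a list is empty.\<close>
  define I where "I \<sigma>' k' \<longleftrightarrow> (\<exists>L' qs. nmem \<sigma>' 20 0 \<le> kk \<and> mid kk L' (set qs) \<sigma>' \<and>
      chain (nmem \<sigma>' 9) (nmem \<sigma>' 16 0) qs \<and> distinct qs \<and>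
      (\<forall>t\<in>set qs. nmem \<sigma> 8 t < kk \<and> rmem \<sigma>' 3 t = (if nmem \<sigma> 7 t = 0 then 0 else p kk) \<and> (\<forall>s\<in>SS \<sigma> t. nmem \<sigma>' 3 s = 0)) \<and>
      (\<forall>i<nmem \<sigma>' 20 0. L' i = [] \<and> nmem \<sigma>' 12 i = 0 \<and> nmem \<sigma>' 13 i = 0) \<and>
      (\<forall>i\<ge>kk. L' i = L i \<and> nmem \<sigma>' 12 i = nmem \<sigma> 12 i \<and> nmem \<sigma>' 13 i = nmem \<sigma> 13 i) \<and>
      K0 + 300 * (f * (\<Sum>i<kk. length (L' i))) + 50 * (kk - nmem \<sigma>' 20 0) + 20 \<le> k')" for \<sigma>' k'
  let ?B = "Cond (NEq (NRead 11 (NV 20)) (NConst 0))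
         (Seq (NWrite 12 (NV 20) (NConst 0)) (Seq (NWrite 13 (NV 20) (NConst 0))
           (NSet 20 (NAdd (NV 20) (NConst 1)))))
         (Seq (NSet 18 (NSub (NRead 11 (NV 20)) (NConst 1)))
           (Seq (NWrite 11 (NV 20) (NRead 9 (NV 18)))
             (Seq (Cond (BAnd (BNot (NEq (NRead 6 (NV 18)) (NConst 0))) (BNot (NEq (NRead 7 (NV 18)) (NConst 0))))
                    (RWrite 5 (NConst 0) (RRead 4 (NV 21))) (RWrite 5 (NConst 0) (ROfNat (NConst 0))))
               (Seq set_weight
                 (Seq reset_sets
                   (Cond (NEq (NRead 6 (NV 18)) (NConst 0)) Skip
                     (Seq (NWrite 9 (NV 18) (NV 16)) (NSet 16 (NAdd (NV 18) (NConst 1))))))))))"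
  let ?L = "\<lambda>i. if i < kk then [] else L i"
  let ?Q = "\<lambda>\<sigma>' k'. k \<le> k' + 300 * (f * (\<Sum>i<kk. length (L i))) + 50 * (kk + 1) \<and>
      (\<exists>qs. mid 0 ?L (set qs) \<sigma>' \<and>
        chain (nmem \<sigma>' 9) (nmem \<sigma>' 16 0) qs \<and> distinct qs \<and>
        set qs = {t. t < nmem \<sigma> 14 0 \<and> nmem \<sigma> 6 t \<noteq> 0 \<and> nmem \<sigma> 8 t < kk} \<and>
        (\<forall>t\<in>set qs. rmem \<sigma>' 3 t = (if nmem \<sigma> 7 t = 0 then 0 else p kk) \<and> (\<forall>s\<in>SS \<sigma> t. nmem \<sigma>' 3 s = 0))) \<and>
      (\<forall>i. count ?L \<sigma>' i) \<and>
      (\<forall>i. nmem \<sigma>' 13 i = (if i < kk then 0 else nmem \<sigma> 13 i))"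
  let ?\<sigma>0 = "nset 16 0 0 (nset 20 0 0 \<sigma>)"
  have "wp (While (NLess (NV 20) (NV 21)) ?B) ?Q ?\<sigma>0 (k - 6)"
  proof (rule wp_While[where I = I], goal_cases)
    case 1
    have "mid 0 L {} ?\<sigma>0" by (rule mid_cong[OF mid]) simp_all
    then have "mid kk L {} ?\<sigma>0" by (auto simp: mid_def sets_def)
    with kK show ?case
      unfolding I_def by (intro exI[of _ L] exI[of _ "[]"]) auto
  next
    case (2 \<sigma>1 k1)
    then obtain L1 qs where j1: "nmem \<sigma>1 20 0 \<le> kk" and mid1: "mid kk L1 (set qs) \<sigma>1" and
      c1: "chain (nmem \<sigma>1 9) (nmem \<sigma>1 16 0) qs" "distinct qs" and
      Q1: "\<forall>t\<in>set qs. nmem \<sigma> 8 t < kk \<and> rmem \<sigma>1 3 t = (if nmem \<sigma> 7 t = 0 then 0 else p kk) \<and> (\<forall>s\<in>SS \<sigma> t. nmem \<sigma>1 3 s = 0)" and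
      lo: "\<forall>i<nmem \<sigma>1 20 0. L1 i = [] \<and> nmem \<sigma>1 12 i = 0 \<and> nmem \<sigma>1 13 i = 0" and
      hi: "\<forall>i\<ge>kk. L1 i = L i \<and> nmem \<sigma>1 12 i = nmem \<sigma> 12 i \<and> nmem \<sigma>1 13 i = nmem \<sigma> 13 i" and
      k1: "K0 + 300 * (f * (\<Sum>i<kk. length (L1 i))) + 50 * (kk - nmem \<sigma>1 20 0) + 20 \<le> k1"
      unfolding I_def by blast
    define j where "j = nmem \<sigma>1 20 0"
    have fr1: "a \<notin> {2, 3, 9, 11, 12, 13, 16, 18, 19, 20} \<Longrightarrow> nmem \<sigma>1 a = nmem \<sigma> a"
      "a \<notin> {2, 3, 5} \<Longrightarrow> rmem \<sigma>1 a = rmem \<sigma> a" for a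
      using 2(1) by (auto simp: frame_def)
    have S1: "SS \<sigma>1 = SS \<sigma>" using fr1 by (simp add: SS_def fun_eq_iff)
    have jk: "j < kk" using 2(3) fr1(1)[of 21] kk by (simp add: j_def)
    have li1: "lists L1 (set qs) \<sigma>1" and sy1: "sys \<sigma>1" and pr1: "prm \<sigma>1" and we1: "weights L1 (set qs) \<sigma>1"
      using mid1 by (auto simp: mid_def)
    have chj: "chain (nmem \<sigma>1 9) (nmem \<sigma>1 11 j) (L1 j)" using li1 by (auto simp: lists_def)
    show ?case
    proof (cases "nmem \<sigma>1 11 j = 0")
      case True
      then have Lj: "L1 j = []" using chj by (cases "L1 j") auto
      let ?\<sigma>2 = "nset 20 0 (Suc j) (nset 13 j 0 (nset 12 j 0 \<sigma>1))"
      have m2: "mid kk L1 (set qs) ?\<sigma>2" by (rule mid_cong[OF mid1]) simp_all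
      have lo2: "\<forall>i<Suc j. L1 i = [] \<and> nmem ?\<sigma>2 12 i = 0 \<and> nmem ?\<sigma>2 13 i = 0"
        using lo Lj by (auto simp: j_def less_Suc_eq)
      have hi2: "\<forall>i\<ge>kk. L1 i = L i \<and> nmem ?\<sigma>2 12 i = nmem \<sigma> 12 i \<and> nmem ?\<sigma>2 13 i = nmem \<sigma> 13 i"
        using hi jk by auto
      have k2: "K0 + 300 * (f * (\<Sum>i<kk. length (L1 i))) + 50 * (kk - Suc j) + 20 \<le> k1 - 26 \<and> 60 \<le> k1"
      proof -
        have "kk - j = Suc (kk - Suc j)" using jk by simp
        then show ?thesis using k1 unfolding j_def[symmetric] by simp
      qed
      have "I ?\<sigma>2 (k1 - 26)"
        unfolding I_def using m2 c1 Q1 lo2 hi2 k2 jk by (intro exI[of _ L1] exI[of _ qs]) auto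
      then show ?thesis
        using True k2 by (auto simp: numeral_2_eq_2[symmetric] j_def)
    next
      case False
      define t where "t = nmem \<sigma>1 11 j - Suc 0"
      obtain ts where ts: "L1 j = t # ts"
        using chain_Suc[OF chj] False by (auto simp: t_def)
      have tj: "t \<in> set (L1 j)" using ts by simp
      then have t: "t < nmem \<sigma>1 14 0" "nmem \<sigma>1 8 t = j" using li1 by (auto simp: lists_def)
      have tq: "t \<notin> set qs" using li1 tj by (auto simp: lists_def)
      have f: "1 \<le> f" using sysD(5)[OF sy1 t(1)] .
      define R where "R = f * (\<Sum>i<kk. length ((L1(j := ts)) i))"
      have sumL: "(\<Sum>i<kk. length (L1 i)) = Suc (\<Sum>i<kk. length ((L1(j := ts)) i))"
      proof -
        have "(\<Sum>i<kk. length (L1 i)) = length (L1 j) + (\<Sum>i\<in>{..<kk} - {j}. length (L1 i))"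
          by (rule sum.remove) (use jk in auto)
        moreover have "(\<Sum>i<kk. length ((L1(j := ts)) i)) = length ts + (\<Sum>i\<in>{..<kk} - {j}. length ((L1(j := ts)) i))"
          using jk sum.remove[of "{..<kk}" j "\<lambda>i. length ((L1(j := ts)) i)"] by simp
        moreover have "(\<Sum>i\<in>{..<kk} - {j}. length ((L1(j := ts)) i)) = (\<Sum>i\<in>{..<kk} - {j}. length (L1 i))"
          by (rule sum.cong) auto
        ultimately show ?thesis using ts by simp
      qed
      have k2: "K0 + 300 * R + 50 * (kk - j) + 20 + 300 * f \<le> k1"
        using k1 unfolding sumL R_def j_def[symmetric] by (simp add: algebra_simps)
      define v where "v = (if nmem \<sigma>1 6 t \<noteq> 0 \<and> nmem \<sigma>1 7 t \<noteq> 0 then p kk else 0)"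
      let ?\<sigma>2 = "rset 5 0 v (nset 11 j (nmem \<sigma>1 9 t) (nset 18 0 t \<sigma>1))"
      have s2: "sys ?\<sigma>2" using sy1 by (simp add: sys_def)
      have c2: "80 * f \<le> k1 - 50" using k2 f by linarith
      let ?C = "Cond (NEq (NRead 6 (NV 18)) (NConst 0)) Skip
                     (Seq (NWrite 9 (NV 18) (NV 16)) (NSet 16 (NAdd (NV 18) (NConst 1))))"
      have "wp set_weight (wp reset_sets (wp ?C I)) ?\<sigma>2 k2" if kb: "k1 - 50 \<le> k2" for k2
      proof (rule wp_mono_frame[OF wp_set_weight[OF s2, of t]], goal_cases)
        case 1 show ?case by simp
      next
        case 2 show ?case using t by simp
      next
        case 3 show ?case using c2 kb by linarith
      next
        case (4 \<sigma>3 k3)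
        have fr3: "a \<notin> {11, 18, 19} \<Longrightarrow> nmem \<sigma>3 a = nmem \<sigma>1 a" "nmem \<sigma>3 11 = (nmem \<sigma>1 11)(j := nmem \<sigma>1 9 t)"
          "nmem \<sigma>3 18 0 = t" "a \<notin> {2, 3, 5} \<Longrightarrow> rmem \<sigma>3 a = rmem \<sigma>1 a" for a
          using 4(1) by (auto simp: frame_def)
        have w3: "rmem \<sigma>3 2 = (\<lambda>s. rmem \<sigma>1 2 s + (if s \<in> SS \<sigma>1 t then v - rmem \<sigma>1 3 t else 0))"
          "rmem \<sigma>3 3 = (rmem \<sigma>1 3)(t := v)" "k2 \<le> k3 + 80 * f"
          using 4(3) by (auto simp: fun_eq_iff)
        have s3: "sys \<sigma>3" "SS \<sigma>3 = SS \<sigma>1" using sy1 fr3(1) SS_cong[of \<sigma>3 \<sigma>1] sys_cong[of \<sigma>3 \<sigma>1] by simp_all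
        show ?case
        proof (rule wp_mono_frame[OF wp_reset_sets[OF s3(1) fr3(3)]], goal_cases)
          case 1 show ?case using t fr3 by simp
        next
          case 2 show ?case using w3(3) kb k2 f by linarith
        next
          case (3 \<sigma>4 k4)
          have fr4: "a \<notin> {2, 3, 11, 18, 19} \<Longrightarrow> nmem \<sigma>4 a = nmem \<sigma>1 a" "nmem \<sigma>4 11 = (nmem \<sigma>1 11)(j := nmem \<sigma>1 9 t)"
            "nmem \<sigma>4 18 0 = t" "a \<notin> {2, 3, 5} \<Longrightarrow> rmem \<sigma>4 a = rmem \<sigma>1 a" "rmem \<sigma>4 2 = rmem \<sigma>3 2" "rmem \<sigma>4 3 = rmem \<sigma>3 3" for a
            using 3(1) fr3 by (auto simp: frame_def)
          have r4: "nmem \<sigma>4 2 = (\<lambda>s. if s \<in> SS \<sigma>1 t then 0 else nmem \<sigma>1 2 s)"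
            "nmem \<sigma>4 3 = (\<lambda>s. if s \<in> SS \<sigma>1 t then 0 else nmem \<sigma>1 3 s)" "k3 \<le> k4 + 80 * f"
            using 3(3) fr3 s3 by (auto simp: fun_eq_iff)
          have k4: "K0 + 300 * R + 50 * (kk - j) + 20 + 20 \<le> k4" using k2 kb w3(3) r4(3) f by linarith
          have fin: "I \<sigma>5 k5" if n9: "\<And>u. u \<noteq> t \<Longrightarrow> nmem \<sigma>5 9 u = nmem \<sigma>1 9 u"
            and live: "nmem \<sigma>1 6 t \<noteq> 0 \<Longrightarrow> nmem \<sigma>5 9 t = nmem \<sigma>1 16 0 \<and> nmem \<sigma>5 16 0 = Suc t"
            and dead: "nmem \<sigma>1 6 t = 0 \<Longrightarrow> nmem \<sigma>5 16 0 = nmem \<sigma>1 16 0"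
            and o: "\<And>a. a \<notin> {9, 16} \<Longrightarrow> nmem \<sigma>5 a = nmem \<sigma>4 a" "rmem \<sigma>5 = rmem \<sigma>4" and k5: "k4 \<le> k5 + 20" for \<sigma>5 k5
          proof -
            let ?qs = "if nmem \<sigma>1 6 t \<noteq> 0 then t # qs else qs"
            have "mid kk (L1(j := ts)) (if nmem \<sigma>1 6 t \<noteq> 0 then insert t (set qs) else set qs) \<sigma>5"
              by (rule mid_collect[OF mid1 ts jk v_def n9]) (use o fr4 r4 w3 in auto)
            then have "mid kk (L1(j := ts)) (set ?qs) \<sigma>5" by (auto split: if_splits)
            moreover have ch5: "chain (nmem \<sigma>5 9) h qs = chain (nmem \<sigma>1 9) h qs" for h
              by (rule chain_cong) (metis n9 tq)
            have "chain (nmem \<sigma>5 9) (nmem \<sigma>5 16 0) ?qs"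
              using live dead c1 ch5 by auto
            moreover have "distinct ?qs" using c1 tq by auto
            moreover have "\<forall>u\<in>set ?qs. nmem \<sigma> 8 u < kk \<and> rmem \<sigma>5 3 u = (if nmem \<sigma> 7 u = 0 then 0 else p kk) \<and> (\<forall>s\<in>SS \<sigma> u. nmem \<sigma>5 3 s = 0)"
            proof
              fix u assume u: "u \<in> set ?qs"
              show "nmem \<sigma> 8 u < kk \<and> rmem \<sigma>5 3 u = (if nmem \<sigma> 7 u = 0 then 0 else p kk) \<and> (\<forall>s\<in>SS \<sigma> u. nmem \<sigma>5 3 s = 0)"
              proof (cases "u = t")
                case True
                then have "nmem \<sigma>1 6 t \<noteq> 0" using u tq by (auto split: if_splits)
                then show ?thesis
                  using True t jk o fr4 w3 r4 S1 fr1(1)[of 8] fr1(1)[of 7] by (auto simp: v_def)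
              next
                case False
                then have "u \<in> set qs" using u by (auto split: if_splits)
                then show ?thesis using False Q1 o fr4 w3 r4 by auto
              qed
            qed
            moreover have j5: "nmem \<sigma>5 20 0 = j" using o fr4 by (simp add: j_def)
            moreover have "\<forall>i<j. (L1(j := ts)) i = [] \<and> nmem \<sigma>5 12 i = 0 \<and> nmem \<sigma>5 13 i = 0"
              using lo o fr4 unfolding j_def by auto
            moreover have "\<forall>i\<ge>kk. (L1(j := ts)) i = L i \<and> nmem \<sigma>5 12 i = nmem \<sigma> 12 i \<and> nmem \<sigma>5 13 i = nmem \<sigma> 13 i"
              using hi jk o fr4 by auto
            moreover have "K0 + 300 * (f * (\<Sum>i<kk. length ((L1(j := ts)) i))) + 50 * (kk - j) + 20 \<le> k5"
              using k4 k5 unfolding R_def by linarith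
            ultimately show ?thesis
              unfolding I_def j5 using less_imp_le[OF jk]
              by (intro exI[of _ "L1(j := ts)"] exI[of _ ?qs] conjI)
          qed
          show ?case
          proof (cases "nmem \<sigma>1 6 t = 0")
            case True
            then show ?thesis using fin[of \<sigma>4 "k4 - 7"] fr4 k4 by (auto simp: numeral_2_eq_2[symmetric])
          next
            case F: False
            then show ?thesis
              using fin[of "nset 16 0 (Suc t) (nset 9 t (nmem \<sigma>1 16 0) \<sigma>4)" "k4 - 17"] fr4 k4
              by (auto simp: numeral_2_eq_2[symmetric])
          qed
        qed
      qed
      moreover have "50 \<le> k1" using k2 f by linarith
      ultimately show ?thesis
        using False fr1(1)[of 21] fr1(2)[of 4] kk pw
        by (auto simp: numeral_2_eq_2[symmetric] j_def[symmetric] t_def[symmetric] v_def)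
    qed
  next
    case (3 \<sigma>1 k1)
    then obtain L1 qs where j1: "nmem \<sigma>1 20 0 \<le> kk" and mid1: "mid kk L1 (set qs) \<sigma>1" and
      c1: "chain (nmem \<sigma>1 9) (nmem \<sigma>1 16 0) qs" "distinct qs" and
      Q1: "\<forall>t\<in>set qs. nmem \<sigma> 8 t < kk \<and> rmem \<sigma>1 3 t = (if nmem \<sigma> 7 t = 0 then 0 else p kk) \<and> (\<forall>s\<in>SS \<sigma> t. nmem \<sigma>1 3 s = 0)" and
      lo: "\<forall>i<nmem \<sigma>1 20 0. L1 i = [] \<and> nmem \<sigma>1 12 i = 0 \<and> nmem \<sigma>1 13 i = 0" and
      hi: "\<forall>i\<ge>kk. L1 i = L i \<and> nmem \<sigma>1 12 i = nmem \<sigma> 12 i \<and> nmem \<sigma>1 13 i = nmem \<sigma> 13 i" and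
      k1: "K0 + 300 * (f * (\<Sum>i<kk. length (L1 i))) + 50 * (kk - nmem \<sigma>1 20 0) + 20 \<le> k1"
      unfolding I_def by blast
    have fr1: "a \<notin> {2, 3, 9, 11, 12, 13, 16, 18, 19, 20} \<Longrightarrow> nmem \<sigma>1 a = nmem \<sigma> a" for a
      using 3(1) by (auto simp: frame_def)
    have j: "nmem \<sigma>1 20 0 = kk" using 3(3) fr1[of 21] kk j1 by simp
    have L1: "L1 = ?L" using lo hi j by (auto simp: fun_eq_iff)
    have m0: "mid 0 ?L (set qs) \<sigma>1" using mid1 unfolding L1 mid_def sets_def by auto
    have "set qs = {t. t < nmem \<sigma> 14 0 \<and> nmem \<sigma> 6 t \<noteq> 0 \<and> nmem \<sigma> 8 t < kk}"
    proof -
      have li: "lists L1 (set qs) \<sigma>1" using mid1 by (simp add: mid_def)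
      have "t \<in> set qs" if "t < nmem \<sigma> 14 0" "nmem \<sigma> 6 t \<noteq> 0" "nmem \<sigma> 8 t < kk" for t
      proof -
        have "t \<in> set qs \<or> t \<in> set (L1 (nmem \<sigma>1 8 t))"
          using li that fr1[of 14] fr1[of 6] unfolding lists_def by simp
        then show ?thesis using that fr1[of 8] lo j by auto
      qed
      moreover have "t < nmem \<sigma> 14 0 \<and> nmem \<sigma> 6 t \<noteq> 0 \<and> nmem \<sigma> 8 t < kk" if "t \<in> set qs" for t
        using Q1 li that fr1[of 14] fr1[of 6] by (auto simp: lists_def)
      ultimately show ?thesis by blast
    qed
    moreover have "count ?L \<sigma>1 i" for i
    proof -
      have "count L \<sigma> i" using co by simp
      then show ?thesis using lo hi j fr1[of 6] fr1[of 7] by (cases "i < kk") (auto simp: count_def)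
    qed
    moreover have "nmem \<sigma>1 13 i = (if i < kk then 0 else nmem \<sigma> 13 i)" for i
      using lo hi j by auto
    moreover have k1': "K0 + 20 \<le> k1" by (rule le_trans[OF _ k1]) simp
    then have "k \<le> k1 - 6 + 300 * (f * (\<Sum>i<kk. length (L i))) + 50 * (kk + 1)"
      using kK by linarith
    moreover have "\<forall>t\<in>set qs. rmem \<sigma>1 3 t = (if nmem \<sigma> 7 t = 0 then 0 else p kk) \<and> (\<forall>s\<in>SS \<sigma> t. nmem \<sigma>1 3 s = 0)"
      using Q1 by blast
    ultimately have Q: "?Q \<sigma>1 (k1 - 6)"
      using m0 c1 by (intro conjI exI[of _ qs] allI)
    have e: "1 + bcost (NLess (NV 20) (NV 21)) = 6" by simp
    have "6 \<le> k1" using k1' by simp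
    from conjI[OF this Q] show ?case unfolding e .
  qed
  then have "wp (While (NLess (NV 20) (NV 21)) ?B) ?Q ?\<sigma>0 (k - 3 - 3)"
    by (simp only: diff_diff_left) simp
  moreover have "50 \<le> k" by (rule le_trans[OF _ k]) simp
  then have "3 \<le> k" "3 \<le> k - 3" by linarith+
  ultimately show ?thesis
    unfolding collect_def by (intro wp_NSet_const)
qed

section \<open>The invariant between updates and its potential\<close>

text \<open>Prefix sums over the levels below \<open>i\<close>: \<open>PA\<close> for live active
  elements, \<open>PD\<close> for deleted ones.\<close>

definition PA :: "mem \<Rightarrow> nat \<Rightarrow> nat" where "PA \<sigma> i = (\<Sum>l<i. nmem \<sigma> 12 l)"
definition PD :: "mem \<Rightarrow> nat \<Rightarrow> nat" where "PD \<sigma> i = (\<Sum>l<i. nmem \<sigma> 13 l)"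

section \<open>Search for the longest bad prefix of levels\<close>

lemma nwr_scan [simp]: "nwr scan = {20, 21, 24, 25}" "rwr scan = {}"
  by (auto simp: scan_def)

lemma wp_scan:
  assumes eps: "rmem \<sigma> 0 0 = 4 * x" and k: "100 * (nmem \<sigma> 15 0 + 2) \<le> k"
  shows "wp scan (\<lambda>\<sigma>' k'. k \<le> k' + 100 * (nmem \<sigma> 15 0 + 2) \<and> nmem \<sigma>' 21 0 \<le> Suc (nmem \<sigma> 15 0) \<and>
      (\<forall>i. nmem \<sigma>' 21 0 < i \<and> i \<le> Suc (nmem \<sigma> 15 0) \<longrightarrow> real (PD \<sigma> i) \<le> x * real (PA \<sigma> i)) \<and>
      (0 < nmem \<sigma>' 21 0 \<longrightarrow> x * real (PA \<sigma> (nmem \<sigma>' 21 0)) < real (PD \<sigma> (nmem \<sigma>' 21 0)))) \<sigma> k"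
proof -
  define T where "T = nmem \<sigma> 15 0"
  define K0 where "K0 = k - 100 * (T + 2)"
  have kK: "K0 + 100 * (T + 2) = k" using k by (simp add: K0_def T_def)
  define I where "I \<sigma>' k' \<longleftrightarrow> nmem \<sigma>' 20 0 \<le> Suc T \<and> nmem \<sigma>' 24 0 = PA \<sigma> (nmem \<sigma>' 20 0) \<and>
     nmem \<sigma>' 25 0 = PD \<sigma> (nmem \<sigma>' 20 0) \<and> nmem \<sigma>' 21 0 \<le> nmem \<sigma>' 20 0 \<and>
     (\<forall>i. nmem \<sigma>' 21 0 < i \<and> i \<le> nmem \<sigma>' 20 0 \<longrightarrow> real (PD \<sigma> i) \<le> x * real (PA \<sigma> i)) \<and>
     (0 < nmem \<sigma>' 21 0 \<longrightarrow> x * real (PA \<sigma> (nmem \<sigma>' 21 0)) < real (PD \<sigma> (nmem \<sigma>' 21 0))) \<and>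
     K0 + 100 * (Suc T - nmem \<sigma>' 20 0) + 20 \<le> k'" for \<sigma>' :: mem and k'
  let ?B = "Seq (NSet 24 (NAdd (NV 24) (NRead 12 (NV 20))))
           (Seq (NSet 25 (NAdd (NV 25) (NRead 13 (NV 20))))
             (Seq (NSet 20 (NAdd (NV 20) (NConst 1)))
               (Cond (RLess (RMul eps1 (ROfNat (NV 24))) (ROfNat (NV 25)))
                 (NSet 21 (NV 20)) Skip)))"
  let ?Q = "\<lambda>\<sigma>' k'. k \<le> k' + 100 * (nmem \<sigma> 15 0 + 2) \<and> nmem \<sigma>' 21 0 \<le> Suc (nmem \<sigma> 15 0) \<and>
      (\<forall>i. nmem \<sigma>' 21 0 < i \<and> i \<le> Suc (nmem \<sigma> 15 0) \<longrightarrow> real (PD \<sigma> i) \<le> x * real (PA \<sigma> i)) \<and>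
      (0 < nmem \<sigma>' 21 0 \<longrightarrow> x * real (PA \<sigma> (nmem \<sigma>' 21 0)) < real (PD \<sigma> (nmem \<sigma>' 21 0)))"
  let ?\<sigma>0 = "nset 21 0 0 (nset 25 0 0 (nset 24 0 0 (nset 20 0 0 \<sigma>)))"
  \<comment> \<open>The four initializations cost 3 each; the differences stay nested so that
    \<open>wp_NSet_const\<close> can be applied four times.\<close>
  have "wp (While (NLess (NV 20) (NAdd (NV 15) (NConst 1))) ?B) ?Q ?\<sigma>0 (k - 3 - 3 - 3 - 3)"
  proof (rule wp_While[where I = I], goal_cases)
    case 1
    show ?case using kK by (simp add: I_def PA_def PD_def)
  next
    case (2 \<sigma>1 k1)
    have fr: "a \<notin> {20, 21, 24, 25} \<Longrightarrow> nmem \<sigma>1 a = nmem \<sigma> a" "rmem \<sigma>1 = rmem \<sigma>" for a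
      using 2(1) by (auto simp: frame_def)
    define j where "j = nmem \<sigma>1 20 0"
    have jT: "j < Suc T" using 2(3) fr(1)[of 15] by (simp add: j_def T_def)
    have k1: "K0 + 100 * (Suc T - Suc j) + 20 + 100 \<le> k1"
    proof -
      have "Suc T - j = Suc (Suc T - Suc j)" using jT by simp
      then show ?thesis using 2(2) unfolding I_def j_def[symmetric] by simp
    qed
    have P: "PA \<sigma> (Suc j) = PA \<sigma> j + nmem \<sigma> 12 j" "PD \<sigma> (Suc j) = PD \<sigma> j + nmem \<sigma> 13 j"
      by (simp_all add: PA_def PD_def)
    have I1: "nmem \<sigma>1 24 0 = PA \<sigma> j" "nmem \<sigma>1 25 0 = PD \<sigma> j" "nmem \<sigma>1 21 0 \<le> j"
      "\<forall>i. nmem \<sigma>1 21 0 < i \<and> i \<le> j \<longrightarrow> real (PD \<sigma> i) \<le> x * real (PA \<sigma> i)"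
      "0 < nmem \<sigma>1 21 0 \<longrightarrow> x * real (PA \<sigma> (nmem \<sigma>1 21 0)) < real (PD \<sigma> (nmem \<sigma>1 21 0))"
      using 2(2) unfolding I_def j_def by auto
    let ?\<sigma>2 = "nset 20 0 (Suc j) (nset 25 0 (PD \<sigma> (Suc j)) (nset 24 0 (PA \<sigma> (Suc j)) \<sigma>1))"
    have a: "I ?\<sigma>2 k2" if "real (PD \<sigma> (Suc j)) \<le> x * real (PA \<sigma> (Suc j))" "k1 \<le> k2 + 100" for k2
      unfolding I_def using I1 k1 jT that by (auto simp: le_Suc_eq)
    have b: "I (nset 21 0 (Suc j) ?\<sigma>2) k2" if "x * real (PA \<sigma> (Suc j)) < real (PD \<sigma> (Suc j))" "k1 \<le> k2 + 100" for k2
      unfolding I_def using I1 k1 jT that by auto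
    show ?case
      using a b k1 I1 fr(1)[of 12] fr(1)[of 13] fr(2) eps P
      by (auto simp: numeral_2_eq_2[symmetric] j_def[symmetric] eps1_def not_less)
  next
    case (3 \<sigma>1 k1)
    have fr: "nmem \<sigma>1 15 = nmem \<sigma> 15"
      using 3(1) by (auto simp: frame_def)
    have "nmem \<sigma>1 20 0 = Suc T" using 3(2,3) fr by (simp add: I_def T_def)
    with 3(2) kK show ?case
      by (auto simp: I_def numeral_2_eq_2[symmetric] T_def)
  qed
  moreover have "100 \<le> k" by (rule le_trans[OF _ k]) simp
  then have "3 \<le> k" "3 \<le> k - 3" "3 \<le> k - 3 - 3" "3 \<le> k - 3 - 3 - 3" by linarith+
  ultimately show ?thesis
    unfolding scan_def by (intro wp_NSet_const)
qed

text \<open>Indices are never reused: an element that is inserted again gets a fresh one, while its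
  old index may still be waiting in a list as deleted. So array 10 is meaningful only for the names
  that are present.\<close>

definition link :: "set_system \<Rightarrow> mem \<Rightarrow> bool" where
  "link X \<sigma> \<longleftrightarrow> finite (fst X) \<and> inj_on (nmem \<sigma> 10) (fst X) \<and>
     (\<forall>e\<in>fst X. nmem \<sigma> 10 e < nmem \<sigma> 14 0 \<and> nmem \<sigma> 6 (nmem \<sigma> 10 e) \<noteq> 0 \<and>
        SS \<sigma> (nmem \<sigma> 10 e) = {s. e \<in> snd X s}) \<and>
     (\<forall>t<nmem \<sigma> 14 0. nmem \<sigma> 6 t \<noteq> 0 \<longrightarrow> t \<in> nmem \<sigma> 10 ` fst X) \<and> (\<forall>s. snd X s \<subseteq> fst X)"

lemma link_card:
  assumes "link X \<sigma>"
  shows "{t. t < nmem \<sigma> 14 0 \<and> nmem \<sigma> 6 t \<noteq> 0} = nmem \<sigma> 10 ` fst X"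
    "card {t. t < nmem \<sigma> 14 0 \<and> nmem \<sigma> 6 t \<noteq> 0} = card (fst X)"
proof -
  show *: "{t. t < nmem \<sigma> 14 0 \<and> nmem \<sigma> 6 t \<noteq> 0} = nmem \<sigma> 10 ` fst X"
    using assms by (auto simp: link_def)
  show "card {t. t < nmem \<sigma> 14 0 \<and> nmem \<sigma> 6 t \<noteq> 0} = card (fst X)"
    unfolding * using assms by (auto simp: link_def card_image)
qed

definition balanced :: "mem \<Rightarrow> bool" where
  "balanced \<sigma> \<longleftrightarrow> (\<forall>i. real (PD \<sigma> i) \<le> x * real (PA \<sigma> i))"

text \<open>Entry 0 is left out because the initial memory holds 0 there; every run of the program
  starts by writing it.\<close>

definition pw_upto :: "nat \<Rightarrow> mem \<Rightarrow> bool" where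
  "pw_upto T \<sigma> \<longleftrightarrow> (\<forall>j. 0 < j \<and> j \<le> T \<longrightarrow> rmem \<sigma> 4 j = p j)"

definition inv :: "set_system \<Rightarrow> mem \<Rightarrow> bool" where
  "inv X \<sigma> \<longleftrightarrow> (\<exists>L. ready 0 L {} \<sigma>) \<and> pw_upto (nmem \<sigma> 15 0) \<sigma> \<and> balanced \<sigma> \<and> link X \<sigma>"

text \<open>Unit of the potential. Collecting and filling together take at most
  \<open>600 * f\<close> per element, and each round of settling at most
  \<open>500 * f\<close>.\<close>

definition u :: nat where "u = 1000 * f"

definition passive_potential :: "mem \<Rightarrow> nat \<Rightarrow> nat" where
  "passive_potential \<sigma> t = u * (3 * (B + 1 - nmem \<sigma> 8 t) + B + 5)"

text \<open>
  A passive element pays for every level it rises, and once for becoming active; a dead element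
  pays for its own removal and for the at most \<open>M\<close> active elements that are rebuilt with it.
\<close>

definition potential :: "mem \<Rightarrow> nat" where
  "potential \<sigma> = (\<Sum>t | t < nmem \<sigma> 14 0 \<and> nmem \<sigma> 6 t \<noteq> 0 \<and> nmem \<sigma> 7 t = 0. passive_potential \<sigma> t) +
     u * (M + 1) * (B + 5) * PD \<sigma> (Suc (nmem \<sigma> 15 0))"

text \<open>A deletion raises the potential by at most one such product and an insertion by at most
  \<open>4 * (u * (B + 5))\<close>; the factor 10 leaves room for the direct work, including the
  scan of the levels.\<close>

definition update_cost :: nat where "update_cost = 10 * (u * (M + 1) * (B + 5))"

section \<open>Counting elements by prefixes of levels\<close>

lemma lists_sum_card:
  assumes li: "lists L Q \<sigma>"
  shows "(\<Sum>l<i. card {t \<in> set (L l). P t}) = card {t. \<exists>l<i. t \<in> set (L l) \<and> P t}"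
proof -
  have "card (\<Union>l\<in>{..<i}. {t \<in> set (L l). P t}) = (\<Sum>l\<in>{..<i}. card {t \<in> set (L l). P t})"
  proof (rule card_UN_disjoint)
    show "\<forall>a\<in>{..<i}. \<forall>b\<in>{..<i}. a \<noteq> b \<longrightarrow> {t \<in> set (L a). P t} \<inter> {t \<in> set (L b). P t} = {}"
    proof (intro ballI impI)
      fix a b :: nat assume ab: "a \<noteq> b"
      have e: "nmem \<sigma> 8 t = l" if "t \<in> set (L l)" for t l using li that by (simp add: lists_def)
      show "{t \<in> set (L a). P t} \<inter> {t \<in> set (L b). P t} = {}"
        using e[of _ a] e[of _ b] ab by fastforce
    qed
  qed auto
  moreover have "(\<Union>l\<in>{..<i}. {t \<in> set (L l). P t}) = {t. \<exists>l<i. t \<in> set (L l) \<and> P t}" by auto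
  ultimately show ?thesis by simp
qed

lemma lists_live:
  assumes li: "lists L {} \<sigma>" and P: "\<And>t. P t \<Longrightarrow> nmem \<sigma> 6 t \<noteq> 0"
  shows "{t. \<exists>l<i. t \<in> set (L l) \<and> P t} = {t. t < nmem \<sigma> 14 0 \<and> P t \<and> nmem \<sigma> 8 t < i}"
proof (rule Collect_cong)
  fix t
  have "t \<in> set (L l) \<Longrightarrow> t < nmem \<sigma> 14 0 \<and> nmem \<sigma> 8 t = l" for l
    using li by (simp add: lists_def)
  moreover have "t < nmem \<sigma> 14 0 \<Longrightarrow> nmem \<sigma> 6 t \<noteq> 0 \<Longrightarrow> t \<in> set (L (nmem \<sigma> 8 t))"
    using li by (simp add: lists_def)
  ultimately show "(\<exists>l<i. t \<in> set (L l) \<and> P t) \<longleftrightarrow> t < nmem \<sigma> 14 0 \<and> P t \<and> nmem \<sigma> 8 t < i"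
    using P[of t] by blast
qed

text \<open>The right-hand side mentions flags and levels but no lists, so two memories with
  different lists can be compared.\<close>

lemma PA_card:
  assumes "lists L {} \<sigma>" "\<forall>i. count L \<sigma> i"
  shows "PA \<sigma> i = card {t. t < nmem \<sigma> 14 0 \<and> (nmem \<sigma> 6 t \<noteq> 0 \<and> nmem \<sigma> 7 t \<noteq> 0) \<and> nmem \<sigma> 8 t < i}"
proof -
  have "PA \<sigma> i = (\<Sum>l<i. card {t \<in> set (L l). nmem \<sigma> 6 t \<noteq> 0 \<and> nmem \<sigma> 7 t \<noteq> 0})"
    unfolding PA_def by (rule sum.cong) (use assms(2) in \<open>auto simp: count_def\<close>)
  also have "\<dots> = card {t. t < nmem \<sigma> 14 0 \<and> (nmem \<sigma> 6 t \<noteq> 0 \<and> nmem \<sigma> 7 t \<noteq> 0) \<and> nmem \<sigma> 8 t < i}"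
    unfolding lists_sum_card[OF assms(1)] by (rule arg_cong[where f = card], rule lists_live[OF assms(1)]) simp
  finally show ?thesis .
qed

lemma sum_length_lists:
  assumes "lists L {} \<sigma>" "\<forall>i. count L \<sigma> i"
  shows "(\<Sum>l<i. length (L l)) = card {t. t < nmem \<sigma> 14 0 \<and> nmem \<sigma> 6 t \<noteq> 0 \<and> nmem \<sigma> 8 t < i} + PD \<sigma> i"
proof -
  have "length (L l) = card {t \<in> set (L l). nmem \<sigma> 6 t \<noteq> 0} + card {t \<in> set (L l). nmem \<sigma> 6 t = 0}" for l
  proof -
    have "distinct (L l)" using assms(1) by (simp add: lists_def)
    then have "length (L l) = card (set (L l))" by (simp add: distinct_card)
    also have "set (L l) = {t \<in> set (L l). nmem \<sigma> 6 t \<noteq> 0} \<union> {t \<in> set (L l). nmem \<sigma> 6 t = 0}" by auto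
    also have "card \<dots> = card {t \<in> set (L l). nmem \<sigma> 6 t \<noteq> 0} + card {t \<in> set (L l). nmem \<sigma> 6 t = 0}"
      by (rule card_Un_disjoint) auto
    finally show ?thesis .
  qed
  then have "(\<Sum>l<i. length (L l)) = (\<Sum>l<i. card {t \<in> set (L l). nmem \<sigma> 6 t \<noteq> 0}) + (\<Sum>l<i. card {t \<in> set (L l). nmem \<sigma> 6 t = 0})"
    by (simp only: sum.distrib)
  moreover have "(\<Sum>l<i. card {t \<in> set (L l). nmem \<sigma> 6 t = 0}) = PD \<sigma> i"
    unfolding PD_def by (rule sum.cong) (use assms(2) in \<open>auto simp: count_def\<close>)
  moreover have "(\<Sum>l<i. card {t \<in> set (L l). nmem \<sigma> 6 t \<noteq> 0}) =
      card {t. t < nmem \<sigma> 14 0 \<and> nmem \<sigma> 6 t \<noteq> 0 \<and> nmem \<sigma> 8 t < i}"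
    unfolding lists_sum_card[OF assms(1)] by (rule arg_cong[where f = card], rule lists_live[OF assms(1)])
  ultimately show ?thesis by simp
qed

lemma PD_beyond:
  assumes "\<forall>i. count L \<sigma> i" "\<forall>j>T. L j = []" "T < i"
  shows "PD \<sigma> i = PD \<sigma> (Suc T)"
proof -
  have "nmem \<sigma> 13 l = 0" if "T < l" for l
    using assms(1,2) that by (auto simp: count_def)
  then have "(\<Sum>l<i. nmem \<sigma> 13 l) = (\<Sum>l<Suc T. nmem \<sigma> 13 l)"
    using assms(3) by (intro sum.mono_neutral_right) auto
  then show ?thesis by (simp add: PD_def)
qed

lemma PA_mono: "i \<le> j \<Longrightarrow> PA \<sigma> i \<le> PA \<sigma> j"
  unfolding PA_def by (rule sum_mono2) auto

section \<open>Deletions\<close>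

text \<open>The element stays in its list with its weight, and covering is demanded for live
  elements only, so just the two counters of its level have to change.\<close>

lemma ready_dead:
  assumes re: "ready 0 L {} \<sigma>" and t: "t < nmem \<sigma> 14 0" "nmem \<sigma> 6 t \<noteq> 0" "l = nmem \<sigma> 8 t"
    and eq: "nmem \<sigma>' 6 = (nmem \<sigma> 6)(t := 0)" "nmem \<sigma>' 12 = (nmem \<sigma> 12)(l := nmem \<sigma> 12 l - nmem \<sigma> 7 t)"
      "nmem \<sigma>' 13 = (nmem \<sigma> 13)(l := nmem \<sigma> 13 l + 1)"
      "\<And>a. a \<notin> {1, 6, 12, 13, 18} \<Longrightarrow> nmem \<sigma>' a = nmem \<sigma> a" "rmem \<sigma>' = rmem \<sigma>"
  shows "ready 0 L {} \<sigma>'"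
proof -
  have pr: "prm \<sigma>" and sy: "sys \<sigma>" and li: "lists L {} \<sigma>" and we: "weights L {} \<sigma>" and se: "sets 0 L \<sigma>"
    and co: "\<And>i. count L \<sigma> i"
    using re by (auto simp: ready_def mid_def)
  have S: "SS \<sigma>' = SS \<sigma>" using eq(4) by (simp add: SS_def fun_eq_iff)
  have e: "nmem \<sigma>' 2 = nmem \<sigma> 2" "nmem \<sigma>' 3 = nmem \<sigma> 3" "nmem \<sigma>' 4 = nmem \<sigma> 4" "nmem \<sigma>' 5 = nmem \<sigma> 5"
    "nmem \<sigma>' 7 = nmem \<sigma> 7" "nmem \<sigma>' 8 = nmem \<sigma> 8" "nmem \<sigma>' 9 = nmem \<sigma> 9" "nmem \<sigma>' 11 = nmem \<sigma> 11"
    "nmem \<sigma>' 14 = nmem \<sigma> 14" "nmem \<sigma>' 15 = nmem \<sigma> 15" by (simp_all add: eq(4))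
  have ld: "load \<sigma>' = load \<sigma>" by (rule load_cong) (simp_all add: S e)
  have tg: "tight \<sigma>' = tight \<sigma>" by (rule tight_cong) (simp add: eq(5))
  have le6: "nmem \<sigma>' 6 v \<noteq> 0 \<Longrightarrow> nmem \<sigma> 6 v \<noteq> 0" for v by (simp add: eq(1) split: if_splits)
  have tl: "t \<in> set (L l)" using li t(1,2) unfolding t(3) lists_def by simp
  have "lists L {} \<sigma>'"
    using li le6 unfolding lists_def e by simp
  moreover have "weights L {} \<sigma>'"
  proof -
    have "wsum \<sigma>' = wsum \<sigma>" by (simp only: wsum_def ld eq(5))
    then show ?thesis using we le6 unfolding weights_def e eq(5) by simp
  qed
  moreover have "sets 0 L \<sigma>'"
    using se le6 unfolding sets_def e tg S by simp
  moreover have "prm \<sigma>'" "sys \<sigma>'"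
    using pr sy unfolding prm_def sys_def e S eq(5) by auto
  moreover have "count L \<sigma>' i" for i
  proof (cases "i = l")
    case True
    let ?A = "{v \<in> set (L l). nmem \<sigma> 6 v \<noteq> 0 \<and> nmem \<sigma> 7 v \<noteq> 0}" and ?D = "{v \<in> set (L l). nmem \<sigma> 6 v = 0}"
    have "{v \<in> set (L l). nmem \<sigma>' 6 v \<noteq> 0 \<and> nmem \<sigma>' 7 v \<noteq> 0} = ?A - {t}"
      by (auto simp: eq(1) e)
    moreover have "card (?A - {t}) = card ?A - nmem \<sigma> 7 t"
    proof (cases "nmem \<sigma> 7 t = 0")
      case True
      then have "?A - {t} = ?A" by auto
      then show ?thesis using True by simp
    next
      case False
      then have "nmem \<sigma> 7 t = 1" using li t(1) by (auto simp: lists_def le_Suc_eq)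
      then show ?thesis using tl t by simp
    qed
    moreover have "{v \<in> set (L l). nmem \<sigma>' 6 v = 0} = insert t ?D" using tl by (auto simp: eq(1))
    moreover have "card (insert t ?D) = card ?D + 1" using t by simp
    ultimately show ?thesis
      using True co[of l] by (simp add: count_def eq(2,3))
  next
    case False
    then have "v \<noteq> t" if "v \<in> set (L i)" for v using li that t(3) by (auto simp: lists_def)
    then have "{v \<in> set (L i). nmem \<sigma>' 6 v \<noteq> 0 \<and> nmem \<sigma>' 7 v \<noteq> 0} = {v \<in> set (L i). nmem \<sigma> 6 v \<noteq> 0 \<and> nmem \<sigma> 7 v \<noteq> 0}"
      "{v \<in> set (L i). nmem \<sigma>' 6 v = 0} = {v \<in> set (L i). nmem \<sigma> 6 v = 0}"
      by (auto simp: eq(1) e)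
    then show ?thesis using False co[of i] by (simp add: count_def eq(2,3))
  qed
  moreover have "card {v. v < nmem \<sigma>' 14 0 \<and> nmem \<sigma>' 6 v \<noteq> 0} \<le> card {v. v < nmem \<sigma> 14 0 \<and> nmem \<sigma> 6 v \<noteq> 0}"
    by (rule card_mono) (use le6 e in auto)
  moreover have "\<forall>j>nmem \<sigma> 15 0. L j = []" "nmem \<sigma> 15 0 \<le> B" "card {v. v < nmem \<sigma> 14 0 \<and> nmem \<sigma> 6 v \<noteq> 0} \<le> n"
    using re by (simp_all add: ready_def)
  ultimately show ?thesis
    unfolding ready_def mid_def e(10) by (meson le0 le_trans not_less0)
qed

text \<open>The comparison is made element by element. One that stays passive rises by at least one
  level and releases at least \<open>3 * u\<close>, more than the \<open>1100 * f\<close> for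
  collection, filling and its single round. One that becomes active releases at least
  \<open>u * (B + 5)\<close>, which pays for up to \<open>B + 2\<close> rounds. An element that was
  active before has no potential; its cost is the last summand and is left to the deleted
  elements.\<close>

lemma rebuild_passive_potential:
  assumes Q: "Q = {t. t < nmem \<sigma> 14 0 \<and> nmem \<sigma> 6 t \<noteq> 0 \<and> nmem \<sigma> 8 t < kk}" and kB: "kk \<le> B + 1"
    and eq: "nmem \<sigma>' 14 0 = nmem \<sigma> 14 0" "nmem \<sigma>' 6 = nmem \<sigma> 6"
    and out: "\<And>t. t \<notin> Q \<Longrightarrow> nmem \<sigma>' 8 t = nmem \<sigma> 8 t \<and> nmem \<sigma>' 7 t = nmem \<sigma> 7 t"
    and inn: "\<And>t. t \<in> Q \<Longrightarrow> (nmem \<sigma> 7 t \<noteq> 0 \<longrightarrow> nmem \<sigma>' 7 t \<noteq> 0) \<and> (nmem \<sigma>' 7 t = 0 \<longrightarrow> nmem \<sigma>' 8 t = kk)"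
  shows "600 * f * card Q + 500 * f * (\<Sum>t\<in>Q. if nmem \<sigma>' 7 t = 0 then 1 else kk + 1) +
      (\<Sum>t | t < nmem \<sigma>' 14 0 \<and> nmem \<sigma>' 6 t \<noteq> 0 \<and> nmem \<sigma>' 7 t = 0. passive_potential \<sigma>' t)
    \<le> (\<Sum>t | t < nmem \<sigma> 14 0 \<and> nmem \<sigma> 6 t \<noteq> 0 \<and> nmem \<sigma> 7 t = 0. passive_potential \<sigma> t) +
      u * (B + 5) * card {t \<in> Q. nmem \<sigma> 7 t \<noteq> 0}"
proof -
  let ?V = "{t. t < nmem \<sigma> 14 0 \<and> nmem \<sigma> 6 t \<noteq> 0}"
  let ?h = "\<lambda>\<rho> t. if nmem \<rho> 7 t = 0 then passive_potential \<rho> t else 0"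
  have fV: "finite ?V" and QV: "Q \<subseteq> ?V" and fQ: "finite Q"
    by (auto simp: Q)
  have split: "(\<Sum>t | t < nmem \<rho> 14 0 \<and> nmem \<rho> 6 t \<noteq> 0 \<and> nmem \<rho> 7 t = 0. passive_potential \<rho> t) =
      (\<Sum>t\<in>?V - Q. ?h \<rho> t) + (\<Sum>t\<in>Q. ?h \<rho> t)" if "nmem \<rho> 14 0 = nmem \<sigma> 14 0" "nmem \<rho> 6 = nmem \<sigma> 6" for \<rho>
  proof -
    have "(\<Sum>t | t < nmem \<rho> 14 0 \<and> nmem \<rho> 6 t \<noteq> 0 \<and> nmem \<rho> 7 t = 0. passive_potential \<rho> t) = (\<Sum>t\<in>?V. ?h \<rho> t)"
      by (rule sum.mono_neutral_cong_left) (use that fV in auto)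
    also have "\<dots> = (\<Sum>t\<in>?V - Q. ?h \<rho> t) + (\<Sum>t\<in>Q. ?h \<rho> t)"
      by (rule sum.subset_diff[OF QV fV])
    finally show ?thesis .
  qed
  have same: "(\<Sum>t\<in>?V - Q. ?h \<sigma>' t) = (\<Sum>t\<in>?V - Q. ?h \<sigma> t)"
    by (rule sum.cong) (use out in \<open>auto simp: passive_potential_def\<close>)
  have "(\<Sum>t\<in>Q. 600 * f + 500 * f * (if nmem \<sigma>' 7 t = 0 then 1 else kk + 1) + ?h \<sigma>' t) \<le>
      (\<Sum>t\<in>Q. ?h \<sigma> t + (if nmem \<sigma> 7 t \<noteq> 0 then u * (B + 5) else 0))"
  proof (rule sum_mono)
    fix t assume t: "t \<in> Q"
    show "600 * f + 500 * f * (if nmem \<sigma>' 7 t = 0 then 1 else kk + 1) + ?h \<sigma>' t \<le>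
      ?h \<sigma> t + (if nmem \<sigma> 7 t \<noteq> 0 then u * (B + 5) else 0)"
    proof (cases "nmem \<sigma>' 7 t = 0")
      case True
      then have a: "nmem \<sigma> 7 t = 0" "nmem \<sigma>' 8 t = kk" "nmem \<sigma> 8 t < kk" using inn[OF t] t by (auto simp: Q)
      obtain d where d: "B + 1 = kk + d" using kB le_Suc_ex by blast
      obtain w where w: "kk = nmem \<sigma> 8 t + 1 + w" using a(3) less_iff_Suc_add by auto
      have "3 * (B + 1 - kk) + B + 5 + 3 \<le> 3 * (B + 1 - nmem \<sigma> 8 t) + B + 5" using d w by simp
      then have "u * (3 * (B + 1 - kk) + B + 5 + 3) \<le> u * (3 * (B + 1 - nmem \<sigma> 8 t) + B + 5)"
        by (rule mult_le_mono2)
      then have "passive_potential \<sigma>' t + 3 * u \<le> passive_potential \<sigma> t"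
        unfolding passive_potential_def a(2) by (simp add: algebra_simps)
      then show ?thesis using True a by (simp add: u_def)
    next
      case False
      have "500 * f * (kk + 1) \<le> 500 * f * (B + 2)" using kB by (intro mult_le_mono2) simp
      then have "600 * f + 500 * f * (kk + 1) \<le> u * (B + 5)"
        by (simp add: u_def algebra_simps)
      moreover have "u * (B + 5) \<le> passive_potential \<sigma> t"
        unfolding passive_potential_def by (rule mult_le_mono2) simp
      ultimately show ?thesis using False by auto
    qed
  qed
  moreover have "(\<Sum>t\<in>Q. 600 * f + 500 * f * (if nmem \<sigma>' 7 t = 0 then 1 else kk + 1) + ?h \<sigma>' t) =
      600 * f * card Q + 500 * f * (\<Sum>t\<in>Q. if nmem \<sigma>' 7 t = 0 then 1 else kk + 1) + (\<Sum>t\<in>Q. ?h \<sigma>' t)"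
    by (simp only: sum.distrib sum_distrib_left sum_constant) (simp add: mult.commute)
  moreover have "(\<Sum>t\<in>Q. if nmem \<sigma> 7 t \<noteq> 0 then u * (B + 5) else 0) = u * (B + 5) * card {t \<in> Q. nmem \<sigma> 7 t \<noteq> 0}"
    using fQ by (simp add: sum.If_cases Int_def)
  ultimately show ?thesis
    unfolding split[OF eq] split[OF refl refl] same by (simp add: sum.distrib mult.commute[of "card Q"])
qed

lemma link_cong:
  assumes "link X \<sigma>" "nmem \<sigma>' 4 = nmem \<sigma> 4" "nmem \<sigma>' 5 = nmem \<sigma> 5" "nmem \<sigma>' 6 = nmem \<sigma> 6"
    "nmem \<sigma>' 10 = nmem \<sigma> 10" "nmem \<sigma>' 14 = nmem \<sigma> 14"
  shows "link X \<sigma>'"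
proof -
  have "SS \<sigma>' = SS \<sigma>" using assms by (simp add: SS_def fun_eq_iff)
  then show ?thesis using assms by (simp add: link_def)
qed

lemma potential_cong:
  assumes "nmem \<sigma>' 6 = nmem \<sigma> 6" "nmem \<sigma>' 7 = nmem \<sigma> 7" "nmem \<sigma>' 8 = nmem \<sigma> 8" "nmem \<sigma>' 13 = nmem \<sigma> 13"
    "nmem \<sigma>' 14 = nmem \<sigma> 14" "nmem \<sigma>' 15 = nmem \<sigma> 15"
  shows "potential \<sigma>' = potential \<sigma>"
  using assms by (simp add: potential_def passive_potential_def PD_def)

lemma wp_delete:
  assumes inv: "inv X \<sigma>" and e: "nmem \<sigma> 1 1 = e" "e \<in> fst X" and pw0: "rmem \<sigma> 4 0 = 1"
    and k: "potential \<sigma> + update_cost \<le> k"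
  shows "wp delete (\<lambda>\<sigma>' k'. inv (apply_update (Delete e) X) \<sigma>' \<and>
      k + potential \<sigma>' \<le> k' + potential \<sigma> + update_cost) \<sigma> k"
proof -
  obtain L where re: "ready 0 L {} \<sigma>" using inv by (auto simp: inv_def)
  have pwT: "pw_upto (nmem \<sigma> 15 0) \<sigma>" and ba: "balanced \<sigma>" and lk: "link X \<sigma>" using inv by (auto simp: inv_def)
  define t where "t = nmem \<sigma> 10 e"
  define l where "l = nmem \<sigma> 8 t"
  have t: "t < nmem \<sigma> 14 0" "nmem \<sigma> 6 t \<noteq> 0" using lk e by (auto simp: link_def t_def)
  have li: "lists L {} \<sigma>" and sy: "sys \<sigma>" and T: "nmem \<sigma> 15 0 \<le> B" and top: "\<forall>j>nmem \<sigma> 15 0. L j = []"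
    using re by (auto simp: ready_def mid_def)
  have f: "1 \<le> f" using sysD(5)[OF sy t(1)] .
  have tl: "t \<in> set (L l)" using li t unfolding l_def lists_def by simp
  have lT: "l \<le> nmem \<sigma> 15 0" using tl top by (metis empty_iff list.set(1) not_le)
  let ?\<sigma>1 = "nset 13 l (nmem \<sigma> 13 l + 1) (nset 12 l (nmem \<sigma> 12 l - nmem \<sigma> 7 t) (nset 6 t 0 (nset 18 0 t \<sigma>)))"
  define \<sigma>1 where "\<sigma>1 = ?\<sigma>1"
  have e1: "nmem \<sigma>1 6 = (nmem \<sigma> 6)(t := 0)" "nmem \<sigma>1 12 = (nmem \<sigma> 12)(l := nmem \<sigma> 12 l - nmem \<sigma> 7 t)"
      "nmem \<sigma>1 13 = (nmem \<sigma> 13)(l := nmem \<sigma> 13 l + 1)"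
      "\<And>a. a \<notin> {1, 6, 12, 13, 18} \<Longrightarrow> nmem \<sigma>1 a = nmem \<sigma> a" "rmem \<sigma>1 = rmem \<sigma>"
    by (auto simp: \<sigma>1_def)
  have re1: "ready 0 L {} \<sigma>1" by (rule ready_dead[OF re t l_def e1])
  have li1: "lists L {} \<sigma>1" and co1: "\<forall>i. count L \<sigma>1 i" and pr1: "prm \<sigma>1" and mid1: "mid 0 L {} \<sigma>1"
    using re1 by (auto simp: ready_def mid_def)
  define T where "T = nmem \<sigma> 15 0"
  have T1: "nmem \<sigma>1 15 0 = T" by (simp add: e1(4) T_def)
  have top1: "\<forall>j>T. L j = []" using top by (simp add: T_def)
  have TB: "T \<le> B" using T by (simp add: T_def)
  let ?X = "apply_update (Delete e) X"
  have S1: "SS \<sigma>1 = SS \<sigma>" using e1(4) by (simp add: SS_def fun_eq_iff)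
  have lk1: "link ?X \<sigma>1"
  proof -
    have 1: "nmem \<sigma>1 10 = nmem \<sigma> 10" "nmem \<sigma>1 14 = nmem \<sigma> 14" by (simp_all add: e1(4))
    have ne: "nmem \<sigma> 10 d \<noteq> t" if "d \<in> fst X - {e}" for d
      using lk that e(2) by (auto simp: link_def t_def inj_on_def)
    show ?thesis
      unfolding link_def 1 S1 e1(1)
    proof (intro conjI, goal_cases)
      case 1 show ?case using lk by (auto simp: link_def)
    next
      case 2 show ?case using lk by (auto simp: link_def intro: inj_on_subset)
    next
      case 3
      show ?case
      proof
        fix d assume d: "d \<in> fst ?X"
        then have "d \<in> fst X - {e}" by simp
        then show "nmem \<sigma> 10 d < nmem \<sigma> 14 0 \<and> ((nmem \<sigma> 6)(t := 0)) (nmem \<sigma> 10 d) \<noteq> 0 \<and>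
          SS \<sigma> (nmem \<sigma> 10 d) = {s. d \<in> snd ?X s}"
          using lk ne[of d] by (auto simp: link_def)
      qed
    next
      case 4 show ?case using lk by (auto simp: link_def t_def)
    next
      case 5 show ?case using lk by (auto simp: link_def)
    qed
  qed
  \<comment> \<open>The potential carried by one deleted element.\<close>
  define V where "V = u * (M + 1) * (B + 5)"
  have pot: "potential \<rho> = (\<Sum>t | t < nmem \<rho> 14 0 \<and> nmem \<rho> 6 t \<noteq> 0 \<and> nmem \<rho> 7 t = 0. passive_potential \<rho> t) + V * PD \<rho> (Suc (nmem \<rho> 15 0))" for \<rho>
    by (simp add: potential_def V_def)
  have pot1: "potential \<sigma>1 \<le> potential \<sigma> + V"
  proof -
    have "PD \<sigma>1 (Suc T) = PD \<sigma> (Suc T) + 1"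
    proof -
      have lm: "l \<in> {..<Suc T}" using lT by (simp add: T_def)
      have "(\<Sum>i\<in>{..<Suc T} - {l}. nmem \<sigma>1 13 i) = (\<Sum>i\<in>{..<Suc T} - {l}. nmem \<sigma> 13 i)"
        by (rule sum.cong) (auto simp: e1)
      then show ?thesis
        unfolding PD_def sum.remove[OF finite_lessThan lm] by (simp add: e1)
    qed
    moreover have "passive_potential \<sigma>1 = passive_potential \<sigma>"
      using e1(4)[of 8] by (simp add: passive_potential_def fun_eq_iff)
    moreover have "(\<Sum>v | v < nmem \<sigma>1 14 0 \<and> nmem \<sigma>1 6 v \<noteq> 0 \<and> nmem \<sigma>1 7 v = 0. passive_potential \<sigma> v) \<le>
      (\<Sum>v | v < nmem \<sigma> 14 0 \<and> nmem \<sigma> 6 v \<noteq> 0 \<and> nmem \<sigma> 7 v = 0. passive_potential \<sigma> v)"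
      by (rule sum_mono2) (auto simp: e1 split: if_splits)
    ultimately show ?thesis unfolding pot T1 by (simp add: T_def)
  qed
  have uV: "u * (B + 5) \<le> V"
    unfolding V_def by simp
  have BV: "1000 * B + 5000 \<le> V"
  proof -
    have "1000 * (B + 5) \<le> u * (B + 5)" by (rule mult_le_mono1) (use f in \<open>simp add: u_def\<close>)
    then show ?thesis using uV by simp
  qed
  have uc: "update_cost = 10 * V" by (simp add: update_cost_def V_def)
  have kV: "potential \<sigma> + 10 * V \<le> k" using k uc by simp
  let ?rest = "Cond (NLess (NConst 0) (NV 21))
               (Seq (RWrite 4 (NV 21) (RDiv (RRead 4 (NSub (NV 21) (NConst 1))) (RAdd (ROfNat (NConst 1)) eps1)))
                 (Seq collect settle)) Skip"
  let ?post = "\<lambda>\<sigma>' k'. inv ?X \<sigma>' \<and> k + potential \<sigma>' \<le> k' + potential \<sigma> + update_cost"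
  have pws: "rmem \<sigma> 4 j = p j" if "j \<le> T" for j
    using pwT pw0 that by (cases "j = 0") (auto simp: pw_upto_def T_def)
  have eps: "rmem \<sigma>1 0 0 = 4 * x" using pr1 by (simp add: prm_def)
  \<comment> \<open>The exact cost of the steps before the scan is irrelevant; only that it is at
    most 100 enters.\<close>
  have main: "wp scan (wp ?rest ?post) \<sigma>1 k1" if k1: "k \<le> k1 + 100" for k1
  proof (rule wp_mono_frame[OF wp_scan[OF eps]], goal_cases)
    case 1 show ?case using k1 kV BV TB unfolding T1 by simp
  next
    case (2 \<sigma>2 k2)
    have fr2: "a \<notin> {20, 21, 24, 25} \<Longrightarrow> nmem \<sigma>2 a = nmem \<sigma>1 a" "rmem \<sigma>2 = rmem \<sigma>1" for a
      using 2(1) by (auto simp: frame_def)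
    define kk where "kk = nmem \<sigma>2 21 0"
    have k2: "k1 \<le> k2 + 100 * (T + 2)" and kkT: "kk \<le> Suc T" and
      hi: "\<forall>i. kk < i \<and> i \<le> Suc T \<longrightarrow> real (PD \<sigma>1 i) \<le> x * real (PA \<sigma>1 i)" and
      vio: "0 < kk \<Longrightarrow> x * real (PA \<sigma>1 kk) < real (PD \<sigma>1 kk)"
      using 2(3) unfolding T1 kk_def by auto
    have k2': "k \<le> k2 + 100 * B + 300" using k1 k2 TB by simp
    \<comment> \<open>Beyond the top level the number of deleted elements no longer grows while that
      of active ones cannot drop, so the prefix ending at the top level decides.\<close>
    have hi': "real (PD \<sigma>1 i) \<le> x * real (PA \<sigma>1 i)" if "kk < Suc T" "kk < i \<or> i = 0" for i
    proof (cases "i \<le> Suc T")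
      case True
      then show ?thesis using hi that by (cases "i = 0") (auto simp: PD_def PA_def)
    next
      case False
      have "real (PD \<sigma>1 (Suc T)) \<le> x * real (PA \<sigma>1 (Suc T))" using hi that by blast
      moreover have "PD \<sigma>1 i = PD \<sigma>1 (Suc T)" by (rule PD_beyond[OF co1 top1]) (use False in simp)
      moreover have "x * real (PA \<sigma>1 (Suc T)) \<le> x * real (PA \<sigma>1 i)"
        using PA_mono[of "Suc T" i \<sigma>1] False x_pos by simp
      ultimately show ?thesis by simp
    qed
    show ?case
    proof (cases "kk = 0")
      case True
      have "ready 0 L {} \<sigma>2" by (rule ready_cong[OF re1]) (simp_all add: fr2)
      moreover have "link ?X \<sigma>2" by (rule link_cong[OF lk1]) (simp_all add: fr2)
      moreover have "balanced \<sigma>2"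
      proof -
        have "PA \<sigma>2 = PA \<sigma>1" "PD \<sigma>2 = PD \<sigma>1" by (simp_all add: PA_def PD_def fr2 fun_eq_iff)
        moreover have "real (PD \<sigma>1 i) \<le> x * real (PA \<sigma>1 i)" for i
          using hi'[of i] True by (cases "i = 0") simp_all
        ultimately show ?thesis by (simp add: balanced_def)
      qed
      moreover have "pw_upto (nmem \<sigma>2 15 0) \<sigma>2"
        using pwT by (simp add: pw_upto_def fr2 e1)
      ultimately have "inv ?X \<sigma>2" by (auto simp: inv_def)
      moreover have "potential \<sigma>2 = potential \<sigma>1" by (rule potential_cong) (simp_all add: fr2)
      moreover have "k + potential \<sigma>1 \<le> k2 - 6 + potential \<sigma> + update_cost" "6 \<le> k2"
        using k2' pot1 BV kV uc by simp_all
      ultimately show ?thesis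
        using True unfolding kk_def by (simp add: numeral_2_eq_2[symmetric])
    next
      case False
      define Q where "Q = {v. v < nmem \<sigma>1 14 0 \<and> nmem \<sigma>1 6 v \<noteq> 0 \<and> nmem \<sigma>1 8 v < kk}"
      have fQ: "finite Q" by (simp add: Q_def)
      define q where "q = card Q"
      define dd where "dd = PD \<sigma>1 kk"
      define a where "a = card {v \<in> Q. nmem \<sigma>1 7 v \<noteq> 0}"
      have kB: "kk \<le> B + 1" using kkT TB by simp
      have len: "(\<Sum>i<kk. length (L i)) = q + dd"
        using sum_length_lists[OF li1 co1, of kk] by (simp add: q_def dd_def Q_def)
      have aPA: "PA \<sigma>1 kk = a"
        unfolding PA_card[OF li1 co1] a_def Q_def by (rule arg_cong[where f = card]) auto
      \<comment> \<open>The prefix is bad and \<open>1 \<le> x * real M\<close>, so a deleted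
        element has to pay for at most \<open>M\<close> active ones.\<close>
      have aM: "a \<le> M * dd"
      proof -
        have "real a \<le> x * real M * real a" using mult_right_mono[OF M, of "real a"] by simp
        also have "\<dots> = real M * (x * real a)" by simp
        also have "\<dots> \<le> real M * real dd"
          using vio False by (intro mult_left_mono) (auto simp: aPA dd_def)
        finally have "real a \<le> real (M * dd)" by simp
        then show ?thesis by (simp only: of_nat_le_iff)
      qed
      have Vd: "u * (B + 5) * a + u * (B + 5) * dd \<le> V * dd"
      proof -
        have "u * (B + 5) * a \<le> u * (B + 5) * (M * dd)" using aM by (rule mult_le_mono2)
        then show ?thesis by (simp add: V_def algebra_simps)
      qed
      have dT: "dd \<le> PD \<sigma>1 (Suc T)" unfolding dd_def PD_def by (rule sum_mono2) (use kkT in auto)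
      \<comment> \<open>Settling demands its worst-case credits in advance, so the potential must
        cover \<open>kk + 1\<close> rounds for every element to be rebuilt. A passive element
        carries enough of its own, and the active ones are covered by the deleted ones.\<close>
      have room: "u * (B + 5) * q + u * (B + 5) * dd \<le> potential \<sigma>1"
      proof -
        let ?P = "{v \<in> Q. nmem \<sigma>1 7 v = 0}"
        have qa: "q = card ?P + a"
        proof -
          have "Q = ?P \<union> {v \<in> Q. nmem \<sigma>1 7 v \<noteq> 0}" by auto
          moreover have "card (?P \<union> {v \<in> Q. nmem \<sigma>1 7 v \<noteq> 0}) = card ?P + card {v \<in> Q. nmem \<sigma>1 7 v \<noteq> 0}"
            by (rule card_Un_disjoint) (use fQ in auto)
          ultimately show ?thesis by (simp add: q_def a_def)
        qed
        have "u * (B + 5) * q = u * (B + 5) * card ?P + u * (B + 5) * a"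
          unfolding qa by (rule distrib_left)
        moreover have "u * (B + 5) * card ?P \<le> (\<Sum>v | v < nmem \<sigma>1 14 0 \<and> nmem \<sigma>1 6 v \<noteq> 0 \<and> nmem \<sigma>1 7 v = 0. passive_potential \<sigma>1 v)"
        proof -
          have "u * (B + 5) * card ?P = (\<Sum>v\<in>?P. u * (B + 5))" by simp
          also have "\<dots> \<le> (\<Sum>v\<in>?P. passive_potential \<sigma>1 v)"
            unfolding passive_potential_def by (intro sum_mono mult_le_mono2) simp
          also have "\<dots> \<le> (\<Sum>v | v < nmem \<sigma>1 14 0 \<and> nmem \<sigma>1 6 v \<noteq> 0 \<and> nmem \<sigma>1 7 v = 0. passive_potential \<sigma>1 v)"
            by (rule sum_mono2) (auto simp: Q_def)
          finally show ?thesis .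
        qed
        moreover have "V * dd \<le> V * PD \<sigma>1 (Suc T)" using dT by (rule mult_le_mono2)
        ultimately show ?thesis
          using Vd unfolding pot T1 by linarith
      qed
      have fle: "600 * (f * z) + 500 * (f * ((kk + 1) * z)) \<le> u * (B + 5) * z" for z
      proof -
        have "600 + 500 * (kk + 1) \<le> 1000 * (B + 5)" using kB by simp
        then have "f * z * (600 + 500 * (kk + 1)) \<le> f * z * (1000 * (B + 5))" by (rule mult_le_mono2)
        then show ?thesis by (simp add: u_def algebra_simps)
      qed
      have fd: "300 * (f * dd) \<le> u * (B + 5) * dd"
        by (simp add: u_def algebra_simps)
      \<comment> \<open>Naming the products leaves only linear arithmetic for the credit
        balances.\<close>
      define fq where "fq = f * q"
      define fdd where "fdd = f * dd"
      define fk where "fk = f * ((kk + 1) * q)"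
      define Uq where "Uq = u * (B + 5) * q"
      define Ud where "Ud = u * (B + 5) * dd"
      have room': "Uq + Ud \<le> potential \<sigma>1" using room by (simp only: Uq_def Ud_def)
      have fle': "600 * fq + 500 * fk \<le> Uq" using fle[of q] by (simp only: fq_def fk_def Uq_def)
      have fd': "300 * fdd \<le> Ud" using fd by (simp only: fdd_def Ud_def)
      let ?\<sigma>3 = "rset 4 kk (p kk) \<sigma>2"
      have mid3: "mid 0 L {} ?\<sigma>3" by (rule mid_cong[OF mid1]) (simp_all add: fr2)
      have co3: "\<forall>i. count L ?\<sigma>3 i" using co1 by (simp add: count_def fr2)
      have c3: "300 * (f * (\<Sum>i<kk. length (L i))) + 50 * (kk + 1) \<le> k2 - 22"
        unfolding len distrib_left[of f] fq_def[symmetric] fdd_def[symmetric]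
        using room' fle' fd' kV k2' pot1 BV kB by simp
      have "wp collect (wp settle ?post) ?\<sigma>3 (k2 - 22)"
      proof (rule wp_mono_frame[OF wp_collect[OF mid3 co3 _ _ c3]], goal_cases)
        case 1 show ?case by (simp add: kk_def)
      next
        case 2 show ?case by simp
      next
        case (3 \<sigma>4 k4)
        have fr4: "b \<notin> {2, 3, 9, 11, 12, 13, 16, 18, 19, 20, 21, 24, 25} \<Longrightarrow> nmem \<sigma>4 b = nmem \<sigma>1 b"
          "b \<notin> {2, 3, 4, 5} \<Longrightarrow> rmem \<sigma>4 b = rmem \<sigma>1 b" "rmem \<sigma>4 4 = (rmem \<sigma>1 4)(kk := p kk)" "nmem \<sigma>4 21 0 = kk" for b
          using 3(1) fr2 by (auto simp: frame_def kk_def)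
        let ?L = "\<lambda>i. if i < kk then [] else L i"
        obtain qs where mid4: "mid 0 ?L (set qs) \<sigma>4" and c4: "chain (nmem \<sigma>4 9) (nmem \<sigma>4 16 0) qs" "distinct qs"
          and qsQ: "set qs = Q" and
          Q4: "\<forall>t\<in>set qs. rmem \<sigma>4 3 t = (if nmem \<sigma>1 7 t = 0 then 0 else p kk) \<and> (\<forall>s\<in>SS \<sigma>1 t. nmem \<sigma>4 3 s = 0)"
          using 3(3) fr2(1) SS_cong[of \<sigma>2 \<sigma>1] by (auto simp: Q_def)
        have co4: "\<forall>i. count ?L \<sigma>4 i" and D4: "nmem \<sigma>4 13 i = (if i < kk then 0 else nmem \<sigma>1 13 i)"
          and k4: "k2 - 22 \<le> k4 + 300 * fq + 300 * fdd + 50 * (kk + 1)" for i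
          using 3(3) fr2(1) unfolding len by (auto simp: fq_def fdd_def distrib_left)
        have S4: "SS \<sigma>4 = SS \<sigma>1" by (rule SS_cong) (simp_all add: fr4)
        have lq: "length qs = q" using qsQ c4(2) by (simp add: q_def flip: distinct_card)
        have re4: "ready kk ?L (set qs) \<sigma>4"
          using mid4 co4 re1 kkT top1 T1 fr4 unfolding ready_def by auto
        have set4: "300 * f * length qs + 500 * f * ((kk + 1) * length qs) + 100 * (kk + 2) \<le> k4"
          unfolding lq mult.assoc[of 300] mult.assoc[of 500] fq_def[symmetric] fk_def[symmetric]
          using room' fle' fd' kV k2' pot1 BV kB k4 by simp
        show ?case
        proof (rule wp_mono_frame[OF wp_settle[OF re4 c4 fr4(4) _ _ _ set4]], goal_cases)
          case (1 j)
          then show ?case using pws[of j] kkT by (cases "j = kk") (auto simp: fr4 e1)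
        next
          case (2 t) then show ?case using Q4 fr4(1)[of 7] by simp
        next
          case (3 t s) then show ?case using Q4 S4 by simp
        next
          case (4 \<sigma>5 k5)
          have fr5: "b \<notin> {2, 3, 7, 8, 9, 11, 12, 13, 15, 16, 17, 18, 19, 20, 21, 22, 23, 24, 25} \<Longrightarrow> nmem \<sigma>5 b = nmem \<sigma>1 b"
            "rmem \<sigma>5 4 = (rmem \<sigma>1 4)(kk := p kk)" "nmem \<sigma>5 13 = nmem \<sigma>4 13" for b
            using 4(1) fr4 by (auto simp: frame_def)
          obtain L5 where re5: "ready 0 L5 {} \<sigma>5" using 4(3) by blast
          have out: "nmem \<sigma>5 8 t = nmem \<sigma>1 8 t \<and> nmem \<sigma>5 7 t = nmem \<sigma>1 7 t" if "t \<notin> Q" for t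
            using 4(3) that fr4(1)[of 7] fr4(1)[of 8] by (simp add: qsQ)
          have inn: "(nmem \<sigma>1 7 t \<noteq> 0 \<longrightarrow> nmem \<sigma>5 7 t \<noteq> 0) \<and> (nmem \<sigma>5 7 t = 0 \<longrightarrow> nmem \<sigma>5 8 t = kk)" and
            el5: "nmem \<sigma>5 8 t \<le> kk" if "t \<in> Q" for t
            using 4(3) that fr4(1)[of 7] by (simp_all add: qsQ)
          have T5: "T \<le> nmem \<sigma>5 15 0" "nmem \<sigma>5 15 0 \<le> max T kk"
            using 4(3) fr4(1)[of 15] T1 by simp_all
          define G where "G = f * (\<Sum>t\<in>Q. if nmem \<sigma>5 7 t = 0 then 1 else kk + 1)"
          have k5: "k4 \<le> k5 + 300 * fq + 500 * G + 100 * (kk + 2)"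
            using 4(3) unfolding lq qsQ G_def fq_def by (simp add: mult.assoc)
          have lk5: "link ?X \<sigma>5" by (rule link_cong[OF lk1]) (simp_all add: fr5)
          have pw5: "pw_upto (nmem \<sigma>5 15 0) \<sigma>5"
            unfolding pw_upto_def
          proof (intro allI impI)
            fix j assume j: "0 < j \<and> j \<le> nmem \<sigma>5 15 0"
            then have "j = kk \<or> j \<le> T" using T5 kkT by auto
            then show "rmem \<sigma>5 4 j = p j" using pws[of j] by (auto simp: fr5 e1)
          qed
          have li5: "lists L5 {} \<sigma>5" and co5: "\<forall>i. count L5 \<sigma>5 i" and top5: "\<forall>j>nmem \<sigma>5 15 0. L5 j = []"
            using re5 by (auto simp: ready_def mid_def)
          have PD5: "PD \<sigma>5 i = (\<Sum>j<i. if j < kk then 0 else nmem \<sigma>1 13 j)" for i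
            unfolding PD_def fr5(3) by (rule sum.cong) (simp_all add: D4)
          have PD_low: "PD \<sigma>5 i = 0" if "i \<le> kk" for i
            unfolding PD5 using that by (intro sum.neutral) auto
          have PD_le: "PD \<sigma>5 i \<le> PD \<sigma>1 i" for i
            unfolding PD5 unfolding PD_def by (rule sum_mono) auto
          \<comment> \<open>Active elements stay active, and the rebuilt ones end at level
            \<open>kk\<close> or below, hence still below \<open>i\<close>.\<close>
          have PA_le: "PA \<sigma>1 i \<le> PA \<sigma>5 i" if i: "kk < i" for i
            unfolding PA_card[OF li1 co1] PA_card[OF li5 co5]
          proof (rule card_mono)
            show "{t. t < nmem \<sigma>1 14 0 \<and> (nmem \<sigma>1 6 t \<noteq> 0 \<and> nmem \<sigma>1 7 t \<noteq> 0) \<and> nmem \<sigma>1 8 t < i}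
              \<subseteq> {t. t < nmem \<sigma>5 14 0 \<and> (nmem \<sigma>5 6 t \<noteq> 0 \<and> nmem \<sigma>5 7 t \<noteq> 0) \<and> nmem \<sigma>5 8 t < i}"
            proof
              fix v assume "v \<in> {t. t < nmem \<sigma>1 14 0 \<and> (nmem \<sigma>1 6 t \<noteq> 0 \<and> nmem \<sigma>1 7 t \<noteq> 0) \<and> nmem \<sigma>1 8 t < i}"
              then show "v \<in> {t. t < nmem \<sigma>5 14 0 \<and> (nmem \<sigma>5 6 t \<noteq> 0 \<and> nmem \<sigma>5 7 t \<noteq> 0) \<and> nmem \<sigma>5 8 t < i}"
                using out[of v] inn[of v] el5[of v] i fr5(1)[of 14] fr5(1)[of 6] by (cases "v \<in> Q") auto
            qed
          qed simp
          have "balanced \<sigma>5"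
            unfolding balanced_def
          proof
            fix i
            show "real (PD \<sigma>5 i) \<le> x * real (PA \<sigma>5 i)"
            proof (cases "i \<le> kk")
              case True
              then show ?thesis using PD_low x_pos by simp
            next
              case i: False
              show ?thesis
              proof (cases "kk < Suc T")
                case True
                have "real (PD \<sigma>5 i) \<le> real (PD \<sigma>1 i)" using PD_le by simp
                also have "\<dots> \<le> x * real (PA \<sigma>1 i)" using hi'[of i] True i by simp
                also have "\<dots> \<le> x * real (PA \<sigma>5 i)" using PA_le[of i] i x_pos by simp
                finally show ?thesis .
              next
                case F: False
                \<comment> \<open>Here \<open>kk = Suc T\<close>: all levels were rebuilt, so no
                  deleted element is left.\<close>
                have "PD \<sigma>5 i = 0"
                  unfolding PD5
                proof (intro sum.neutral ballI)
                  fix j show "(if j < kk then 0 else nmem \<sigma>1 13 j) = 0"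
                    using F co1 top1 by (auto simp: count_def)
                qed
                then show ?thesis using x_pos by simp
              qed
            qed
          qed
          with re5 pw5 lk5 have inv5: "inv ?X \<sigma>5" by (auto simp: inv_def)
          have PDsum: "PD \<sigma>5 (Suc (nmem \<sigma>5 15 0)) + dd = PD \<sigma>1 (Suc T)"
          proof -
            have "PD \<sigma>5 (Suc (nmem \<sigma>5 15 0)) + dd = PD \<sigma>1 (Suc (nmem \<sigma>5 15 0))"
            proof -
              have kle: "kk \<le> Suc (nmem \<sigma>5 15 0)" using kkT T5 by simp
              have "dd = (\<Sum>j<Suc (nmem \<sigma>5 15 0). if j < kk then nmem \<sigma>1 13 j else 0)"
                unfolding dd_def PD_def by (rule sum.mono_neutral_cong_left) (use kle in auto)
              then show ?thesis
                unfolding PD5 by (simp only: sum.distrib[symmetric]) (unfold PD_def, rule sum.cong, auto)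
            qed
            also have "\<dots> = PD \<sigma>1 (Suc T)"
              by (rule PD_beyond[OF co1 top1]) (use T5 in simp)
            finally show ?thesis .
          qed
          have pass: "600 * fq + 500 * G + (\<Sum>t | t < nmem \<sigma>5 14 0 \<and> nmem \<sigma>5 6 t \<noteq> 0 \<and> nmem \<sigma>5 7 t = 0. passive_potential \<sigma>5 t)
            \<le> (\<Sum>t | t < nmem \<sigma>1 14 0 \<and> nmem \<sigma>1 6 t \<noteq> 0 \<and> nmem \<sigma>1 7 t = 0. passive_potential \<sigma>1 t) + u * (B + 5) * a"
            using rebuild_passive_potential[OF Q_def kB, of \<sigma>5] out inn fr5(1)[of 14] fr5(1)[of 6]
            unfolding fq_def q_def G_def a_def by (simp add: mult.assoc)
          have "V * PD \<sigma>5 (Suc (nmem \<sigma>5 15 0)) + V * dd = V * PD \<sigma>1 (Suc T)"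
            using PDsum by (simp flip: distrib_left)
          \<comment> \<open>By \<open>Vd\<close> the potential of the purged elements splits in two:
            one part pays for the rebuilt active elements, the other, \<open>Ud\<close>, for
            collecting the purged ones themselves.\<close>
          then have "600 * fq + 500 * G + potential \<sigma>5 + Ud \<le> potential \<sigma>1"
            using pass Vd unfolding pot T1 Ud_def by linarith
          then have "k + potential \<sigma>5 \<le> k5 + potential \<sigma> + update_cost"
            using k5 k4 k2' kB BV pot1 uc fd' by simp
          with inv5 show ?case by simp
        qed
      qed
      moreover have "22 \<le> k2" using kV k2' pot1 BV by simp
      \<comment> \<open>When \<open>kk\<close> is a new top level its weight is not stored yet, but
        that of its predecessor is, because \<open>kk \<le> Suc T\<close>.\<close>
      moreover have "rmem \<sigma>2 4 (kk - Suc 0) / (1 + rmem \<sigma>2 0 0 / 4) = p kk"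
        using pws[of "kk - 1"] kkT False p_Suc[of "kk - 1"] eps by (simp add: fr2 e1)
      ultimately show ?thesis
        using False unfolding kk_def[symmetric] by (auto simp: numeral_2_eq_2[symmetric] eps1_def kk_def[symmetric])
    qed
  qed
  have "wp scan (wp ?rest ?post) \<sigma>1 (k - 31)" by (rule main) (use kV BV in simp)
  moreover have "100 \<le> k" using kV BV by simp
  ultimately show ?thesis
    using e(1) unfolding \<sigma>1_def
    by (auto simp: delete_def numeral_2_eq_2[symmetric] t_def[symmetric] l_def[symmetric])
qed

section \<open>Insertions\<close>

lemma nwr_insert_ops [simp]: "nwr read_sets = {4, 5, 19}" "rwr read_sets = {}"
  by (auto simp: read_sets_def)

lemma wp_read_sets:
  assumes N: "nmem \<sigma> 14 0 = N" and len: "nmem \<sigma> 1 2 = length ss"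
    and ss: "\<And>i. i < length ss \<Longrightarrow> nmem \<sigma> 1 (i + 3) = ss ! i" and k: "60 * length ss + 60 \<le> k"
  shows "wp read_sets (\<lambda>\<sigma>' k'. k \<le> k' + 60 * length ss + 60 \<and>
      nmem \<sigma>' 5 = (nmem \<sigma> 5)(Suc N := nmem \<sigma> 5 N + length ss) \<and>
      nmem \<sigma>' 4 = (\<lambda>i. if nmem \<sigma> 5 N \<le> i \<and> i < nmem \<sigma> 5 N + length ss then ss ! (i - nmem \<sigma> 5 N) else nmem \<sigma> 4 i)) \<sigma> k"
proof -
  define a where "a = nmem \<sigma> 5 N"
  define K0 where "K0 = k - (60 * length ss + 60)"
  have kK: "K0 + 60 * length ss + 60 = k" using k by (simp add: K0_def)
  define I where "I \<sigma>' k' \<longleftrightarrow> nmem \<sigma>' 19 0 \<le> length ss \<and> nmem \<sigma>' 5 = (nmem \<sigma> 5)(Suc N := a + nmem \<sigma>' 19 0) \<and>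
      nmem \<sigma>' 4 = (\<lambda>i. if a \<le> i \<and> i < a + nmem \<sigma>' 19 0 then ss ! (i - a) else nmem \<sigma> 4 i) \<and>
      K0 + 60 * (length ss - nmem \<sigma>' 19 0) + 20 \<le> k'" for \<sigma>' :: mem and k'
  let ?B = "Seq (NWrite 4 (NRead 5 (NAdd (NV 14) (NConst 1))) (NRead 1 (NAdd (NV 19) (NConst 3))))
           (Seq (NWrite 5 (NAdd (NV 14) (NConst 1)) (NAdd (NRead 5 (NAdd (NV 14) (NConst 1))) (NConst 1)))
             (NSet 19 (NAdd (NV 19) (NConst 1))))"
  let ?Q = "\<lambda>\<sigma>' k'. k \<le> k' + 60 * length ss + 60 \<and>
      nmem \<sigma>' 5 = (nmem \<sigma> 5)(Suc N := nmem \<sigma> 5 N + length ss) \<and>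
      nmem \<sigma>' 4 = (\<lambda>i. if nmem \<sigma> 5 N \<le> i \<and> i < nmem \<sigma> 5 N + length ss then ss ! (i - nmem \<sigma> 5 N) else nmem \<sigma> 4 i)"
  have "wp (While (NLess (NV 19) (NRead 1 (NConst 2))) ?B) ?Q (nset 19 0 0 (nset 5 (Suc N) a \<sigma>)) (k - 11)"
  proof (rule wp_While[where I = I], goal_cases)
    case 1
    show ?case using kK by (auto simp: I_def fun_eq_iff)
  next
    case (2 \<sigma>1 k1)
    have fr: "nmem \<sigma>1 14 = nmem \<sigma> 14" "nmem \<sigma>1 1 = nmem \<sigma> 1"
      using 2(1) by (auto simp: frame_def)
    define i where "i = nmem \<sigma>1 19 0"
    have il: "i < length ss" using 2(3) fr len by (simp add: i_def)
    have I1: "nmem \<sigma>1 5 = (nmem \<sigma> 5)(Suc N := a + i)"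
      "nmem \<sigma>1 4 = (\<lambda>j. if a \<le> j \<and> j < a + i then ss ! (j - a) else nmem \<sigma> 4 j)"
      using 2(2) unfolding I_def i_def by auto
    have k1: "K0 + 60 * (length ss - Suc i) + 20 + 60 \<le> k1"
    proof -
      have "length ss - i = Suc (length ss - Suc i)" using il by simp
      then show ?thesis using 2(2) unfolding I_def i_def[symmetric] by simp
    qed
    let ?\<sigma>2 = "nset 19 0 (Suc i) (nset 5 (Suc N) (Suc (a + i)) (nset 4 (a + i) (ss ! i) \<sigma>1))"
    have "I ?\<sigma>2 k2" if "k1 \<le> k2 + 60" for k2
      unfolding I_def using il k1 that by (auto simp: I1 fun_eq_iff)
    then show ?case
      using k1 fr N ss[OF il] I1 by (auto simp: numeral_2_eq_2[symmetric] i_def[symmetric])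
  next
    case (3 \<sigma>1 k1)
    have fr: "nmem \<sigma>1 1 = nmem \<sigma> 1"
      using 3(1) by (auto simp: frame_def)
    have "nmem \<sigma>1 19 0 = length ss" using 3(2,3) fr len by (simp add: I_def)
    with 3(2) kK show ?case
      by (auto simp: I_def numeral_2_eq_2[symmetric] a_def)
  qed
  then show ?thesis
    using k N by (auto simp: read_sets_def numeral_2_eq_2[symmetric] a_def)
qed

text \<open>Segments lie in the pool in the order of creation, so a new one begins beyond all others
  and writing it destroys none.\<close>

lemma start_mono:
  assumes "sys \<sigma>" "t < nmem \<sigma> 14 0"
  shows "nmem \<sigma> 5 (Suc t) \<le> nmem \<sigma> 5 (nmem \<sigma> 14 0)"
proof -
  have "Suc t \<le> i \<Longrightarrow> i \<le> nmem \<sigma> 14 0 \<Longrightarrow> nmem \<sigma> 5 (Suc t) \<le> nmem \<sigma> 5 i" for i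
  proof (induction i rule: dec_induct)
    case (step i)
    then have "nmem \<sigma> 5 i < nmem \<sigma> 5 (Suc i)" using assms(1) by (auto simp: sys_def)
    then show ?case using step by simp
  qed simp
  then show ?thesis using assms(2) by simp
qed

text \<open>With weight 0 the new element changes no load and can join the queue while all other
  parts of the invariant carry over.\<close>

lemma ready_new:
  assumes re: "ready 0 L {} \<sigma>" and lk: "link X \<sigma>" and N: "N = nmem \<sigma> 14 0"
    and ss: "distinct ss" "ss \<noteq> []" "set ss \<subseteq> {..<m}" "length ss \<le> f" and e: "e \<notin> fst X"
    and n: "card (insert e (fst X)) \<le> n"
    and eq: "nmem \<sigma>' 5 = (nmem \<sigma> 5)(Suc N := nmem \<sigma> 5 N + length ss)"
      "nmem \<sigma>' 4 = (\<lambda>i. if nmem \<sigma> 5 N \<le> i \<and> i < nmem \<sigma> 5 N + length ss then ss ! (i - nmem \<sigma> 5 N) else nmem \<sigma> 4 i)"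
      "nmem \<sigma>' 14 0 = Suc N" "nmem \<sigma>' 10 = (nmem \<sigma> 10)(e := N)" "nmem \<sigma>' 6 = (nmem \<sigma> 6)(N := 1)"
      "nmem \<sigma>' 7 = (nmem \<sigma> 7)(N := 0)" "rmem \<sigma>' 3 = (rmem \<sigma> 3)(N := 0)"
      "\<And>a. a \<notin> {1, 4, 5, 6, 7, 10, 14, 18, 19} \<Longrightarrow> nmem \<sigma>' a = nmem \<sigma> a" "\<And>a. a \<noteq> 3 \<Longrightarrow> rmem \<sigma>' a = rmem \<sigma> a"
  shows "ready 0 L {N} \<sigma>'" "link (apply_update (Insert e ss) X) \<sigma>'" "SS \<sigma>' N = set ss"
    "\<And>t. t < N \<Longrightarrow> SS \<sigma>' t = SS \<sigma> t"
proof -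
  have pr: "prm \<sigma>" and sy: "sys \<sigma>" and li: "lists L {} \<sigma>" and we: "weights L {} \<sigma>" and se: "sets 0 L \<sigma>"
    and co: "\<And>i. count L \<sigma> i"
    using re by (auto simp: ready_def mid_def)
  have e': "nmem \<sigma>' 2 = nmem \<sigma> 2" "nmem \<sigma>' 3 = nmem \<sigma> 3" "nmem \<sigma>' 8 = nmem \<sigma> 8" "nmem \<sigma>' 9 = nmem \<sigma> 9"
    "nmem \<sigma>' 11 = nmem \<sigma> 11" "nmem \<sigma>' 12 = nmem \<sigma> 12" "nmem \<sigma>' 13 = nmem \<sigma> 13" "nmem \<sigma>' 15 = nmem \<sigma> 15"
    "rmem \<sigma>' 0 = rmem \<sigma> 0" "rmem \<sigma>' 1 = rmem \<sigma> 1" "rmem \<sigma>' 2 = rmem \<sigma> 2"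
    using eq(8,9) by simp_all
  let ?a = "nmem \<sigma> 5 N"
  have pool: "nmem \<sigma>' 4 i = nmem \<sigma> 4 i" if "t < N" "i < nmem \<sigma> 5 (Suc t)" for i t
    using start_mono[OF sy, of t] that N by (simp add: eq(2))
  have st: "nmem \<sigma>' 5 t = nmem \<sigma> 5 t" "nmem \<sigma>' 5 (Suc t) = nmem \<sigma> 5 (Suc t)" if "t < N" for t
    using that by (simp_all add: eq(1))
  show SSo: "SS \<sigma>' t = SS \<sigma> t" if "t < N" for t
    unfolding SS_def st[OF that] by (rule image_cong) (use pool[OF that] in auto)
  have seg: "nmem \<sigma>' 5 N = ?a" "nmem \<sigma>' 5 (Suc N) = ?a + length ss"
    by (simp_all add: eq(1))
  have img: "nmem \<sigma>' 4 (?a + i) = ss ! i" if "i < length ss" for i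
    using that by (simp add: eq(2))
  have segset: "{?a..<?a + length ss} = (\<lambda>i. ?a + i) ` {..<length ss}"
    using image_add_atLeastLessThan[of ?a 0 "length ss"] by (simp add: lessThan_atLeast0 add.commute)
  show SSn: "SS \<sigma>' N = set ss"
    unfolding SS_def seg segset image_image by (auto simp: img set_conv_nth)
  have sy': "sys \<sigma>'"
    unfolding sys_def eq(3)
  proof (intro allI impI)
    fix t assume "t < Suc N"
    then consider "t < N" | "t = N" by linarith
    then show "nmem \<sigma>' 5 t < nmem \<sigma>' 5 (Suc t) \<and> nmem \<sigma>' 5 (Suc t) \<le> nmem \<sigma>' 5 t + f \<and>
         inj_on (nmem \<sigma>' 4) {nmem \<sigma>' 5 t..<nmem \<sigma>' 5 (Suc t)} \<and> SS \<sigma>' t \<subseteq> {..<m}"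
    proof cases
      case 1
      have old: "nmem \<sigma> 5 t < nmem \<sigma> 5 (Suc t)" "nmem \<sigma> 5 (Suc t) \<le> nmem \<sigma> 5 t + f"
        "inj_on (nmem \<sigma> 4) {nmem \<sigma> 5 t..<nmem \<sigma> 5 (Suc t)}" "SS \<sigma> t \<subseteq> {..<m}"
        using sy 1 N by (auto simp: sys_def)
      have "inj_on (nmem \<sigma>' 4) {nmem \<sigma> 5 t..<nmem \<sigma> 5 (Suc t)} = inj_on (nmem \<sigma> 4) {nmem \<sigma> 5 t..<nmem \<sigma> 5 (Suc t)}"
        by (rule inj_on_cong) (use pool[OF 1] in auto)
      then show ?thesis using old unfolding st[OF 1] SSo[OF 1] by simp
    next
      case 2
      have "inj_on (nmem \<sigma>' 4) {?a..<?a + length ss}"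
        unfolding segset by (rule inj_on_imageI) (use ss(1) img in \<open>auto simp: inj_on_def nth_eq_iff_index_eq\<close>)
      then show ?thesis using 2 ss SSn by (simp add: seg)
    qed
  qed
  have LN: "t < N" if "t \<in> set (L j)" for t j using li that N by (auto simp: lists_def)
  have li': "lists L {N} \<sigma>'"
    unfolding lists_def e' eq(3)
  proof (intro conjI allI ballI impI, goal_cases)
    case (1 j) then show ?case using li by (simp add: lists_def)
  next
    case (2 j) then show ?case using li by (simp add: lists_def)
  next
    case (3 j t) then show ?case using LN[of t j] by simp
  next
    case (4 j t) then show ?case using li by (simp add: lists_def)
  next
    case (5 t) then show ?case by simp
  next
    case (6 t) then show ?case by (simp add: eq(5))
  next
    case (7 t j) then show ?case using LN[of N j] by auto
  next
    case (8 t) then show ?case using li N by (auto simp: lists_def eq(5) less_Suc_eq)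
  next
    case (9 t) then show ?case using li N by (auto simp: lists_def eq(6) less_Suc_eq)
  qed
  have ld: "load \<sigma>' (rmem \<sigma>' 3) s = load \<sigma> (rmem \<sigma> 3) s" for s
    unfolding load_def
    by (rule sum.mono_neutral_cong_right) (use SSo N in \<open>auto simp: eq(3,7) less_Suc_eq\<close>)
  have we': "weights L {N} \<sigma>'"
    unfolding weights_def eq(3) e' wsum_def ld
  proof (intro conjI allI ballI impI, goal_cases)
    case (1 s) then show ?case using we by (simp add: weights_def wsum_def)
  next
    case (2 s) then show ?case using we by (simp add: weights_def)
  next
    case (3 t) then show ?case using we N by (auto simp: weights_def eq(7) less_Suc_eq)
  next
    case (4 j t) then show ?case using we LN[of t j] by (simp add: weights_def eq(7))
  next
    case (5 j t)
    then have "t \<noteq> N" using LN[of t j] by simp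
    then show ?case using we 5 by (simp add: weights_def eq(5,6,7))
  next
    case (6 t) then show ?case using we N by (auto simp: weights_def eq(7) less_Suc_eq)
  qed
  have tg: "tight \<sigma>' = tight \<sigma>" by (rule tight_cong) (simp add: e')
  have se': "sets 0 L \<sigma>'"
    unfolding sets_def e' tg
  proof (intro conjI allI ballI impI, goal_cases)
    case (1 s) then show ?case using se by (simp add: sets_def)
  next
    case (2 s) then show ?case using se by (simp add: sets_def)
  next
    case (3 s) then show ?case using se by (simp add: sets_def)
  next
    case (4 s) then show ?case using se by (simp add: sets_def)
  next
    case (5 j t s) then show ?case using se SSo[OF LN[of t j]] by (simp add: sets_def)
  next
    case (6 j t)
    then have "nmem \<sigma> 6 t \<noteq> 0" using LN[of t j] by (simp add: eq(5))
    then have "\<exists>s\<in>SS \<sigma> t. nmem \<sigma> 2 s \<noteq> 0 \<and> nmem \<sigma> 3 s = j" using se 6 unfolding sets_def by blast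
    then show ?case using SSo[OF LN[of t j]] 6 by simp
  qed
  have co': "count L \<sigma>' i" for i
  proof -
    have "{t \<in> set (L i). nmem \<sigma>' 6 t \<noteq> 0 \<and> nmem \<sigma>' 7 t \<noteq> 0} = {t \<in> set (L i). nmem \<sigma> 6 t \<noteq> 0 \<and> nmem \<sigma> 7 t \<noteq> 0}"
      "{t \<in> set (L i). nmem \<sigma>' 6 t = 0} = {t \<in> set (L i). nmem \<sigma> 6 t = 0}"
      using LN[of _ i] by (auto simp: eq(5,6))
    then show ?thesis using co[of i] by (simp add: count_def e')
  qed
  show lk': "link (apply_update (Insert e ss) X) \<sigma>'"
    unfolding link_def eq(3)
  proof (intro conjI, goal_cases)
    case 1 show ?case using lk by (simp add: link_def)
  next
    case 2
    have "N \<notin> nmem \<sigma> 10 ` fst X" using lk N by (auto simp: link_def)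
    then show ?case using lk e by (auto simp: link_def eq(4) inj_on_def)
  next
    case 3
    have eF: "e \<notin> snd X s" for s using lk e by (auto simp: link_def)
    show ?case
    proof
      fix d assume d: "d \<in> fst (apply_update (Insert e ss) X)"
      show "nmem \<sigma>' 10 d < Suc N \<and> nmem \<sigma>' 6 (nmem \<sigma>' 10 d) \<noteq> 0 \<and>
        SS \<sigma>' (nmem \<sigma>' 10 d) = {s. d \<in> snd (apply_update (Insert e ss) X) s}"
      proof (cases "d = e")
        case True
        then show ?thesis using SSn eF by (auto simp: eq(4,5))
      next
        case False
        then have dX: "d \<in> fst X" using d by simp
        then have "nmem \<sigma> 10 d < N" "nmem \<sigma> 6 (nmem \<sigma> 10 d) \<noteq> 0" "SS \<sigma> (nmem \<sigma> 10 d) = {s. d \<in> snd X s}"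
          using lk N by (auto simp: link_def)
        then show ?thesis using False SSo[of "nmem \<sigma> 10 d"] by (auto simp: eq(4,5))
      qed
    qed
  next
    case 4
    show ?case
    proof (intro allI impI)
      fix t assume t: "t < Suc N" "nmem \<sigma>' 6 t \<noteq> 0"
      show "t \<in> nmem \<sigma>' 10 ` fst (apply_update (Insert e ss) X)"
      proof (cases "t = N")
        case True then show ?thesis by (auto simp: eq(4))
      next
        case False
        then have "t \<in> nmem \<sigma> 10 ` fst X" using t lk N by (auto simp: link_def eq(5))
        then obtain d where "d \<in> fst X" "t = nmem \<sigma> 10 d" by auto
        then show ?thesis using e by (intro image_eqI[of _ _ d]) (auto simp: eq(4))
      qed
    qed
  next
    case 5 show ?case using lk by (auto simp: link_def)
  qed
  have "card {t. t < nmem \<sigma>' 14 0 \<and> nmem \<sigma>' 6 t \<noteq> 0} \<le> n"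
    using link_card(2)[OF lk'] n by simp
  moreover have "prm \<sigma>'" using pr unfolding prm_def e' .
  moreover have "\<forall>j>nmem \<sigma> 15 0. L j = []" "nmem \<sigma> 15 0 \<le> B" using re by (simp_all add: ready_def)
  ultimately show "ready 0 L {N} \<sigma>'"
    unfolding ready_def mid_def e'(8) using sy' li' we' se' co' by (meson le0 le_trans not_less0)
qed

text \<open>At worst the new element is passive at level 0.\<close>

lemma potential_insert:
  assumes "nmem \<sigma>' 14 0 = Suc (nmem \<sigma> 14 0)" "nmem \<sigma>' 13 = nmem \<sigma> 13" "nmem \<sigma>' 15 0 = nmem \<sigma> 15 0"
    and "\<And>t. t < nmem \<sigma> 14 0 \<Longrightarrow> nmem \<sigma>' 6 t = nmem \<sigma> 6 t \<and> nmem \<sigma>' 7 t = nmem \<sigma> 7 t \<and> nmem \<sigma>' 8 t = nmem \<sigma> 8 t"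
  shows "potential \<sigma>' \<le> potential \<sigma> + 4 * (u * (B + 5))"
proof -
  let ?A = "{t. t < nmem \<sigma> 14 0 \<and> nmem \<sigma> 6 t \<noteq> 0 \<and> nmem \<sigma> 7 t = 0}"
  have "(\<Sum>t | t < nmem \<sigma>' 14 0 \<and> nmem \<sigma>' 6 t \<noteq> 0 \<and> nmem \<sigma>' 7 t = 0. passive_potential \<sigma>' t) \<le>
      (\<Sum>t\<in>insert (nmem \<sigma> 14 0) ?A. passive_potential \<sigma>' t)"
    by (rule sum_mono2) (use assms in \<open>auto simp: less_Suc_eq\<close>)
  also have "\<dots> = passive_potential \<sigma>' (nmem \<sigma> 14 0) + (\<Sum>t\<in>?A. passive_potential \<sigma>' t)"
    by (rule sum.insert) auto
  also have "(\<Sum>t\<in>?A. passive_potential \<sigma>' t) = (\<Sum>t\<in>?A. passive_potential \<sigma> t)"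
    by (rule sum.cong) (use assms in \<open>auto simp: passive_potential_def\<close>)
  also have "passive_potential \<sigma>' (nmem \<sigma> 14 0) \<le> 4 * (u * (B + 5))"
  proof -
    have "u * (3 * (B + 1 - nmem \<sigma>' 8 (nmem \<sigma> 14 0)) + B + 5) \<le> u * (4 * (B + 5))"
      by (rule mult_le_mono2) simp
    then show ?thesis by (simp add: passive_potential_def)
  qed
  finally show ?thesis
    using assms(2,3) by (simp add: potential_def PD_def)
qed

text \<open>An insertion adds no deleted element, and the old active ones keep their flags and
  levels, so active counts can only grow.\<close>

lemma balanced_insert:
  assumes "balanced \<sigma>" "lists L {} \<sigma>" "\<forall>i. count L \<sigma> i" "lists L' {} \<sigma>'" "\<forall>i. count L' \<sigma>' i"
    and "nmem \<sigma>' 14 0 = Suc (nmem \<sigma> 14 0)" "nmem \<sigma>' 13 = nmem \<sigma> 13"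
    and "\<And>t. t < nmem \<sigma> 14 0 \<Longrightarrow> nmem \<sigma>' 6 t = nmem \<sigma> 6 t \<and> nmem \<sigma>' 7 t = nmem \<sigma> 7 t \<and> nmem \<sigma>' 8 t = nmem \<sigma> 8 t"
  shows "balanced \<sigma>'"
  unfolding balanced_def
proof
  fix i
  have "PA \<sigma> i \<le> PA \<sigma>' i"
    unfolding PA_card[OF assms(2,3)] PA_card[OF assms(4,5)] by (rule card_mono) (use assms(6,8) in auto)
  then have "x * real (PA \<sigma> i) \<le> x * real (PA \<sigma>' i)" using x_pos by simp
  moreover have "PD \<sigma>' i = PD \<sigma> i" using assms(7) by (simp add: PD_def)
  moreover have "real (PD \<sigma> i) \<le> x * real (PA \<sigma> i)" using assms(1) by (simp add: balanced_def)
  ultimately show "real (PD \<sigma>' i) \<le> x * real (PA \<sigma>' i)" by simp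
qed

text \<open>In neither case does the top level rise: a positive \<open>l\<close> is the level of an
  existing set, and settling from level 0 uses no other level. The latter is a single round, since
  weight 1 already exhausts every cost.\<close>

lemma wp_insert_element:
  assumes inv: "inv X \<sigma>" and pw0: "rmem \<sigma> 4 0 = 1"
    and inp: "nmem \<sigma> 1 1 = e" "nmem \<sigma> 1 2 = length ss" "\<And>i. i < length ss \<Longrightarrow> nmem \<sigma> 1 (i + 3) = ss ! i"
    and ss: "distinct ss" "ss \<noteq> []" "set ss \<subseteq> {..<m}" "length ss \<le> f" and e: "e \<notin> fst X"
    and n: "card (insert e (fst X)) \<le> n"
    and k: "potential \<sigma> + update_cost \<le> k"
  shows "wp insert_element (\<lambda>\<sigma>' k'. inv (apply_update (Insert e ss) X) \<sigma>' \<and>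
      k + potential \<sigma>' \<le> k' + potential \<sigma> + update_cost) \<sigma> k"
proof -
  obtain L where re: "ready 0 L {} \<sigma>" using inv by (auto simp: inv_def)
  have pwT: "pw_upto (nmem \<sigma> 15 0) \<sigma>" and ba: "balanced \<sigma>" and lk: "link X \<sigma>" using inv by (auto simp: inv_def)
  have li: "lists L {} \<sigma>" and co: "\<forall>i. count L \<sigma> i" using re by (auto simp: ready_def mid_def)
  define N where "N = nmem \<sigma> 14 0"
  have f: "1 \<le> f" using ss(2,4) by (cases ss) auto
  have uB: "5000 * f \<le> u * (B + 5)"
  proof -
    have "u * 5 \<le> u * (B + 5)" by (rule mult_le_mono2) simp
    then show ?thesis by (simp add: u_def)
  qed
  have uc: "10 * (u * (B + 5)) \<le> update_cost"
    unfolding update_cost_def by simp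
  have k1: "potential \<sigma> + 10 * (u * (B + 5)) \<le> k" using k uc by simp
  define U where "U = u * (B + 5)"
  note uB = uB[folded U_def] and uc = uc[folded U_def] and k1 = k1[folded U_def]
  let ?X = "apply_update (Insert e ss) X"
  let ?post = "\<lambda>\<sigma>' k'. inv ?X \<sigma>' \<and> k + potential \<sigma>' \<le> k' + potential \<sigma> + update_cost"
  have fin: "?post \<sigma>' k'" if re': "ready 0 L' {} \<sigma>'" and lk': "link ?X \<sigma>'"
    and pw': "rmem \<sigma>' 4 = rmem \<sigma> 4" and T': "nmem \<sigma>' 15 0 = nmem \<sigma> 15 0" and N': "nmem \<sigma>' 14 0 = Suc N"
    and D': "nmem \<sigma>' 13 = nmem \<sigma> 13"
    and old: "\<And>t. t < N \<Longrightarrow> nmem \<sigma>' 6 t = nmem \<sigma> 6 t \<and> nmem \<sigma>' 7 t = nmem \<sigma> 7 t \<and> nmem \<sigma>' 8 t = nmem \<sigma> 8 t"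
    and k': "k \<le> k' + 2 * U" for L' \<sigma>' k'
  proof -
    have "balanced \<sigma>'"
      by (rule balanced_insert[OF ba li co, of L' \<sigma>']) (use re' N' D' old in \<open>auto simp: ready_def mid_def N_def\<close>)
    moreover have "pw_upto (nmem \<sigma>' 15 0) \<sigma>'" using pwT by (simp add: pw_upto_def pw' T')
    moreover have "potential \<sigma>' \<le> potential \<sigma> + 4 * U"
      unfolding U_def by (rule potential_insert) (use N' D' T' old in \<open>auto simp: N_def\<close>)
    ultimately show ?thesis using re' lk' k' uc by (auto simp: inv_def)
  qed
  have klen: "60 * length ss + 60 \<le> k" using ss(4) f uB k1 by simp
  let ?rest = "Cond (NLess (NConst 0) (NV 20)) place
                     (Seq (NWrite 9 (NV 18) (NConst 0))
                       (Seq (NSet 16 (NAdd (NV 18) (NConst 1)))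
                         (Seq (NSet 21 (NConst 0)) settle)))"
  let ?tail = "Seq (NSet 18 (NV 14))
       (Seq (NSet 14 (NAdd (NV 14) (NConst 1)))
         (Seq (NWrite 10 (NRead 1 (NConst 1)) (NV 18))
           (Seq (NWrite 6 (NV 18) (NConst 1))
             (Seq (NWrite 7 (NV 18) (NConst 0))
               (Seq (RWrite 3 (NV 18) (ROfNat (NConst 0)))
                 (Seq max_level ?rest))))))"
  have "wp read_sets (wp ?tail ?post) \<sigma> k"
  proof (rule wp_mono_frame[OF wp_read_sets[OF N_def[symmetric] inp(2,3) klen]], goal_cases)
    case (1 i) then show ?case .
  next
    case (2 \<sigma>1 k2)
    have fr1: "a \<notin> {4, 5, 19} \<Longrightarrow> nmem \<sigma>1 a = nmem \<sigma> a" "rmem \<sigma>1 = rmem \<sigma>" for a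
      using 2(1) by (auto simp: frame_def)
    define \<sigma>2 where "\<sigma>2 = rset 3 N 0 (nset 7 N 0 (nset 6 N 1 (nset 10 e N (nset 14 0 (Suc N) (nset 18 0 N \<sigma>1)))))"
    have e2: "nmem \<sigma>2 5 = (nmem \<sigma> 5)(Suc N := nmem \<sigma> 5 N + length ss)"
      "nmem \<sigma>2 4 = (\<lambda>i. if nmem \<sigma> 5 N \<le> i \<and> i < nmem \<sigma> 5 N + length ss then ss ! (i - nmem \<sigma> 5 N) else nmem \<sigma> 4 i)"
      "nmem \<sigma>2 14 0 = Suc N" "nmem \<sigma>2 10 = (nmem \<sigma> 10)(e := N)" "nmem \<sigma>2 6 = (nmem \<sigma> 6)(N := 1)"
      "nmem \<sigma>2 7 = (nmem \<sigma> 7)(N := 0)" "rmem \<sigma>2 3 = (rmem \<sigma> 3)(N := 0)"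
      "\<And>a. a \<notin> {1, 4, 5, 6, 7, 10, 14, 18, 19} \<Longrightarrow> nmem \<sigma>2 a = nmem \<sigma> a" "\<And>a. a \<noteq> 3 \<Longrightarrow> rmem \<sigma>2 a = rmem \<sigma> a"
      "nmem \<sigma>2 18 0 = N"
      using 2(3) fr1 by (auto simp: \<sigma>2_def)
    note new = ready_new[OF re lk N_def ss e n e2(1-9)]
    have re2: "ready 0 L {N} \<sigma>2" by (rule new(1))
    have sy2: "sys \<sigma>2" and li2: "lists L {N} \<sigma>2" and we2: "weights L {N} \<sigma>2" and se2: "sets 0 L \<sigma>2"
      and co2: "\<forall>i. count L \<sigma>2 i" and pr2: "prm \<sigma>2"
      using re2 by (auto simp: ready_def mid_def)
    have kf: "k \<le> k2 + 120 * f" using 2(3) ss(4) f by simp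
    have km: "80 * f \<le> k2 - 28" using kf uB k1 f by simp
    have "wp max_level (wp ?rest ?post) \<sigma>2 (k2 - 28)"
    proof (rule wp_mono_frame[OF wp_max_level[OF sy2 e2(10) _ km]], goal_cases)
      case 1 show ?case by (simp add: e2)
    next
      case (2 \<sigma>3 k3)
      have fr3: "a \<notin> {19, 20} \<Longrightarrow> nmem \<sigma>3 a = nmem \<sigma>2 a" "rmem \<sigma>3 = rmem \<sigma>2" for a
        using 2(1) by (auto simp: frame_def)
      have S3: "SS \<sigma>3 = SS \<sigma>2" by (rule SS_cong) (simp_all add: fr3)
      have tg3: "tight \<sigma>3 = tight \<sigma>2" by (rule tight_cong) (simp add: fr3)
      define l where "l = nmem \<sigma>3 20 0"
      have lev: "\<forall>s\<in>SS \<sigma>2 N. nmem \<sigma>2 3 s \<le> l" and lev': "l = 0 \<or> (\<exists>s\<in>SS \<sigma>2 N. nmem \<sigma>2 3 s = l)"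
        and k3: "k2 - 28 \<le> k3 + 80 * f"
        using 2(3) by (auto simp: l_def)
      have kf3: "k \<le> k3 + 240 * f" using kf k3 f by simp
      have k3big: "2000 * f \<le> k3" using kf3 uB k1 f by simp
      have lk3: "link ?X \<sigma>3" by (rule link_cong[OF new(2)]) (simp_all add: fr3)
      show ?case
      proof (cases "l = 0")
        case False
        have p80: "80 \<le> k3 - 5" using k3big f by simp
        have "wp place ?post \<sigma>3 (k3 - 5)"
        proof (rule wp_mono_frame[OF wp_place[OF _ _ p80, of \<sigma>3 N l]], goal_cases)
          case 1 show ?case by (simp add: fr3 e2(10))
        next
          case 2 show ?case by (simp add: l_def)
        next
          case (3 \<sigma>4 k4)
          have fr4: "a \<notin> {8, 9, 11, 12, 15, 19, 20} \<Longrightarrow> nmem \<sigma>4 a = nmem \<sigma>2 a" "rmem \<sigma>4 = rmem \<sigma>2" for a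
            using 3(1) fr3 by (auto simp: frame_def)
          have e4: "nmem \<sigma>4 9 = (nmem \<sigma>2 9)(N := nmem \<sigma>2 11 l)" "nmem \<sigma>4 11 = (nmem \<sigma>2 11)(l := Suc N)"
            "nmem \<sigma>4 8 = (nmem \<sigma>2 8)(N := l)" "nmem \<sigma>4 12 = (nmem \<sigma>2 12)(l := nmem \<sigma>2 12 l + nmem \<sigma>2 7 N)"
            "nmem \<sigma>4 15 0 = max (nmem \<sigma>2 15 0) l" "k3 - 5 \<le> k4 + 80"
            using 3(3) fr3 by simp_all
          obtain s where s: "s \<in> SS \<sigma>2 N" "nmem \<sigma>2 3 s = l" using lev' False by auto
          have lT: "l \<le> nmem \<sigma>2 15 0" using s se2 by (auto simp: sets_def)
          have T4: "nmem \<sigma>4 15 0 = nmem \<sigma>2 15 0" using e4(5) lT by simp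
          have S4: "SS \<sigma>4 = SS \<sigma>2" by (rule SS_cong) (simp_all add: fr4)
          have tg4: "tight \<sigma>4 = tight \<sigma>2" by (rule tight_cong) (simp add: fr4)
          let ?L = "L(l := N # L l)"
          have "lists ?L ({N} - {N}) \<sigma>4" by (rule lists_place[OF li2]) (use e4 fr4 in auto)
          moreover have "weights ?L ({N} - {N}) \<sigma>4"
            by (rule weights_place[OF we2]) (use e4 fr4 S4 in \<open>auto simp: e2 less_imp_le\<close>)
          moreover have "\<forall>i. count ?L \<sigma>4 i"
            by (rule count_place[OF li2 _ co2]) (use e4 fr4 in auto)
          moreover have "sets 0 ?L \<sigma>4"
            unfolding sets_def S4 tg4 T4
          proof (intro conjI allI ballI impI, goal_cases)
            case (1 v) then show ?case using se2 fr4 by (simp add: sets_def)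
          next
            case (2 v) then show ?case using se2 fr4 by (simp add: sets_def)
          next
            case (3 v) then show ?case using se2 fr4 by (simp add: sets_def)
          next
            case (4 v) then show ?case using se2 fr4 by (simp add: sets_def)
          next
            case (5 j t v)
            then have "nmem \<sigma>2 3 v \<le> j" using lev se2 by (auto simp: sets_def split: if_splits)
            then show ?case using fr4 by simp
          next
            case (6 j t)
            show ?case
            proof (cases "t = N \<and> j = l")
              case True
              have "nmem \<sigma>2 2 s \<noteq> 0" using s False se2 by (auto simp: sets_def)
              then show ?thesis using True s fr4(1) by (intro bexI[of _ s]) auto
            next
              case F: False
              then have "t \<in> set (L j)" using 6(2) by (auto split: if_splits)
              moreover have "nmem \<sigma>2 6 t \<noteq> 0" using 6(3) fr4(1)[of 6] by simp
              ultimately have "\<exists>s\<in>SS \<sigma>2 t. nmem \<sigma>2 2 s \<noteq> 0 \<and> nmem \<sigma>2 3 s = j"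
                using se2 6(1) unfolding sets_def by blast
              then show ?thesis using fr4(1)[of 2] fr4(1)[of 3] by simp
            qed
          qed
          moreover have "prm \<sigma>4" "sys \<sigma>4"
            using pr2 sy2 fr4 by (simp_all add: prm_def sys_cong[of \<sigma>4 \<sigma>2])
          moreover have "\<forall>j>nmem \<sigma>2 15 0. ?L j = []" "nmem \<sigma>2 15 0 \<le> B" "card {t. t < nmem \<sigma>2 14 0 \<and> nmem \<sigma>2 6 t \<noteq> 0} \<le> n"
            using re2 lT by (auto simp: ready_def)
          ultimately have re4: "ready 0 ?L {} \<sigma>4"
            unfolding ready_def mid_def T4 using fr4(1)[of 14] fr4(1)[of 6] by simp
          show ?case
          proof (rule fin[OF re4])
            show "link ?X \<sigma>4" by (rule link_cong[OF new(2)]) (simp_all add: fr4)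
            show "k \<le> k4 + 2 * U" using kf3 e4(6) uB f by simp
            show "nmem \<sigma>4 6 t = nmem \<sigma> 6 t \<and> nmem \<sigma>4 7 t = nmem \<sigma> 7 t \<and> nmem \<sigma>4 8 t = nmem \<sigma> 8 t" if "t < N" for t
              using that by (simp add: fr4 e2 e4)
          qed (simp_all add: fr4 e2 T4)
        qed
        then show ?thesis using False k3big f by (simp add: l_def numeral_2_eq_2[symmetric])
      next
        case True
        let ?\<sigma>4 = "nset 21 0 0 (nset 16 0 (Suc N) (nset 9 N 0 \<sigma>3))"
        have NL: "N \<notin> set (L j)" for j using li2 by (auto simp: lists_def)
        have re4: "ready 0 L (set [N]) ?\<sigma>4"
          by (rule ready_cong[of 0 L "set [N]" \<sigma>2]) (use re2 fr3 NL in auto)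
        have lev4: "nmem ?\<sigma>4 3 s = 0" if "s \<in> SS ?\<sigma>4 N" for s
          using lev True that S3 fr3 by simp
        have set4: "300 * f * length [N] + 500 * f * ((0 + 1) * length [N]) + 100 * (0 + 2) \<le> k3 - 18"
          using k3big f by simp
        have "wp settle ?post ?\<sigma>4 (k3 - 18)"
        proof (rule wp_mono_frame[OF wp_settle[OF re4 _ _ _ _ _ _ set4]], goal_cases)
          case 1 show ?case by simp
        next
          case 2 show ?case by simp
        next
          case 3 show ?case by simp
        next
          case (4 j) then show ?case using pw0 by (simp add: fr3 e2)
        next
          case (5 t) then show ?case by (simp add: fr3 e2)
        next
          case (6 t s) then show ?case using lev4 by simp
        next
          case (7 \<sigma>5 k5)
          have fr5: "a \<notin> {2, 3, 7, 8, 9, 11, 12, 15, 16, 17, 18, 19, 20, 21, 22, 23} \<Longrightarrow> nmem \<sigma>5 a = nmem \<sigma>2 a"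
            "rmem \<sigma>5 4 = rmem \<sigma>2 4" for a
            using 7(1) fr3 by (auto simp: frame_def)
          obtain L5 where re5: "ready 0 L5 {} \<sigma>5" using 7(3) by blast
          have out5: "nmem \<sigma>5 8 t = nmem \<sigma>2 8 t \<and> nmem \<sigma>5 7 t = nmem \<sigma>2 7 t" if "t \<noteq> N" for t
            using 7(3) that fr3 by simp
          have T5: "nmem \<sigma>5 15 0 = nmem \<sigma>2 15 0" using 7(3) fr3 by simp
          have k5: "k3 - 18 \<le> k5 + 1000 * f"
            using 7(3) f by (auto split: if_splits)
          show ?case
          proof (rule fin[OF re5])
            show "link ?X \<sigma>5" by (rule link_cong[OF new(2)]) (simp_all add: fr5)
            show "k \<le> k5 + 2 * U" using kf3 k5 uB f by simp
            show "nmem \<sigma>5 6 t = nmem \<sigma> 6 t \<and> nmem \<sigma>5 7 t = nmem \<sigma> 7 t \<and> nmem \<sigma>5 8 t = nmem \<sigma> 8 t" if "t < N" for t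
              using that out5[of t] by (simp add: fr5 e2)
          qed (simp_all add: fr5 e2 T5)
        qed
        moreover have "100 \<le> k3" using k3big f by simp
        ultimately show ?thesis using True fr3(1)[of 18] e2(10)
          by (auto simp: l_def numeral_2_eq_2[symmetric])
      qed
    qed
    moreover have "100 \<le> k2" using kf uB k1 f by simp
    moreover have "nmem \<sigma>1 (Suc 0) (Suc 0) = e" using fr1(1)[of 1] inp by simp
    ultimately show ?case
      using fr1(1)[of 14] unfolding \<sigma>2_def
      by (auto simp: numeral_2_eq_2[symmetric] N_def[symmetric])
  qed
  then show ?thesis by (simp add: insert_element_def)
qed

section \<open>Approximation ratio\<close>

text \<open>The partial sums of \<open>x * a l - d l\<close> are nonnegative and \<open>p\<close>
  decreases, so by induction each sum weighted with \<open>p\<close> is at least the last weight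
  \<open>p i\<close> times the plain partial sum.\<close>

lemma abel_bound:
  fixes a d :: "nat \<Rightarrow> real"
  assumes pre: "\<And>i. (\<Sum>l<i. d l) \<le> x * (\<Sum>l<i. a l)"
  shows "(\<Sum>l<i. d l * p l) \<le> x * (\<Sum>l<i. a l * p l)"
proof -
  define y where "y l = x * a l - d l" for l
  have Y: "0 \<le> (\<Sum>l<i. y l)" for i
    using pre[of i] by (simp add: y_def sum_subtractf sum_distrib_left)
  have "p i * (\<Sum>l<Suc i. y l) \<le> (\<Sum>l<Suc i. y l * p l)" for i
  proof (induction i)
    case (Suc i)
    have "p (Suc i) * (\<Sum>l<Suc i. y l) \<le> p i * (\<Sum>l<Suc i. y l)"
      by (rule mult_right_mono[OF p_antimono Y]) simp
    with Suc show ?case by (simp add: algebra_simps)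
  qed (simp add: algebra_simps)
  then have "0 \<le> (\<Sum>l<Suc i. y l * p l)" for i
    by (meson Y less_imp_le mult_nonneg_nonneg order_trans p_pos)
  then have "0 \<le> (\<Sum>l<i. y l * p l)"
    by (cases i) auto
  then show ?thesis
    by (simp add: y_def left_diff_distrib sum_subtractf sum_distrib_left mult.assoc)
qed

lemma lists_sum:
  fixes g :: "nat \<Rightarrow> real"
  assumes li: "lists L Q \<sigma>"
  shows "(\<Sum>t | \<exists>l<i. t \<in> set (L l) \<and> P t. g t) = (\<Sum>l<i. \<Sum>t | t \<in> set (L l) \<and> P t. g t)"
proof -
  have "(\<Sum>t\<in>(\<Union>l\<in>{..<i}. {t. t \<in> set (L l) \<and> P t}). g t) = (\<Sum>l<i. \<Sum>t | t \<in> set (L l) \<and> P t. g t)"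
  proof (rule sum.UNION_disjoint)
    show "\<forall>a\<in>{..<i}. \<forall>b\<in>{..<i}. a \<noteq> b \<longrightarrow> {t. t \<in> set (L a) \<and> P t} \<inter> {t. t \<in> set (L b) \<and> P t} = {}"
    proof (intro ballI impI)
      fix a b :: nat assume ab: "a \<noteq> b"
      have e: "nmem \<sigma> 8 t = l" if "t \<in> set (L l)" for t l using li that by (simp add: lists_def)
      show "{t. t \<in> set (L a) \<and> P t} \<inter> {t. t \<in> set (L b) \<and> P t} = {}"
        using e[of _ a] e[of _ b] ab by fastforce
    qed
  qed auto
  moreover have "(\<Union>l\<in>{..<i}. {t. t \<in> set (L l) \<and> P t}) = {t. \<exists>l<i. t \<in> set (L l) \<and> P t}" by auto
  ultimately show ?thesis by simp
qed

text \<open>A deleted element at level \<open>l\<close> weighs at most \<open>p l\<close>, a live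
  active one exactly \<open>p l\<close>; with the counters as coefficients this is the situation of
  \<open>abel_bound\<close>. Passive elements only add to the right-hand side.\<close>

lemma dead_weight:
  assumes re: "ready 0 L {} \<sigma>" and ba: "balanced \<sigma>"
  shows "(\<Sum>t<nmem \<sigma> 14 0. rmem \<sigma> 3 t) \<le> (1 + x) * (\<Sum>t | t < nmem \<sigma> 14 0 \<and> nmem \<sigma> 6 t \<noteq> 0. rmem \<sigma> 3 t)"
proof -
  have li: "lists L {} \<sigma>" and we: "weights L {} \<sigma>" and co: "\<And>i. count L \<sigma> i" and top: "\<forall>j>nmem \<sigma> 15 0. L j = []"
    using re by (auto simp: ready_def mid_def)
  let ?N = "nmem \<sigma> 14 0"
  define i where "i = Suc (nmem \<sigma> 15 0)"
  let ?V = "{t. t < ?N \<and> nmem \<sigma> 6 t \<noteq> 0}" and ?W = "{t. t < ?N \<and> nmem \<sigma> 6 t = 0}"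
  let ?A = "\<lambda>l. {t. t \<in> set (L l) \<and> (nmem \<sigma> 6 t \<noteq> 0 \<and> nmem \<sigma> 7 t \<noteq> 0)}"
  let ?D = "\<lambda>l. {t. t \<in> set (L l) \<and> nmem \<sigma> 6 t = 0}"
  have wt: "rmem \<sigma> 3 t \<le> p j" "nmem \<sigma> 6 t \<noteq> 0 \<Longrightarrow> nmem \<sigma> 7 t \<noteq> 0 \<Longrightarrow> rmem \<sigma> 3 t = p j" if "t \<in> set (L j)" for t j
    using we that by (auto simp: weights_def)
  have nn: "0 \<le> rmem \<sigma> 3 t" if "t < ?N" for t using we that by (auto simp: weights_def)
  have LN: "t < ?N" if "t \<in> set (L j)" for t j using li that by (auto simp: lists_def)
  have Li: "l < i" if "t \<in> set (L l)" for t l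
    using top that unfolding i_def by (metis empty_iff list.set(1) not_less_eq)
  have "(\<Sum>t\<in>?W. rmem \<sigma> 3 t) = (\<Sum>t | \<exists>l<i. t \<in> set (L l) \<and> nmem \<sigma> 6 t = 0. rmem \<sigma> 3 t)"
  proof (rule sum.mono_neutral_right)
    show "\<forall>t\<in>?W - {t. \<exists>l<i. t \<in> set (L l) \<and> nmem \<sigma> 6 t = 0}. rmem \<sigma> 3 t = 0"
    proof
      fix t assume t: "t \<in> ?W - {t. \<exists>l<i. t \<in> set (L l) \<and> nmem \<sigma> 6 t = 0}"
      then have "\<forall>j. t \<notin> set (L j)" using Li by blast
      then show "rmem \<sigma> 3 t = 0" using we t by (auto simp: weights_def)
    qed
  qed (use LN in auto)
  also have "\<dots> = (\<Sum>l<i. \<Sum>t\<in>?D l. rmem \<sigma> 3 t)" by (rule lists_sum[OF li])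
  also have "\<dots> \<le> (\<Sum>l<i. real (nmem \<sigma> 13 l) * p l)"
  proof (rule sum_mono)
    fix l
    have "(\<Sum>t\<in>?D l. rmem \<sigma> 3 t) \<le> (\<Sum>t\<in>?D l. p l)" by (rule sum_mono) (use wt in auto)
    then show "(\<Sum>t\<in>?D l. rmem \<sigma> 3 t) \<le> real (nmem \<sigma> 13 l) * p l" using co[of l] by (simp add: count_def)
  qed
  also have "\<dots> \<le> x * (\<Sum>l<i. real (nmem \<sigma> 12 l) * p l)"
    by (rule abel_bound) (use ba in \<open>simp add: balanced_def PA_def PD_def\<close>)
  also have "(\<Sum>l<i. real (nmem \<sigma> 12 l) * p l) = (\<Sum>l<i. \<Sum>t\<in>?A l. rmem \<sigma> 3 t)"
  proof (rule sum.cong)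
    fix l
    have "(\<Sum>t\<in>?A l. rmem \<sigma> 3 t) = (\<Sum>t\<in>?A l. p l)" by (rule sum.cong) (use wt in auto)
    then show "real (nmem \<sigma> 12 l) * p l = (\<Sum>t\<in>?A l. rmem \<sigma> 3 t)" using co[of l] by (simp add: count_def)
  qed simp
  also have "(\<Sum>l<i. \<Sum>t\<in>?A l. rmem \<sigma> 3 t) = (\<Sum>t | \<exists>l<i. t \<in> set (L l) \<and> (nmem \<sigma> 6 t \<noteq> 0 \<and> nmem \<sigma> 7 t \<noteq> 0). rmem \<sigma> 3 t)"
    by (rule lists_sum[OF li, symmetric])
  also have "\<dots> \<le> (\<Sum>t\<in>?V. rmem \<sigma> 3 t)"
    by (rule sum_mono2) (use LN nn in auto)
  finally have "(\<Sum>t\<in>?W. rmem \<sigma> 3 t) \<le> x * (\<Sum>t\<in>?V. rmem \<sigma> 3 t)"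
    using x_pos by (simp add: mult_left_mono)
  moreover have "(\<Sum>t<?N. rmem \<sigma> 3 t) = (\<Sum>t\<in>?V. rmem \<sigma> 3 t) + (\<Sum>t\<in>?W. rmem \<sigma> 3 t)"
    by (subst sum.union_disjoint[symmetric]) (auto intro: sum.cong)
  ultimately show ?thesis by (simp add: algebra_simps)
qed

text \<open>Each live element lies in a set of any cover, and no set is overloaded, so the live
  weight \<open>W\<close> is a lower bound for every cover. Conversely, summing the set weights
  counts each element at most \<open>f\<close> times; tightness and deleted weight account for the
  two factors \<open>1 + x\<close>.\<close>

lemma inv_solution:
  assumes inv: "inv X \<sigma>"
  shows "solution \<sigma> \<subseteq> {..<m}" "cover X (solution \<sigma>)"
    "total_cost c (solution \<sigma>) \<le> (1 + x) * (1 + x) * real f * OPT m c X"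
proof -
  obtain L where re: "ready 0 L {} \<sigma>" using inv by (auto simp: inv_def)
  have ba: "balanced \<sigma>" and lk: "link X \<sigma>" using inv by (auto simp: inv_def)
  have li: "lists L {} \<sigma>" and we: "weights L {} \<sigma>" and se: "sets 0 L \<sigma>" and sy: "sys \<sigma>"
    using re by (auto simp: ready_def mid_def)
  let ?N = "nmem \<sigma> 14 0" and ?I = "solution \<sigma>"
  let ?V = "{t. t < ?N \<and> nmem \<sigma> 6 t \<noteq> 0}"
  show Im: "?I \<subseteq> {..<m}" using se by (auto simp: solution_def sets_def)
  have el: "nmem \<sigma> 10 e \<in> ?V" "SS \<sigma> (nmem \<sigma> 10 e) = {s. e \<in> snd X s}" if "e \<in> fst X" for e
    using lk that by (auto simp: link_def)
  show cov: "cover X ?I"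
    unfolding cover_def
  proof
    fix e assume e: "e \<in> fst X"
    let ?t = "nmem \<sigma> 10 e"
    have "?t \<in> set (L (nmem \<sigma> 8 ?t))" using li el(1)[OF e] by (simp add: lists_def)
    then have "\<exists>s\<in>SS \<sigma> ?t. nmem \<sigma> 2 s \<noteq> 0"
      using se el(1)[OF e] unfolding sets_def by blast
    then show "\<exists>s\<in>?I. e \<in> snd X s" using el(2)[OF e] by (auto simp: solution_def)
  qed
  have nn: "0 \<le> rmem \<sigma> 3 t" if "t < ?N" for t using we that by (auto simp: weights_def)
  have w: "rmem \<sigma> 2 s = (\<Sum>t<?N. if s \<in> SS \<sigma> t then rmem \<sigma> 3 t else 0)" if "s < m" for s
  proof -
    have "rmem \<sigma> 2 s = (\<Sum>t\<in>{t \<in> {..<?N}. s \<in> SS \<sigma> t}. rmem \<sigma> 3 t)"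
      using we that by (simp add: weights_def wsum_def load_def)
    also have "\<dots> = (\<Sum>t<?N. if s \<in> SS \<sigma> t then rmem \<sigma> 3 t else 0)" by (rule sum.inter_filter) simp
    finally show ?thesis .
  qed
  have w0: "0 \<le> rmem \<sigma> 2 s" if "s < m" for s unfolding w[OF that] by (rule sum_nonneg) (use nn in auto)
  define W where "W = (\<Sum>t\<in>?V. rmem \<sigma> 3 t)"
  have W_le: "W \<le> total_cost c J" if J: "J \<subseteq> {..<m}" "cover X J" for J
  proof -
    have fJ: "finite J" using J(1) finite_subset by blast
    have "W \<le> (\<Sum>t\<in>?V. \<Sum>s\<in>J. if s \<in> SS \<sigma> t then rmem \<sigma> 3 t else 0)"
      unfolding W_def
    proof (rule sum_mono)
      fix t assume t: "t \<in> ?V"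
      then obtain e where e: "e \<in> fst X" "t = nmem \<sigma> 10 e" using lk by (auto simp: link_def)
      then obtain s where s: "s \<in> J" "s \<in> SS \<sigma> t" using J(2) el(2)[OF e(1)] by (auto simp: cover_def)
      have "(if s \<in> SS \<sigma> t then rmem \<sigma> 3 t else 0) \<le> (\<Sum>s\<in>J. if s \<in> SS \<sigma> t then rmem \<sigma> 3 t else 0)"
        by (rule member_le_sum) (use s t nn fJ in auto)
      then show "rmem \<sigma> 3 t \<le> (\<Sum>s\<in>J. if s \<in> SS \<sigma> t then rmem \<sigma> 3 t else 0)" using s by simp
    qed
    also have "\<dots> = (\<Sum>s\<in>J. \<Sum>t\<in>?V. if s \<in> SS \<sigma> t then rmem \<sigma> 3 t else 0)" by (rule sum.swap)
    also have "\<dots> \<le> (\<Sum>s\<in>J. c s)"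
    proof (rule sum_mono)
      fix s assume "s \<in> J"
      then have sm: "s < m" using J(1) by auto
      have "(\<Sum>t\<in>?V. if s \<in> SS \<sigma> t then rmem \<sigma> 3 t else 0) \<le> (\<Sum>t<?N. if s \<in> SS \<sigma> t then rmem \<sigma> 3 t else 0)"
        by (rule sum_mono2) (use nn in auto)
      also have "\<dots> = rmem \<sigma> 2 s" using w[OF sm] by simp
      also have "\<dots> \<le> c s" using we sm by (auto simp: weights_def)
      finally show "(\<Sum>t\<in>?V. if s \<in> SS \<sigma> t then rmem \<sigma> 3 t else 0) \<le> c s" .
    qed
    finally show ?thesis by (simp add: total_cost_def)
  qed
  have "total_cost c ?I \<le> (\<Sum>s\<in>?I. (1 + x) * rmem \<sigma> 2 s)"
    unfolding total_cost_def by (rule sum_mono) (use se in \<open>auto simp: sets_def tight_def solution_def\<close>)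
  also have "\<dots> \<le> (\<Sum>s<m. (1 + x) * rmem \<sigma> 2 s)"
    by (rule sum_mono2) (use Im w0 x_pos in auto)
  also have "\<dots> = (1 + x) * (\<Sum>s<m. rmem \<sigma> 2 s)" by (simp add: sum_distrib_left)
  also have "(\<Sum>s<m. rmem \<sigma> 2 s) = (\<Sum>s<m. \<Sum>t<?N. if s \<in> SS \<sigma> t then rmem \<sigma> 3 t else 0)"
    by (rule sum.cong) (use w in auto)
  also have "\<dots> = (\<Sum>t<?N. \<Sum>s<m. if s \<in> SS \<sigma> t then rmem \<sigma> 3 t else 0)" by (rule sum.swap)
  also have "\<dots> \<le> (\<Sum>t<?N. real f * rmem \<sigma> 3 t)"
  proof (rule sum_mono)
    fix t assume t: "t \<in> {..<?N}"
    have sub: "SS \<sigma> t \<subseteq> {..<m}" "card (SS \<sigma> t) \<le> f" using sysD[OF sy, of t] t by auto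
    have "(\<Sum>s<m. if s \<in> SS \<sigma> t then rmem \<sigma> 3 t else 0) = (\<Sum>s\<in>SS \<sigma> t. rmem \<sigma> 3 t)"
      by (rule sum.mono_neutral_cong_right) (use sub in auto)
    also have "\<dots> \<le> real f * rmem \<sigma> 3 t" using sub(2) nn t by (simp add: mult_right_mono)
    finally show "(\<Sum>s<m. if s \<in> SS \<sigma> t then rmem \<sigma> 3 t else 0) \<le> real f * rmem \<sigma> 3 t" .
  qed
  also have "\<dots> = real f * (\<Sum>t<?N. rmem \<sigma> 3 t)" by (simp add: sum_distrib_left)
  also have "\<dots> \<le> real f * ((1 + x) * W)"
    unfolding W_def by (rule mult_left_mono[OF dead_weight[OF re ba]]) simp
  finally have main: "total_cost c ?I \<le> (1 + x) * (real f * ((1 + x) * W))"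
    using x_pos by (simp add: mult_left_mono)
  \<comment> \<open>The minimum is attained: only finitely many costs occur, and the solution itself
    shows that there is a cover.\<close>
  have "OPT m c X \<in> {total_cost c J | J. J \<subseteq> {..<m} \<and> cover X J}"
    unfolding OPT_def
  proof (rule Min_in)
    have "{total_cost c J | J. J \<subseteq> {..<m} \<and> cover X J} \<subseteq> total_cost c ` Pow {..<m}" by auto
    then show "finite {total_cost c J | J. J \<subseteq> {..<m} \<and> cover X J}" by (rule finite_subset) simp
    show "{total_cost c J | J. J \<subseteq> {..<m} \<and> cover X J} \<noteq> {}" using Im cov by blast
  qed
  then have "W \<le> OPT m c X" using W_le by auto
  then have "(1 + x) * (real f * ((1 + x) * W)) \<le> (1 + x) * (real f * ((1 + x) * OPT m c X))"
    using x_pos by (intro mult_left_mono) auto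
  with main show "total_cost c ?I \<le> (1 + x) * (1 + x) * real f * OPT m c X"
    by (simp add: mult_ac)
qed

section \<open>Processing a sequence of updates\<close>

text \<open>Loading an update overwrites array 1, and the program then writes entry 0 of real array
  4; the invariant and the potential depend on neither.\<close>

lemma inv_cong:
  assumes inv: "inv X \<sigma>" and eq: "\<And>a. a \<noteq> 1 \<Longrightarrow> nmem \<sigma>' a = nmem \<sigma> a" "\<And>a. a \<noteq> 4 \<Longrightarrow> rmem \<sigma>' a = rmem \<sigma> a"
    "\<And>j. 0 < j \<Longrightarrow> rmem \<sigma>' 4 j = rmem \<sigma> 4 j"
  shows "inv X \<sigma>'" "potential \<sigma>' = potential \<sigma>"
proof -
  obtain L where re: "ready 0 L {} \<sigma>" using inv by (auto simp: inv_def)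
  have "ready 0 L {} \<sigma>'" by (rule ready_cong[OF re]) (simp_all add: eq)
  moreover have "link X \<sigma>'" by (rule link_cong) (use inv in \<open>simp_all add: inv_def eq\<close>)
  moreover have "balanced \<sigma>'" using inv by (simp add: inv_def balanced_def PA_def PD_def eq)
  moreover have "pw_upto (nmem \<sigma>' 15 0) \<sigma>'" using inv by (simp add: inv_def pw_upto_def eq)
  ultimately show "inv X \<sigma>'" by (auto simp: inv_def)
  show "potential \<sigma>' = potential \<sigma>" by (rule potential_cong) (simp_all add: eq)
qed

text \<open>The extra 9 is the cost of the initial write and of the test of the operation code, 4
  and 5 units.\<close>

lemma program_step:
  assumes inv: "inv X \<sigma>" and v: "valid_update m f X v" and n: "card (fst (apply_update v X)) \<le> n"
  shows "\<exists>t \<sigma>'. exec program (load_update v \<sigma>) t \<sigma>' \<and> inv (apply_update v X) \<sigma>' \<and>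
    t + potential \<sigma>' \<le> potential \<sigma> + (update_cost + 9)"
proof -
  let ?\<sigma>0 = "load_update v \<sigma>"
  let ?\<sigma>1 = "rset 4 0 1 ?\<sigma>0"
  have inv1: "inv X ?\<sigma>1" and pot1: "potential ?\<sigma>1 = potential \<sigma>"
    by (rule inv_cong[OF inv]; simp add: load_update_def)+
  have n1: "nmem ?\<sigma>1 1 i = (if i < length (encode_update v) then encode_update v ! i else 0)" for i
    by (simp add: load_update_def)
  let ?k = "potential \<sigma> + update_cost"
  let ?post = "\<lambda>\<sigma>' k'. inv (apply_update v X) \<sigma>' \<and> ?k + potential \<sigma>' \<le> k' + potential \<sigma> + update_cost"
  have "wp program ?post ?\<sigma>0 (?k + 9)"
  proof (cases v)
    case (Delete e)
    have "wp delete ?post ?\<sigma>1 ?k"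
      using wp_delete[OF inv1, of e ?k] v n1[of 1] Delete unfolding pot1 by simp
    then show ?thesis
      using n1[of 0] Delete by (simp add: program_def numeral_2_eq_2[symmetric])
  next
    case (Insert e ss)
    have "nmem ?\<sigma>1 1 1 = e" "nmem ?\<sigma>1 1 2 = length ss" using n1[of 1] n1[of 2] Insert by simp_all
    moreover have "nmem ?\<sigma>1 1 (i + 3) = ss ! i" if "i < length ss" for i
      using n1[of "i + 3"] Insert that by (simp add: numeral_eq_Suc)
    ultimately have "wp insert_element ?post ?\<sigma>1 ?k"
      using wp_insert_element[OF inv1, of e ss ?k] v n Insert unfolding pot1 by simp
    then show ?thesis
      using n1[of 0] Insert by (simp add: program_def numeral_2_eq_2[symmetric])
  qed
  then obtain t \<sigma>' where t: "exec program ?\<sigma>0 t \<sigma>'" "t \<le> ?k + 9" "inv (apply_update v X) \<sigma>'"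
    "?k + potential \<sigma>' \<le> ?k + 9 - t + potential \<sigma> + update_cost"
    by (auto simp: wp_def)
  then have "t + potential \<sigma>' \<le> potential \<sigma> + (update_cost + 9)" by linarith
  with t show ?thesis by blast
qed

text \<open>The bounds of \<open>program_step\<close> telescope. Allowing an arbitrary starting
  state, with its potential on the right, makes the induction go through.\<close>

lemma program_run:
  assumes "inv X \<sigma>"
    and "\<And>k. k < length us \<Longrightarrow> valid_update m f (fold apply_update (take k us) X) (us ! k)"
    and "\<And>k. k \<le> length us \<Longrightarrow> card (fst (fold apply_update (take k us) X)) \<le> n"
  shows "\<exists>rs. process program \<sigma> us rs \<and> length rs = length us \<and>
    (\<forall>k<length us. inv (fold apply_update (take (Suc k) us) X) (snd (rs ! k))) \<and>
    (\<forall>k\<le>length us. sum_list (take k (map fst rs)) \<le> potential \<sigma> + k * (update_cost + 9))"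
  using assms
proof (induction us arbitrary: X \<sigma>)
  case (Cons v us)
  have "valid_update m f X v" using Cons.prems(2)[of 0] by simp
  moreover have "card (fst (apply_update v X)) \<le> n" using Cons.prems(3)[of 1] by simp
  ultimately obtain t \<sigma>' where step: "exec program (load_update v \<sigma>) t \<sigma>'" "inv (apply_update v X) \<sigma>'"
    "t + potential \<sigma>' \<le> potential \<sigma> + (update_cost + 9)"
    using program_step[OF Cons.prems(1)] by blast
  have "\<exists>rs. process program \<sigma>' us rs \<and> length rs = length us \<and>
    (\<forall>k<length us. inv (fold apply_update (take (Suc k) us) (apply_update v X)) (snd (rs ! k))) \<and>
    (\<forall>k\<le>length us. sum_list (take k (map fst rs)) \<le> potential \<sigma>' + k * (update_cost + 9))"
  proof (rule Cons.IH[OF step(2)])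
    fix k assume "k < length us"
    then show "valid_update m f (fold apply_update (take k us) (apply_update v X)) (us ! k)"
      using Cons.prems(2)[of "Suc k"] by simp
  next
    fix k assume "k \<le> length us"
    then show "card (fst (fold apply_update (take k us) (apply_update v X))) \<le> n"
      using Cons.prems(3)[of "Suc k"] by simp
  qed
  then obtain rs where rs: "process program \<sigma>' us rs" "length rs = length us"
    "\<And>k. k < length us \<Longrightarrow> inv (fold apply_update (take (Suc k) us) (apply_update v X)) (snd (rs ! k))"
    "\<And>k. k \<le> length us \<Longrightarrow> sum_list (take k (map fst rs)) \<le> potential \<sigma>' + k * (update_cost + 9)"
    by blast
  show ?case
  proof (intro exI[of _ "(t, \<sigma>') # rs"] conjI allI impI)
    show "process program \<sigma> (v # us) ((t, \<sigma>') # rs)" using step(1) rs(1) by auto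
    show "length ((t, \<sigma>') # rs) = length (v # us)" using rs(2) by simp
    show "inv (fold apply_update (take (Suc k) (v # us)) X) (snd (((t, \<sigma>') # rs) ! k))" if "k < length (v # us)" for k
      using that step(2) rs(3)[of "k - 1"] by (cases k) auto
    show "sum_list (take k (map fst ((t, \<sigma>') # rs))) \<le> potential \<sigma> + k * (update_cost + 9)"
      if "k \<le> length (v # us)" for k
    proof (cases k)
      case (Suc k')
      then show ?thesis using rs(4)[of k'] that step(3) by simp
    qed simp
  qed
qed simp

lemma inv_initial:
  assumes "x = \<epsilon> / 4"
  shows "inv ({}, \<lambda>s. {}) (initial_mem \<epsilon> C f m c)" "potential (initial_mem \<epsilon> C f m c) = 0"
proof -
  let ?\<sigma> = "initial_mem \<epsilon> C f m c"
  have e: "nmem ?\<sigma> a i = 0" if "a \<noteq> 0" for a i using that by (simp add: initial_mem_def)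
  have r: "rmem ?\<sigma> a i = 0" if "1 < a" for a i using that by (simp add: initial_mem_def)
  have "prm ?\<sigma>" using assms by (simp add: prm_def initial_mem_def)
  moreover have "sys ?\<sigma>" "lists (\<lambda>_. []) {} ?\<sigma>"
    by (simp_all add: sys_def lists_def e)
  moreover have "0 \<le> c s" if "s < m" for s
    using c_ge[OF that] C by (meson divide_nonneg_pos less_trans order_trans zero_less_one zero_le_one)
  then have "weights (\<lambda>_. []) {} ?\<sigma>"
    by (simp add: weights_def wsum_def load_def e r)
  moreover have "sets 0 (\<lambda>_. []) ?\<sigma>" by (simp add: sets_def e)
  moreover have "count (\<lambda>_. []) ?\<sigma> i" for i by (simp add: count_def e)
  ultimately have "ready 0 (\<lambda>_. []) {} ?\<sigma>" by (simp add: ready_def mid_def e)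
  moreover have "pw_upto (nmem ?\<sigma> 15 0) ?\<sigma>" by (simp add: pw_upto_def e)
  moreover have "balanced ?\<sigma>" by (simp add: balanced_def PA_def PD_def e)
  moreover have "link ({}, \<lambda>s. {}) ?\<sigma>" by (simp add: link_def e)
  ultimately show "inv ({}, \<lambda>s. {}) ?\<sigma>" by (auto simp: inv_def)
  show "potential ?\<sigma> = 0" by (simp add: potential_def PD_def e)
qed

end

section \<open>Numerical estimate of the amortized cost\<close>

lemma update_cost_bound:
  fixes \<epsilon> C :: real and f n :: nat
  assumes \<epsilon>: "0 < \<epsilon>" "\<epsilon> < 1 / 2" and C: "1 < C" and n: "2 \<le> n" and f: "1 \<le> f"
    and M: "real M \<le> 4 / \<epsilon> + 1" and B: "real B \<le> ln ((1 + \<epsilon> / 4) * C * real n) / ln (1 + \<epsilon> / 4)"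
  shows "real (10 * (1000 * f * (M + 1) * (B + 5)) + 9) \<le> 2000000 * (real f * ln (C * real n) / \<epsilon>\<^sup>2)"
proof -
  define l where "l = ln (C * real n)"
  \<comment> \<open>With \<open>n\<close> at least 2 the logarithm is at least \<open>1 / 2\<close>,
    so additive constants can be absorbed into it.\<close>
  have "ln 2 \<le> l"
  proof -
    have "2 \<le> real n" using n by simp
    also have "real n \<le> C * real n" using C n by simp
    finally show ?thesis unfolding l_def by simp
  qed
  moreover have "1 / 2 \<le> ln (2 :: real)" using ln_le_minus_one[of "1 / 2 :: real"] by (simp add: ln_div)
  ultimately have l: "1 / 2 \<le> l" by linarith
  \<comment> \<open>From \<open>ln (1 + y) \<ge> y - y\<^sup>2\<close> at
    \<open>y = \<epsilon> / 4\<close>, where the square takes away at most half.\<close>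
  have L1: "\<epsilon> / 8 \<le> ln (1 + \<epsilon> / 4)"
  proof -
    have "\<epsilon> / 4 - (\<epsilon> / 4)\<^sup>2 \<le> ln (1 + \<epsilon> / 4)"
      by (rule ln_one_plus_pos_lower_bound) (use \<epsilon> in auto)
    moreover have "(\<epsilon> / 4)\<^sup>2 \<le> \<epsilon> / 8"
      using \<epsilon> by (simp add: power2_eq_square)
    ultimately show ?thesis by simp
  qed
  have "ln ((1 + \<epsilon> / 4) * C * real n) = ln (1 + \<epsilon> / 4) + l"
    unfolding l_def using \<epsilon> C n by (simp add: ln_mult mult.assoc)
  then have "ln ((1 + \<epsilon> / 4) * C * real n) / ln (1 + \<epsilon> / 4) = 1 + l / ln (1 + \<epsilon> / 4)"
    using L1 \<epsilon> by (simp add: add_divide_distrib)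
  also have "\<dots> \<le> 1 + l / (\<epsilon> / 8)"
    using L1 \<epsilon> l by (intro add_left_mono divide_left_mono) auto
  finally have "real B + 5 \<le> 6 + 8 * l / \<epsilon>" using B by (simp add: mult.commute)
  also have "\<dots> \<le> 14 * l / \<epsilon>"
  proof -
    have "6 * \<epsilon> \<le> 6 * l" using \<epsilon> l by simp
    then have "6 \<le> 6 * l / \<epsilon>" using \<epsilon> by (simp add: pos_le_divide_eq)
    then show ?thesis by (simp add: add_divide_distrib[symmetric])
  qed
  finally have b: "real B + 5 \<le> 14 * l / \<epsilon>" .
  have a: "real M + 1 \<le> 5 / \<epsilon>"
  proof -
    have "2 * \<epsilon> \<le> 1" using \<epsilon> by simp
    then have "2 \<le> 1 / \<epsilon>" using \<epsilon> by (simp add: pos_le_divide_eq)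
    then show ?thesis using M by (simp add: add_divide_distrib[symmetric])
  qed
  have "(real M + 1) * (real B + 5) \<le> (5 / \<epsilon>) * (14 * l / \<epsilon>)"
    using a b \<epsilon> by (intro mult_mono) auto
  then have "real f * ((real M + 1) * (real B + 5)) \<le> real f * ((5 / \<epsilon>) * (14 * l / \<epsilon>))"
    by (rule mult_left_mono) simp
  then have main: "real f * ((real M + 1) * (real B + 5)) \<le> 70 * (real f * l / \<epsilon>\<^sup>2)"
    by (simp add: power2_eq_square mult.left_commute)
  have "1 / 2 * 1 \<le> real f * l" using mult_mono[of 1 "real f" "1 / 2" l] f l by simp
  moreover have "\<epsilon>\<^sup>2 \<le> 1" using \<epsilon> by (simp add: power_le_one)
  ultimately have "\<epsilon>\<^sup>2 * (1 / 2) \<le> real f * l" using \<epsilon> by (simp add: mult_mono order_trans)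
  then have "1 / 2 \<le> real f * l / \<epsilon>\<^sup>2" using \<epsilon> by (simp add: pos_le_divide_eq mult.commute)
  \<comment> \<open>\<open>10 * 1000 * 70 = 700000\<close>, and the 9 is at most
    \<open>18 * z\<close>; the constant 2000000 is generous.\<close>
  moreover have scale: "y \<le> 70 * z \<Longrightarrow> 1 / 2 \<le> z \<Longrightarrow> 10 * (1000 * y) + 9 \<le> 2000000 * z" for y z :: real
    by linarith
  ultimately have "10 * (1000 * (real f * ((real M + 1) * (real B + 5)))) + 9 \<le> 2000000 * (real f * l / \<epsilon>\<^sup>2)"
    using main scale by blast
  moreover have "real (10 * (1000 * f * (M + 1) * (B + 5)) + 9) =
      10 * (1000 * (real f * ((real M + 1) * (real B + 5)))) + 9"
    by (simp add: algebra_simps)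
  ultimately show ?thesis by (simp only: l_def)
qed

section \<open>Choice of the parameters and conclusion\<close>

theorem theorem1p1:
  "\<exists>K>0. \<forall>\<epsilon>::real. 0 < \<epsilon> \<and> \<epsilon> < 1 / 2 \<longrightarrow>
    (\<exists>P::com. \<forall>(C::real) (f::nat) (m::nat) (c::nat \<Rightarrow> real) (us::update list).
      C > 1 \<and> (\<forall>s<m. 1 / C \<le> c s \<and> c s \<le> 1) \<and> valid_updates m f us \<longrightarrow>
      (\<exists>rs. process P (initial_mem \<epsilon> C f m c) us rs \<and>
        (\<forall>k<length us.
          let X = system_after (take (Suc k) us);
              I = solution (snd (rs ! k))
          in I \<subseteq> {..<m} \<and> cover X I \<and>
             total_cost c I \<le> (1 + \<epsilon>) * real f * OPT m c X) \<and>
        amortized_time (map fst rs)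
          (K * (real f * ln (C * real (max 2 (max_elements us))) / \<epsilon>\<^sup>2))))"
proof (rule exI[of _ "2000000 :: real"], intro conjI allI impI, goal_cases)
  case (2 \<epsilon>)
  then have \<epsilon>: "0 < \<epsilon>" "\<epsilon> < 1 / 2" by auto
  show ?case
  \<comment> \<open>The accuracy is read from memory, so the same program serves every
    \<open>\<epsilon>\<close>.\<close>
  proof (rule exI[of _ program], intro allI impI, elim conjE)
    fix C :: real and f m :: nat and c :: "nat \<Rightarrow> real" and us :: "update list"
    assume C: "1 < C" and c: "\<forall>s<m. 1 / C \<le> c s \<and> c s \<le> 1" and us: "valid_updates m f us"
    define n where "n = max 2 (max_elements us)"
    define x where "x = \<epsilon> / 4"
    define M where "M = nat \<lceil>1 / x\<rceil>"
    define B where "B = nat \<lfloor>ln ((1 + x) * C * real n) / ln (1 + x)\<rfloor>"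
    have x: "0 < x" "x \<le> 1" using \<epsilon> by (auto simp: x_def)
    have n2: "2 \<le> n" by (simp add: n_def)
    have lnx: "0 < ln (1 + x)" using x by simp
    have Y: "1 \<le> (1 + x) * C * real n"
    proof -
      have "1 * 1 \<le> (1 + x) * C" using x C by (intro mult_mono) auto
      then have "1 * 1 \<le> (1 + x) * C * real n" using n2 x C by (intro mult_mono) auto
      then show ?thesis by simp
    qed
    interpret dynamic_cover x C f m n B M c
    proof
      fix j :: nat assume j: "(1 + x) ^ j \<le> (1 + x) * C * real n"
      have "real j * ln (1 + x) = ln ((1 + x) ^ j)" using x by (simp add: ln_realpow)
      also have "\<dots> \<le> ln ((1 + x) * C * real n)" using j x Y by (intro ln_mono) auto
      finally have "real j \<le> ln ((1 + x) * C * real n) / ln (1 + x)" using lnx by (simp add: pos_le_divide_eq)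
      then show "j \<le> B" unfolding B_def by (simp add: le_nat_floor)
    next
      have "1 / x \<le> real M" unfolding M_def by (rule real_nat_ceiling_ge)
      then show "1 \<le> x * real M" using x by (simp add: field_simps)
    qed (use x C c in auto)
    have "\<exists>rs. process program (initial_mem \<epsilon> C f m c) us rs \<and> length rs = length us \<and>
      (\<forall>k<length us. inv (fold apply_update (take (Suc k) us) ({}, \<lambda>s. {})) (snd (rs ! k))) \<and>
      (\<forall>k\<le>length us. sum_list (take k (map fst rs)) \<le> potential (initial_mem \<epsilon> C f m c) + k * (update_cost + 9))"
    proof (rule program_run)
      show "inv ({}, \<lambda>s. {}) (initial_mem \<epsilon> C f m c)" by (rule inv_initial) (rule x_def)
    next
      fix k assume "k < length us"
      then show "valid_update m f (fold apply_update (take k us) ({}, \<lambda>s. {})) (us ! k)"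
        using us by (simp add: valid_updates_def system_after_def)
    next
      fix k assume k: "k \<le> length us"
      have "card (fst (system_after (take k us))) \<le> max_elements us"
        unfolding max_elements_def by (rule Max_ge) (use k in auto)
      then show "card (fst (fold apply_update (take k us) ({}, \<lambda>s. {}))) \<le> n"
        by (simp add: n_def system_after_def)
    qed
    then obtain rs where rs: "process program (initial_mem \<epsilon> C f m c) us rs" "length rs = length us"
      "\<And>k. k < length us \<Longrightarrow> inv (system_after (take (Suc k) us)) (snd (rs ! k))"
      "\<And>k. k \<le> length us \<Longrightarrow> sum_list (take k (map fst rs)) \<le> k * (update_cost + 9)"
      using inv_initial(2)[OF x_def] by (auto simp: system_after_def)
    let ?t = "2000000 * (real f * ln (C * real (max 2 (max_elements us))) / \<epsilon>\<^sup>2)"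
    show "\<exists>rs. process program (initial_mem \<epsilon> C f m c) us rs \<and>
        (\<forall>k<length us.
          let X = system_after (take (Suc k) us);
              I = solution (snd (rs ! k))
          in I \<subseteq> {..<m} \<and> cover X I \<and>
             total_cost c I \<le> (1 + \<epsilon>) * real f * OPT m c X) \<and>
        amortized_time (map fst rs) ?t"
    proof (intro exI[of _ rs] conjI allI impI)
      show "process program (initial_mem \<epsilon> C f m c) us rs" by (rule rs(1))
    next
      fix k assume k: "k < length us"
      let ?X = "system_after (take (Suc k) us)" and ?I = "solution (snd (rs ! k))"
      note sol = inv_solution[OF rs(3)[OF k]]
      have "0 \<le> total_cost c ?I"
        unfolding total_cost_def
      proof (rule sum_nonneg)
        fix s assume "s \<in> ?I"
        then have "1 / C \<le> c s" using sol(1) c by auto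
        moreover have "0 \<le> 1 / C" using C by simp
        ultimately show "0 \<le> c s" by linarith
      qed
      then have "0 \<le> (1 + x) * (1 + x) * (real f * OPT m c ?X)" using sol(3) by (simp add: mult.assoc)
      moreover have "0 < (1 + x) * (1 + x)" using x by simp
      \<comment> \<open>The sign is read off from the approximation bound itself, because the
        solution has nonnegative cost.\<close>
      ultimately have o: "0 \<le> real f * OPT m c ?X"
        by (meson mult_pos_neg not_le)
      have "x * x \<le> 2 * x" using x by (intro mult_right_mono) auto
      then have "(1 + x) * (1 + x) \<le> 1 + \<epsilon>" by (simp add: x_def algebra_simps)
      then have "(1 + x) * (1 + x) * (real f * OPT m c ?X) \<le> (1 + \<epsilon>) * (real f * OPT m c ?X)"
        by (rule mult_right_mono[OF _ o])
      then show "let X = ?X; I = ?I in I \<subseteq> {..<m} \<and> cover X I \<and> total_cost c I \<le> (1 + \<epsilon>) * real f * OPT m c X"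
        using sol by (simp add: Let_def mult.assoc)
    next
      show "amortized_time (map fst rs) ?t"
        unfolding amortized_time_def
      proof (intro allI impI)
        fix k assume k: "k \<le> length (map fst rs)"
        show "real (sum_list (take k (map fst rs))) \<le> real k * ?t"
        proof (cases "k = 0")
          case False
          then have "us \<noteq> []" using k rs(2) by auto
          then have "valid_update m f (system_after (take 0 us)) (us ! 0)"
            using us unfolding valid_updates_def by (metis length_greater_0_conv)
          \<comment> \<open>The first update acts on the empty system, so it is an insertion, and
            its element lies in at least one and at most \<open>f\<close> sets.\<close>
          then have f: "1 \<le> f"
          proof (cases "us ! 0")
            case (Insert e ss)
            then have "ss \<noteq> []" "length ss \<le> f"
              using \<open>valid_update m f (system_after (take 0 us)) (us ! 0)\<close> by auto
            then show ?thesis by (cases ss) auto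
          qed (simp add: system_after_def)
          have "real (update_cost + 9) \<le> ?t"
            unfolding update_cost_def u_def n_def[symmetric]
          proof (rule update_cost_bound[OF \<epsilon> C n2 f])
            show "real M \<le> 4 / \<epsilon> + 1"
              unfolding M_def using \<epsilon> by (simp add: x_def)
            show "real B \<le> ln ((1 + \<epsilon> / 4) * C * real n) / ln (1 + \<epsilon> / 4)"
              unfolding B_def x_def[symmetric] using Y lnx by (simp add: of_nat_floor)
          qed
          then have "real k * real (update_cost + 9) \<le> real k * ?t" by (rule mult_left_mono) simp
          moreover have "real (sum_list (take k (map fst rs))) \<le> real (k * (update_cost + 9))"
            using rs(4)[of k] k rs(2) by (simp only: of_nat_le_iff) simp
          ultimately show ?thesis by simp
        qed simp
      qed
    qed
  qed
qed simp

end
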